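(* Suppose $(N_0,\mathcal{F}_0)$ and $(N_1,\mathcal{F}_1)$ are Molino transverse equivalent singular foliations, with quotient maps $\pi_i:N_i\to N_i/\mathcal{F}_i$. If $\pi_0^*:\Omega^\bullet(N_0/\mathcal{F}_0)\to\Omega_b^\bullet(N_0,\mathcal{F}_0)$ is an isomorphism, then $\pi_1^*:\Omega^\bullet(N_1/\mathcal{F}_1)\to\Omega_b^\bullet(N_1,\mathcal{F}_1)$ is an isomorphism.
   Context: A manifold is a set with a maximal smooth atlas whose topology is Hausdorff and second-countable. Singular foliation: A subset $L\subseteq M$ is a diffeological submanifold if its subspace diffeology (a map $q:O\to L$ from an open subset $O$ of a Cartesian space is a plot iff $q$ is smooth as a map into $M$) is a manifold diffeology, i.e. there is a (necessarily unique) manifold structure on $L$ whose smooth maps $O\to L$ are exactly these plots; $L$ always carries this manifold structure. It is weakly-embedded if moreover the inclusion $L\hookrightarrow M$ is an immersion. A (Stefan) singular foliation of an $n$-dimensional manifold $M$ is a partition $\mathcal{F}$ of $M$ into connected, weakly-embedded submanifolds, called leaves, such that about each $x\in M$ there is a chart $\psi$ of $M$ with: (a) $\psi$ is a diffeomorphism $V\to U\times W$, where $V$ is an open neighbourhood of $x$, $U$ and $W$ are open neighbourhoods of the origin in $\mathbb{R}^k$ and $\mathbb{R}^{n-k}$, and $k$ is the dimension of the leaf through $x$; (b) $\psi(x)=(0,0)$; (c) for every leaf $L$ of $\mathcal{F}$, $\psi(L\cap V)=U\times\ell$ for some $\ell\subseteq W$. Pullback and Molino transverse equivalence: for a surjective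 submersion with connected fibers $p:M\to N$ and a singular foliation $\mathcal{F}$ of $N$, $p^{-1}\mathcal{F}$ is the singular foliation of $M$ whose leaves are the sets $p^{-1}(L)$, $L$ a leaf of $\mathcal{F}$. $(N_0,\mathcal{F}_0)$ and $(N_1,\mathcal{F}_1)$ are Molino transverse equivalent if there exist a singular foliation $(M,\mathcal{F})$ and surjective submersions with connected fibers $p_i:M\to N_i$ such that $p_i^{-1}\mathcal{F}_i=\mathcal{F}$ for $i=0,1$. Basic forms: a vector field $X$ on $M$ is tangent to $\mathcal{F}$ if $X_x\in T_xL$ for every $x$, where $L$ is the leaf through $x$. A form $\alpha\in\Omega^\bullet(M)$ is $\mathcal{F}$-basic if $\iota_X\alpha=0$ and $\mathcal{L}_X\alpha=0$ for every vector field $X$ tangent to $\mathcal{F}$. The basic forms make up a subcomplex $\Omega_b^\bullet(M,\mathcal{F})$ of the de Rham complex. Leaf space and its forms: $N/\mathcal{F}$ is the set of leaves with the quotient diffeology: a map $q:O\to N/\mathcal{F}$ ($O$ open in a Cartesian space) is a plot iff each $r\in O$ has an open neighbourhood $O'$ and a smooth map $\tilde q:O'\to N$ with $q|_{O'}=\pi\circ\tilde q$, $\pi:N\to N/\mathcal{F}$ the quotient map. A diffeological differential $k$-form on a diffeological space $Y$ assigns to each plot $q:O\to Y$ a $k$-form $\alpha(q)\in\Omega^k(O)$ such that $\alpha(q\circ f)=f^*(\alpha(q))$ for every smooth $f:O'\to O$ between open subsets of Cartesian spaces; the differential is defined plotwise, giving the complex $\Omega^\bullet(Y)$, which for a manifold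 $Y$ is identified with the usual de Rham complex. For the quotient map, $(\pi^*\alpha)(q)=\alpha(\pi\circ q)$. It is a known fact that $\pi^*:\Omega^\bullet(N/\mathcal{F})\to\Omega^\bullet(N)$ is injective with image contained in $\Omega_b^\bullet(N,\mathcal{F})$. *)

theory Defs
  imports "HOL-Analysis.Analysis" "HOL-Library.Disjoint_Sets"
begin

section \<open>Calculus on open subsets of Cartesian spaces\<close>

text \<open>
  Dimensions have to be values rather than types here (a foliation has leaves of different
  dimensions, a diffeology has plots from all Cartesian spaces), so the Cartesian space of
  dimension \<open>n\<close> is the library space \<^const>\<open>Euclidean_space\<close>, whose points are
  the sequences \<open>x\<close> with \<open>x i = 0\<close> for \<open>i \<ge> n\<close>.
\<close>

type_synonym vec = "nat \<Rightarrow> real"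

abbreviation cart :: "nat \<Rightarrow> vec set" where
  "cart n \<equiv> topspace (Euclidean_space n)"

definition partial :: "nat \<Rightarrow> (vec \<Rightarrow> real) \<Rightarrow> vec \<Rightarrow> real" where
  "partial i f x = deriv (\<lambda>t. f (x(i := t))) (x i)"

primrec Ck_fun :: "nat \<Rightarrow> nat \<Rightarrow> vec set \<Rightarrow> (vec \<Rightarrow> real) \<Rightarrow> bool" where
  "Ck_fun 0 n O' f \<longleftrightarrow>
     continuous_map (subtopology (Euclidean_space n) O') euclideanreal f"
| "Ck_fun (Suc r) n O' f \<longleftrightarrow>
     continuous_map (subtopology (Euclidean_space n) O') euclideanreal f \<and>
     (\<forall>i<n. (\<forall>x\<in>O'. (\<lambda>t. f (x(i := t))) differentiable (at (x i))) \<and>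
            Ck_fun r n O' (partial i f))"

text \<open>In all that follows, \<open>O'\<close> is meant to be open; values outside \<open>O'\<close> are irrelevant.\<close>

definition smooth_fun :: "nat \<Rightarrow> vec set \<Rightarrow> (vec \<Rightarrow> real) \<Rightarrow> bool" where
  "smooth_fun n O' f \<longleftrightarrow> (\<forall>r. Ck_fun r n O' f)"

definition smooth_cart :: "nat \<Rightarrow> vec set \<Rightarrow> nat \<Rightarrow> (vec \<Rightarrow> vec) \<Rightarrow> bool" where
  "smooth_cart n O' m f \<longleftrightarrow>
     f ` O' \<subseteq> cart m \<and> (\<forall>i<m. smooth_fun n O' (\<lambda>x. f x i))"

definition dir_deriv :: "nat \<Rightarrow> (vec \<Rightarrow> real) \<Rightarrow> vec \<Rightarrow> vec \<Rightarrow> real" where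
  "dir_deriv n f x v = (\<Sum>j<n. v j * partial j f x)"

text \<open>The derivative at \<open>x\<close>, applied to \<open>v\<close>, of a map between the Cartesian spaces of
  dimensions \<open>n\<close> and \<open>m\<close>.\<close>

definition jac :: "nat \<Rightarrow> nat \<Rightarrow> (vec \<Rightarrow> vec) \<Rightarrow> vec \<Rightarrow> vec \<Rightarrow> vec" where
  "jac n m f x v = (\<lambda>i. if i < m then dir_deriv n (\<lambda>y. f y i) x v else 0)"


section \<open>Differential forms on open subsets of Cartesian spaces\<close>

type_synonym lform = "vec \<Rightarrow> vec list \<Rightarrow> real"

text \<open>The value of a \<open>k\<close>-form at a point is an alternating multilinear function of lists of
  \<open>k\<close> vectors. Forms are set to 0 off their domain, so that equal forms are equal functions.\<close>

definition lforms :: "nat \<Rightarrow> nat \<Rightarrow> vec set \<Rightarrow> lform set" where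
  "lforms k n O' = {w.
     (\<forall>x vs. \<not> (x \<in> O' \<and> length vs = k \<and> set vs \<subseteq> cart n) \<longrightarrow> w x vs = 0) \<and>
     (\<forall>x\<in>O'. \<forall>vs i a b u v. length vs = k \<longrightarrow> set vs \<subseteq> cart n \<longrightarrow> i < k \<longrightarrow>
        u \<in> cart n \<longrightarrow> v \<in> cart n \<longrightarrow>
        w x (vs[i := (\<lambda>j. a * u j + b * v j)]) = a * w x (vs[i := u]) + b * w x (vs[i := v])) \<and>
     (\<forall>x\<in>O'. \<forall>vs i j. length vs = k \<longrightarrow> set vs \<subseteq> cart n \<longrightarrow> i < j \<longrightarrow> j < k \<longrightarrow>
        vs ! i = vs ! j \<longrightarrow> w x vs = 0) \<and>
     (\<forall>vs. length vs = k \<longrightarrow> set vs \<subseteq> cart n \<longrightarrow> smooth_fun n O' (\<lambda>x. w x vs))}"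

text \<open>Pullback of a form along \<open>f\<close>, defined on the subset \<open>O'\<close> of the \<open>m\<close>-dimensional
  space, with values in the \<open>n\<close>-dimensional space.\<close>

definition lpull :: "nat \<Rightarrow> vec set \<Rightarrow> nat \<Rightarrow> (vec \<Rightarrow> vec) \<Rightarrow> lform \<Rightarrow> lform" where
  "lpull m O' n f w = (\<lambda>x vs.
     if x \<in> O' \<and> set vs \<subseteq> cart m then w (f x) (map (jac m n f x) vs) else 0)"

text \<open>For constant vector fields the brackets in the invariant formula for the exterior derivative
  vanish, which leaves the alternating sum below.\<close>

definition ldiff :: "nat \<Rightarrow> vec set \<Rightarrow> lform \<Rightarrow> lform" where
  "ldiff n O' w = (\<lambda>x vs.
     if x \<in> O' \<and> set vs \<subseteq> cart n
     then (\<Sum>i<length vs. (-1) ^ i *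
            dir_deriv n (\<lambda>y. w y (take i vs @ drop (Suc i) vs)) x (vs ! i))
     else 0)"

definition lint :: "(vec \<Rightarrow> vec) \<Rightarrow> lform \<Rightarrow> lform" where
  "lint X w = (\<lambda>x vs. w x (X x # vs))"

text \<open>The formula \<open>(L\<^sub>X w)(V\<^sub>1,\<dots>,V\<^sub>k) = X (w(V\<^sub>1,\<dots>,V\<^sub>k)) - (\<Sum>i. w(V\<^sub>1,\<dots>,[X,V\<^sub>i],\<dots>,V\<^sub>k))\<close>,
  evaluated on constant vector fields, where \<open>[X,v] = - (DX) v\<close>.\<close>

definition llie :: "nat \<Rightarrow> vec set \<Rightarrow> (vec \<Rightarrow> vec) \<Rightarrow> lform \<Rightarrow> lform" where
  "llie n O' X w = (\<lambda>x vs.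
     if x \<in> O' \<and> set vs \<subseteq> cart n
     then dir_deriv n (\<lambda>y. w y vs) x (X x) +
          (\<Sum>i<length vs. w x (vs[i := jac n n X x (vs ! i)]))
     else 0)"


section \<open>Manifolds\<close>

text \<open>A chart is a domain together with an injective map, made \<^const>\<open>undefined\<close> off the domain so
  that equal charts are equal pairs.\<close>

type_synonym 'a chart = "'a set \<times> ('a \<Rightarrow> vec)"

abbreviation cdom :: "'a chart \<Rightarrow> 'a set" where "cdom c \<equiv> fst c"
abbreviation cmap :: "'a chart \<Rightarrow> 'a \<Rightarrow> vec" where "cmap c \<equiv> snd c"
abbreviation cimg :: "'a chart \<Rightarrow> vec set" where "cimg c \<equiv> cmap c ` cdom c"
abbreviation cinv :: "'a chart \<Rightarrow> vec \<Rightarrow> 'a" where "cinv c \<equiv> inv_into (cdom c) (cmap c)"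

definition is_chart :: "nat \<Rightarrow> 'a set \<Rightarrow> 'a chart \<Rightarrow> bool" where
  "is_chart n S c \<longleftrightarrow>
     cdom c \<subseteq> S \<and> cmap c \<in> extensional (cdom c) \<and> inj_on (cmap c) (cdom c) \<and>
     openin (Euclidean_space n) (cimg c)"

abbreviation transition :: "'a chart \<Rightarrow> 'a chart \<Rightarrow> vec \<Rightarrow> vec" where
  "transition c c' \<equiv> cmap c' \<circ> cinv c"

definition chart_compatible :: "nat \<Rightarrow> 'a chart \<Rightarrow> 'a chart \<Rightarrow> bool" where
  "chart_compatible n c c' \<longleftrightarrow>
     openin (Euclidean_space n) (cmap c ` (cdom c \<inter> cdom c')) \<and>
     openin (Euclidean_space n) (cmap c' ` (cdom c \<inter> cdom c')) \<and>
     smooth_cart n (cmap c ` (cdom c \<inter> cdom c')) n (transition c c') \<and>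
     smooth_cart n (cmap c' ` (cdom c \<inter> cdom c')) n (transition c' c)"

record 'a manifold =
  mdim :: nat
  mpts :: "'a set"
  atlas :: "'a chart set"

definition mtop :: "'a manifold \<Rightarrow> 'a topology" where
  "mtop M = topology (\<lambda>A. A \<subseteq> mpts M \<and>
     (\<forall>c\<in>atlas M. openin (Euclidean_space (mdim M)) (cmap c ` (A \<inter> cdom c))))"

definition smooth_manifold :: "'a manifold \<Rightarrow> bool" where
  "smooth_manifold M \<longleftrightarrow>
     (\<forall>c\<in>atlas M. is_chart (mdim M) (mpts M) c) \<and>
     \<Union> (cdom ` atlas M) = mpts M \<and>
     (\<forall>c\<in>atlas M. \<forall>c'\<in>atlas M. chart_compatible (mdim M) c c') \<and>
     (\<forall>c. is_chart (mdim M) (mpts M) c \<longrightarrow>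
        (\<forall>c'\<in>atlas M. chart_compatible (mdim M) c c') \<longrightarrow> c \<in> atlas M) \<and>
     Hausdorff_space (mtop M) \<and> second_countable (mtop M)"

definition smooth_into :: "nat \<Rightarrow> vec set \<Rightarrow> 'a manifold \<Rightarrow> (vec \<Rightarrow> 'a) \<Rightarrow> bool" where
  "smooth_into n O' M q \<longleftrightarrow> q ` O' \<subseteq> mpts M \<and>
     (\<forall>r\<in>O'. \<exists>c\<in>atlas M. \<exists>O''. openin (Euclidean_space n) O'' \<and> r \<in> O'' \<and> O'' \<subseteq> O' \<and>
        q ` O'' \<subseteq> cdom c \<and> smooth_cart n O'' (mdim M) (cmap c \<circ> q))"

definition smooth_map :: "'a manifold \<Rightarrow> 'b manifold \<Rightarrow> ('a \<Rightarrow> 'b) \<Rightarrow> bool" where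
  "smooth_map M N f \<longleftrightarrow> (\<forall>c\<in>atlas M. smooth_into (mdim M) (cimg c) N (f \<circ> cinv c))"

text \<open>The differential of \<open>f\<close> at \<open>x\<close>, in charts \<open>c\<close> at \<open>x\<close> and \<open>c'\<close> at \<open>f x\<close>.\<close>

definition diff_in_charts ::
  "'a manifold \<Rightarrow> 'b manifold \<Rightarrow> ('a \<Rightarrow> 'b) \<Rightarrow> 'a chart \<Rightarrow> 'b chart \<Rightarrow> 'a \<Rightarrow> vec \<Rightarrow> vec" where
  "diff_in_charts M N f c c' x = jac (mdim M) (mdim N) (cmap c' \<circ> f \<circ> cinv c) (cmap c x)"

definition immersion :: "'a manifold \<Rightarrow> 'b manifold \<Rightarrow> ('a \<Rightarrow> 'b) \<Rightarrow> bool" where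
  "immersion M N f \<longleftrightarrow> smooth_map M N f \<and>
     (\<forall>c\<in>atlas M. \<forall>c'\<in>atlas N. \<forall>x\<in>cdom c. f x \<in> cdom c' \<longrightarrow>
        inj_on (diff_in_charts M N f c c' x) (cart (mdim M)))"

definition submersion :: "'a manifold \<Rightarrow> 'b manifold \<Rightarrow> ('a \<Rightarrow> 'b) \<Rightarrow> bool" where
  "submersion M N f \<longleftrightarrow> smooth_map M N f \<and>
     (\<forall>c\<in>atlas M. \<forall>c'\<in>atlas N. \<forall>x\<in>cdom c. f x \<in> cdom c' \<longrightarrow>
        diff_in_charts M N f c c' x ` cart (mdim M) = cart (mdim N))"

definition surj_submersion_conn :: "'a manifold \<Rightarrow> 'b manifold \<Rightarrow> ('a \<Rightarrow> 'b) \<Rightarrow> bool" where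
  "surj_submersion_conn M N p \<longleftrightarrow> submersion M N p \<and> p ` mpts M = mpts N \<and>
     (\<forall>y\<in>mpts N. connectedin (mtop M) {x \<in> mpts M. p x = y})"


section \<open>Diffeologies\<close>

text \<open>A diffeology is given by its set of plots \<open>(n, O, q)\<close>, where \<open>q\<close> is defined on the open subset
  \<open>O\<close> of the \<open>n\<close>-dimensional Cartesian space, and is \<^const>\<open>undefined\<close> off \<open>O\<close>.\<close>

type_synonym 'y plot = "nat \<times> vec set \<times> (vec \<Rightarrow> 'y)"

definition manifold_plots :: "'a manifold \<Rightarrow> 'a plot set" where
  "manifold_plots M = {(n, O', q). openin (Euclidean_space n) O' \<and> q \<in> extensional O' \<and>
     smooth_into n O' M q}"

definition subspace_plots :: "'a plot set \<Rightarrow> 'a set \<Rightarrow> 'a plot set" where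
  "subspace_plots D L = {(n, O', q). (n, O', q) \<in> D \<and> q ` O' \<subseteq> L}"

definition submanifold_structure :: "'a manifold \<Rightarrow> 'a set \<Rightarrow> 'a manifold \<Rightarrow> bool" where
  "submanifold_structure M L K \<longleftrightarrow> smooth_manifold K \<and> mpts K = L \<and>
     manifold_plots K = subspace_plots (manifold_plots M) L"

definition diffeological_submanifold :: "'a manifold \<Rightarrow> 'a set \<Rightarrow> bool" where
  "diffeological_submanifold M L \<longleftrightarrow> L \<subseteq> mpts M \<and> (\<exists>K. submanifold_structure M L K)"

text \<open>The structure is unique when \<open>L\<close> is nonempty, so the choice is harmless for leaves.\<close>

definition submfd :: "'a manifold \<Rightarrow> 'a set \<Rightarrow> 'a manifold" where
  "submfd M L = (SOME K. submanifold_structure M L K)"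

definition weakly_embedded :: "'a manifold \<Rightarrow> 'a set \<Rightarrow> bool" where
  "weakly_embedded M L \<longleftrightarrow> diffeological_submanifold M L \<and> immersion (submfd M L) M (\<lambda>x. x)"


section \<open>Singular foliations and Molino transverse equivalence\<close>

text \<open>The product of subsets of the \<open>k\<close>-dimensional and the \<open>(n-k)\<close>-dimensional Cartesian
  spaces, as a subset of the \<open>n\<close>-dimensional one: the coordinates are concatenated.\<close>

definition cart_prod :: "nat \<Rightarrow> vec set \<Rightarrow> vec set \<Rightarrow> vec set" where
  "cart_prod k U W = {(\<lambda>i. if i < k then u i else w (i - k)) | u w. u \<in> U \<and> w \<in> W}"

text \<open>The leaf through a point; this is also the quotient map to the leaf space.\<close>

definition leaf_of :: "'a set set \<Rightarrow> 'a \<Rightarrow> 'a set" where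
  "leaf_of F x = (THE L. L \<in> F \<and> x \<in> L)"

text \<open>Diffeomorphisms from open subsets of \<open>M\<close> onto open subsets of the model space are
  precisely the members of the maximal atlas.\<close>

definition foliation_chart :: "'a manifold \<Rightarrow> 'a set set \<Rightarrow> 'a \<Rightarrow> 'a chart \<Rightarrow> bool" where
  "foliation_chart M F x c \<longleftrightarrow> c \<in> atlas M \<and> x \<in> cdom c \<and>
     (let k = mdim (submfd M (leaf_of F x)) in
      \<exists>U W. openin (Euclidean_space k) U \<and> openin (Euclidean_space (mdim M - k)) W \<and>
        (\<lambda>_. 0) \<in> U \<and> (\<lambda>_. 0) \<in> W \<and>
        cimg c = cart_prod k U W \<and> cmap c x = (\<lambda>_. 0) \<and>
        (\<forall>L\<in>F. \<exists>l\<subseteq>W. cmap c ` (L \<inter> cdom c) = cart_prod k U l))"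

definition singular_foliation :: "'a manifold \<Rightarrow> 'a set set \<Rightarrow> bool" where
  "singular_foliation M F \<longleftrightarrow> partition_on (mpts M) F \<and>
     (\<forall>L\<in>F. weakly_embedded M L \<and> connected_space (mtop (submfd M L))) \<and>
     (\<forall>x\<in>mpts M. \<exists>c. foliation_chart M F x c)"

definition pullback_foliation :: "'a manifold \<Rightarrow> ('a \<Rightarrow> 'b) \<Rightarrow> 'b set set \<Rightarrow> 'a set set" where
  "pullback_foliation M p F = {{x \<in> mpts M. p x \<in> L} | L. L \<in> F}"

text \<open>HOL cannot quantify over the type \<open>'m\<close> of points of the intermediate manifold, so it is a
  parameter. In a hypothesis, leaving \<open>'m\<close> free amounts to the existence of an intermediate
  manifold with points of any type.\<close>

definition molino_equivalent ::
  "'m itself \<Rightarrow> 'a manifold \<Rightarrow> 'a set set \<Rightarrow> 'b manifold \<Rightarrow> 'b set set \<Rightarrow> bool" where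
  "molino_equivalent _ N0 F0 N1 F1 \<longleftrightarrow>
     (\<exists>(M :: 'm manifold) F p0 p1.
        smooth_manifold M \<and> singular_foliation M F \<and>
        surj_submersion_conn M N0 p0 \<and> surj_submersion_conn M N1 p1 \<and>
        pullback_foliation M p0 F0 = F \<and> pullback_foliation M p1 F1 = F)"


section \<open>Differential forms on manifolds and basic forms\<close>

text \<open>A form on a manifold is a family of forms on the images of the charts, and a vector field is
  a family of vector fields on the images of the charts, which are related by the transition maps.\<close>

type_synonym 'a mform = "'a chart \<Rightarrow> lform"
type_synonym 'a vfield = "'a chart \<Rightarrow> vec \<Rightarrow> vec"

definition mforms :: "'a manifold \<Rightarrow> nat \<Rightarrow> 'a mform set" where
  "mforms M k = {w.
     (\<forall>c. c \<notin> atlas M \<longrightarrow> w c = (\<lambda>_ _. 0)) \<and>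
     (\<forall>c\<in>atlas M. w c \<in> lforms k (mdim M) (cimg c)) \<and>
     (\<forall>c\<in>atlas M. \<forall>c'\<in>atlas M. \<forall>x \<in> cdom c \<inter> cdom c'. \<forall>vs. set vs \<subseteq> cart (mdim M) \<longrightarrow>
        w c (cmap c x) vs =
        w c' (cmap c' x) (map (jac (mdim M) (mdim M) (transition c c') (cmap c x)) vs))}"

definition mdiff :: "'a manifold \<Rightarrow> 'a mform \<Rightarrow> 'a mform" where
  "mdiff M w = (\<lambda>c. if c \<in> atlas M then ldiff (mdim M) (cimg c) (w c) else (\<lambda>_ _. 0))"

definition vector_field :: "'a manifold \<Rightarrow> 'a vfield \<Rightarrow> bool" where
  "vector_field M X \<longleftrightarrow>
     (\<forall>c\<in>atlas M. smooth_cart (mdim M) (cimg c) (mdim M) (X c)) \<and>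
     (\<forall>c\<in>atlas M. \<forall>c'\<in>atlas M. \<forall>x \<in> cdom c \<inter> cdom c'.
        X c' (cmap c' x) =
        jac (mdim M) (mdim M) (transition c c') (cmap c x) (X c (cmap c x)))"

definition mint :: "'a manifold \<Rightarrow> 'a vfield \<Rightarrow> 'a mform \<Rightarrow> 'a mform" where
  "mint M X w = (\<lambda>c. if c \<in> atlas M then lint (X c) (w c) else (\<lambda>_ _. 0))"

definition mlie :: "'a manifold \<Rightarrow> 'a vfield \<Rightarrow> 'a mform \<Rightarrow> 'a mform" where
  "mlie M X w = (\<lambda>c. if c \<in> atlas M then llie (mdim M) (cimg c) (X c) (w c) else (\<lambda>_ _. 0))"

text \<open>The tangent space at \<open>x\<close> of the submanifold \<open>K\<close> of \<open>M\<close>, in the chart \<open>c\<close> of \<open>M\<close>: the image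
  of the differential of the inclusion.\<close>

definition tangent_in_chart :: "'a manifold \<Rightarrow> 'a manifold \<Rightarrow> 'a chart \<Rightarrow> 'a \<Rightarrow> vec set" where
  "tangent_in_chart K M c x =
     (\<Union>b\<in>{b \<in> atlas K. x \<in> cdom b}. diff_in_charts K M (\<lambda>y. y) b c x ` cart (mdim K))"

definition tangent_field :: "'a manifold \<Rightarrow> 'a set set \<Rightarrow> 'a vfield \<Rightarrow> bool" where
  "tangent_field M F X \<longleftrightarrow> vector_field M X \<and>
     (\<forall>c\<in>atlas M. \<forall>x\<in>cdom c. X c (cmap c x) \<in> tangent_in_chart (submfd M (leaf_of F x)) M c x)"

definition basic_forms :: "'a manifold \<Rightarrow> 'a set set \<Rightarrow> nat \<Rightarrow> 'a mform set" where
  "basic_forms M F k = {w \<in> mforms M k. \<forall>X. tangent_field M F X \<longrightarrow>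
     mint M X w = (\<lambda>_ _ _. 0) \<and> mlie M X w = (\<lambda>_ _ _. 0)}"


section \<open>The leaf space and its diffeological forms\<close>

definition leaf_space_plots :: "'a manifold \<Rightarrow> 'a set set \<Rightarrow> 'a set plot set" where
  "leaf_space_plots N F = {(n, O', q). openin (Euclidean_space n) O' \<and> q \<in> extensional O' \<and>
     q ` O' \<subseteq> F \<and>
     (\<forall>r\<in>O'. \<exists>O'' q'. openin (Euclidean_space n) O'' \<and> r \<in> O'' \<and> O'' \<subseteq> O' \<and>
        smooth_into n O'' N q' \<and> (\<forall>s\<in>O''. q s = leaf_of F (q' s)))}"

type_synonym 'y dform = "'y plot \<Rightarrow> lform"

definition dforms :: "'y plot set \<Rightarrow> nat \<Rightarrow> 'y dform set" where
  "dforms D k = {w.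
     (\<forall>p. p \<notin> D \<longrightarrow> w p = (\<lambda>_ _. 0)) \<and>
     (\<forall>(n, O', q)\<in>D. w (n, O', q) \<in> lforms k n O' \<and>
        (\<forall>m O'' f. openin (Euclidean_space m) O'' \<longrightarrow> smooth_cart m O'' n f \<longrightarrow> f ` O'' \<subseteq> O' \<longrightarrow>
           w (m, O'', restrict (q \<circ> f) O'') = lpull m O'' n f (w (n, O', q))))}"

definition ddiff :: "'y dform \<Rightarrow> 'y dform" where
  "ddiff w = (\<lambda>(n, O', q). ldiff n O' (w (n, O', q)))"

definition dpull :: "'x plot set \<Rightarrow> ('x \<Rightarrow> 'y) \<Rightarrow> 'y dform \<Rightarrow> 'x dform" where
  "dpull D g w = (\<lambda>(n, O', q).
     if (n, O', q) \<in> D then w (n, O', restrict (g \<circ> q) O') else (\<lambda>_ _. 0))"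

text \<open>The identification of the diffeological forms on a manifold with the usual forms: evaluate on
  the inverses of the charts.\<close>

definition mform_of :: "'a manifold \<Rightarrow> 'a dform \<Rightarrow> 'a mform" where
  "mform_of M w = (\<lambda>c. if c \<in> atlas M
     then w (mdim M, cimg c, restrict (cinv c) (cimg c)) else (\<lambda>_ _. 0))"

definition quot_pull :: "'a manifold \<Rightarrow> 'a set set \<Rightarrow> 'a set dform \<Rightarrow> 'a mform" where
  "quot_pull N F w = mform_of N (dpull (manifold_plots N) (leaf_of F) w)"

definition cochain_iso ::
  "(nat \<Rightarrow> ('i \<Rightarrow> lform) set) \<Rightarrow> (('i \<Rightarrow> lform) \<Rightarrow> ('i \<Rightarrow> lform)) \<Rightarrow>
   (nat \<Rightarrow> ('j \<Rightarrow> lform) set) \<Rightarrow> (('j \<Rightarrow> lform) \<Rightarrow> ('j \<Rightarrow> lform)) \<Rightarrow>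
   (('i \<Rightarrow> lform) \<Rightarrow> ('j \<Rightarrow> lform)) \<Rightarrow> bool" where
  "cochain_iso A dA B dB T \<longleftrightarrow> (\<forall>k.
     bij_betw T (A k) (B k) \<and>
     (\<forall>v\<in>A k. \<forall>w\<in>A k. \<forall>a b. T (\<lambda>p x vs. a * v p x vs + b * w p x vs) =
        (\<lambda>c x vs. a * T v c x vs + b * T w c x vs)) \<and>
     (\<forall>w\<in>A k. T (dA w) = dB (T w)))"

definition quot_pull_iso :: "'a manifold \<Rightarrow> 'a set set \<Rightarrow> bool" where
  "quot_pull_iso N F \<longleftrightarrow>
     cochain_iso (dforms (leaf_space_plots N F)) ddiff (basic_forms N F) (mdiff N) (quot_pull N F)"

end

theory Submission
  imports Defs
begin

text \<open>
  Basic forms are exactly the forms \<open>\<beta>\<close> which are invariant along leafwise homotopies: if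
  \<open>f\<close> is a smooth map for which the leaf of \<open>f x\<close> does not depend on the coordinate \<open>x\<^sub>j\<close>, then
  \<open>f\<^sup>*\<beta>\<close> is killed by \<open>\<partial>\<^sub>j\<close> and its coefficients do not depend on \<open>x\<^sub>j\<close>. Forms pulled back from
  the leaf space have this property, and are characterised by the stronger one that
  \<open>f\<^sup>*\<beta> = g\<^sup>*\<beta>\<close> whenever \<open>\<pi> \<circ> f = \<pi> \<circ> g\<close>. Both properties are local on the source of \<open>f\<close>, so that they
  can be moved between \<open>N0\<close> and \<open>N1\<close> by lifting \<open>f\<close> to \<open>M\<close> along one of the submersions, as soon as
  there are forms with \<open>p0\<^sup>*\<gamma> = p1\<^sup>*\<beta>\<close>.

  Given a basic \<open>\<beta>\<close> on \<open>N1\<close>, such a \<open>\<gamma>\<close> is defined by local sections of \<open>p0\<close>. It does not depend on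
  their choice: two lifts of a map along \<open>p0\<close> with nearby values are joined by a homotopy inside the
  fibers, which \<open>p1\<close> maps into leaves, and the fibers are connected. Then \<open>\<gamma>\<close> is basic, hence by
  assumption it comes from \<open>N0/F0\<close>, and therefore \<open>\<beta>\<close> comes from \<open>N1/F1\<close>.
\<close>

section \<open>Calculus on open subsets of Cartesian spaces\<close>

text \<open>Leaf dimensions may jump, and this shapes the comparison of basic forms with leafwise
  invariance. In a foliation chart centred at x, with k the dimension of the leaf of x, the first k
  coordinate directions are tangent to every leaf that meets the chart, but away from x they need
  not exhaust the tangent space. A tangent field is therefore matched with a velocity along the
  leaves at one point only, and neither flows nor local frames of tangent fields are used. One point
  is enough: contraction is pointwise, and the terms of the Lie derivative that contain derivatives
  of X are governed by contractions, which vanish nearby. Being basic quantifies over global fields,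
  so single tangent vectors are extended by a cutoff. There the Hausdorff axiom enters: it makes a
  compact set inside a chart closed in the manifold. Both clauses of leafwise invariance concern a
  single coordinate of the source. A homotopy with time as an additional coordinate is a map to
  which they apply directly, and finite statements follow by the mean value theorem in that
  coordinate.\<close>

abbreviation opn :: "nat \<Rightarrow> vec set \<Rightarrow> bool" where
  "opn n \<equiv> openin (Euclidean_space n)"

text \<open>Coordinate cubes instead of balls: moving one coordinate of a point closer to the centre
  stays inside, as the arguments that change one coordinate at a time require.\<close>

definition nbox :: "nat \<Rightarrow> vec \<Rightarrow> real \<Rightarrow> vec set" where
  "nbox n x e = {y \<in> cart n. \<forall>i<n. \<bar>y i - x i\<bar> < e}"

lemma cart_iff: "x \<in> cart n \<longleftrightarrow> (\<forall>i\<ge>n. x i = 0)"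
  by (simp add: topspace_Euclidean_space)

lemma cart_upd: "x \<in> cart n \<Longrightarrow> i < n \<Longrightarrow> x(i := t) \<in> cart n"
  by (auto simp: cart_iff)

lemma cart_eqI: "x \<in> cart n \<Longrightarrow> y \<in> cart n \<Longrightarrow> (\<And>i. i < n \<Longrightarrow> x i = y i) \<Longrightarrow> x = y"
  by (rule ext) (metis cart_iff not_le)

lemma Euclidean_space_eq: "Euclidean_space n = top_of_set {x. \<forall>i\<ge>n. x i = 0}"
  by (simp add: Euclidean_space_def euclidean_product_topology)

lemma opn_subset: "opn n O' \<Longrightarrow> O' \<subseteq> cart n"
  by (rule openin_subset)

lemma continuous_map_iff_continuous_on:
  "O' \<subseteq> cart n \<Longrightarrow>
    continuous_map (subtopology (Euclidean_space n) O') euclidean f \<longleftrightarrow> continuous_on O' f"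
  by (simp add: Euclidean_space_eq subtopology_subtopology inf_absorb2)

lemma nbox_self: "x \<in> cart n \<Longrightarrow> e > 0 \<Longrightarrow> x \<in> nbox n x e"
  by (simp add: nbox_def)

lemma opn_nbox: "opn n (nbox n x e)"
proof -
  have "nbox n x e = cart n \<inter> (\<Inter>i\<in>{..<n}. {y. \<bar>y i - x i\<bar> < e})"
    by (auto simp: nbox_def)
  moreover have "open (\<Inter>i\<in>{..<n}. {y :: vec. \<bar>y i - x i\<bar> < e})"
    by (intro open_INT finite_lessThan ballI open_Collect_less continuous_intros
        continuous_on_product_coordinates)
  ultimately show ?thesis
    by (auto simp: Euclidean_space_eq openin_open)
qed

lemma opn_contains_nbox:
  assumes "opn n O'" "x \<in> O'"
  obtains e where "e > 0" "nbox n x e \<subseteq> O'"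
proof -
  obtain U where U: "openin (powertop_real UNIV) U" "O' = cart n \<inter> U"
    using assms(1) by (auto simp: Euclidean_space_eq openin_open euclidean_product_topology)
  from product_topology_open_contains_basis[OF U(1), of x] assms U
  obtain X where X: "x \<in> (\<Pi>\<^sub>E i\<in>UNIV. X i)" "\<And>i. open (X i)" "(\<Pi>\<^sub>E i\<in>UNIV. X i) \<subseteq> U"
    by auto
  have "\<exists>d>0. \<forall>t. \<bar>t - x i\<bar> < d \<longrightarrow> t \<in> X i" for i
  proof -
    have "x i \<in> X i" using X(1) by (simp add: PiE_iff)
    then obtain d where "d > 0" "\<forall>y. dist y (x i) < d \<longrightarrow> y \<in> X i"
      using X(2)[of i] unfolding open_dist by blast
    then show ?thesis by (auto simp: dist_real_def)
  qed
  then obtain d where d: "\<And>i. d i > 0" "\<And>i t. \<bar>t - x i\<bar> < d i \<Longrightarrow> t \<in> X i"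
    by metis
  \<comment> \<open>Points of \<open>cart n\<close> are constrained in the first n coordinates only,
    so a minimum of finitely many radii is enough. The inserted 1 keeps the set nonempty when n =
    0.\<close>
  define e where "e = Min (insert 1 (d ` {..<n}))"
  have "e > 0" unfolding e_def using d by (subst Min_gr_iff) auto
  moreover have "nbox n x e \<subseteq> O'"
  proof
    fix y assume y: "y \<in> nbox n x e"
    have "y i \<in> X i" for i
    proof (cases "i < n")
      case True
      then have "e \<le> d i" by (auto simp: e_def)
      then show ?thesis using y True by (intro d(2)) (auto simp: nbox_def)
    next
      case False
      then have "y i = 0" "x i = 0" using y assms opn_subset[of n O'] by (auto simp: nbox_def cart_iff)
      then show ?thesis using d(2)[of "y i" i] d(1)[of i] by simp
    qed
    then have "y \<in> U" using X(3) by (auto simp: PiE_iff)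
    then show "y \<in> O'" using y U by (auto simp: nbox_def)
  qed
  ultimately show thesis by (rule that)
qed

lemma opnI:
  assumes "\<And>x. x \<in> O' \<Longrightarrow> \<exists>W. opn n W \<and> x \<in> W \<and> W \<subseteq> O'"
  shows "opn n O'"
  using assms by (subst openin_subopen) blast

lemma opn_slice:
  assumes "opn n O'" "x \<in> O'" "i < n"
  shows "\<forall>\<^sub>F t in nhds (x i). x(i := t) \<in> O'"
proof -
  obtain e where e: "e > 0" "nbox n x e \<subseteq> O'" using opn_contains_nbox assms by metis
  have "x(i := t) \<in> O'" if "dist t (x i) < e" for t
  proof -
    have "x(i := t) \<in> nbox n x e"
      using that e(1) assms(2,3) opn_subset[OF assms(1)]
      by (auto simp: nbox_def dist_real_def intro!: cart_upd)
    then show ?thesis using e(2) by blast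
  qed
  then show ?thesis unfolding eventually_nhds_metric using e by blast
qed

lemma opn_preimage:
  assumes "opn n O'" "continuous_on O' f" "f ` O' \<subseteq> cart m" "opn m W"
  shows "opn n {x \<in> O'. f x \<in> W}"
proof -
  obtain U where U: "open U" "W = cart m \<inter> U"
    using assms(4) by (auto simp: Euclidean_space_eq openin_open)
  have "openin (top_of_set O') (O' \<inter> f -` U)"
    using continuous_openin_preimage_gen[OF assms(2) U(1)] .
  then have "opn n (O' \<inter> f -` U)"
    using assms(1) by (auto simp: Euclidean_space_eq intro: openin_trans)
  moreover have "{x \<in> O'. f x \<in> W} = O' \<inter> f -` U" using U assms(3) by auto
  ultimately show ?thesis by simp
qed

lemma opn_preimage_real:
  assumes "opn n O'" "continuous_on O' (f :: vec \<Rightarrow> real)" "open W"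
  shows "opn n {x \<in> O'. f x \<in> W}"
proof -
  have "openin (top_of_set O') (O' \<inter> f -` W)"
    using continuous_openin_preimage_gen[OF assms(2,3)] .
  then have "opn n (O' \<inter> f -` W)"
    using assms(1) by (auto simp: Euclidean_space_eq intro: openin_trans)
  moreover have "{x \<in> O'. f x \<in> W} = O' \<inter> f -` W" by auto
  ultimately show ?thesis by simp
qed

lemma continuous_on_nbox:
  assumes "opn n O'" "continuous_on O' (f :: vec \<Rightarrow> real)" "x \<in> O'" "e > 0"
  obtains d where "d > 0" "nbox n x d \<subseteq> O'" "\<And>y. y \<in> nbox n x d \<Longrightarrow> \<bar>f y - f x\<bar> < e"
proof -
  have "opn n {y \<in> O'. f y \<in> ball (f x) e}"
    by (rule opn_preimage_real) (use assms in auto)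
  moreover have "x \<in> {y \<in> O'. f y \<in> ball (f x) e}" using assms by simp
  ultimately obtain d where d: "d > 0" "nbox n x d \<subseteq> {y \<in> O'. f y \<in> ball (f x) e}"
    using opn_contains_nbox by blast
  show thesis
  proof (rule that[OF d(1)])
    show "nbox n x d \<subseteq> O'" using d(2) by blast
    fix y assume "y \<in> nbox n x d"
    then have "f y \<in> ball (f x) e" using d(2) by blast
    then show "\<bar>f y - f x\<bar> < e" by (simp add: dist_real_def)
  qed
qed


section \<open>Functions of class C^k: locality and algebra\<close>

declare Ck_fun.simps [simp del]

abbreviation has_partial :: "nat \<Rightarrow> (vec \<Rightarrow> real) \<Rightarrow> real \<Rightarrow> vec \<Rightarrow> bool" where
  "has_partial i f d x \<equiv> ((\<lambda>t. f (x(i := t))) has_real_derivative d) (at (x i))"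

lemma has_partial_imp_partial: "has_partial i f d x \<Longrightarrow> partial i f x = d"
  unfolding partial_def by (rule DERIV_imp_deriv)

lemma has_partial_cong:
  assumes "opn n O'" "x \<in> O'" "i < n" "\<And>y. y \<in> O' \<Longrightarrow> f y = g y"
  shows "has_partial i f d x \<longleftrightarrow> has_partial i g d x"
proof (rule DERIV_cong_ev)
  show "\<forall>\<^sub>F t in nhds (x i). f (x(i := t)) = g (x(i := t))"
    using opn_slice[OF assms(1-3)] by eventually_elim (use assms in auto)
qed auto

lemma partial_cong:
  assumes "opn n O'" "x \<in> O'" "i < n" "\<And>y. y \<in> O' \<Longrightarrow> f y = g y"
  shows "partial i f x = partial i g x"
proof -
  have "has_partial i f d x \<longleftrightarrow> has_partial i g d x" for d
    by (rule has_partial_cong[OF assms(1-3)]) (rule assms(4))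
  then show ?thesis unfolding partial_def deriv_def by simp
qed

lemma continuous_on_local:
  assumes "opn n O'"
    and "\<And>x. x \<in> O' \<Longrightarrow> \<exists>W. opn n W \<and> x \<in> W \<and> W \<subseteq> O' \<and> continuous_on W (f :: vec \<Rightarrow> real)"
  shows "continuous_on O' f"
  unfolding continuous_on_eq_continuous_within
proof
  fix x assume "x \<in> O'"
  then obtain W where W: "opn n W" "x \<in> W" "W \<subseteq> O'" "continuous_on W f"
    using assms(2) by blast
  then obtain U where U: "open U" "W = {x. \<forall>i\<ge>n. x i = 0} \<inter> U"
    unfolding Euclidean_space_eq openin_open by blast
  have "O' \<subseteq> {x. \<forall>i\<ge>n. x i = 0}"
    using opn_subset[OF assms(1)] by (simp add: topspace_Euclidean_space)
  then have "W \<inter> U - {x} = O' \<inter> U - {x}" using U W(3) by blast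
  moreover have "x \<in> U" using U W by blast
  ultimately have "at x within W = at x within O'" using U(1) by (metis at_within_nhd)
  moreover have "continuous (at x within W) f" using W by (simp add: continuous_on_eq_continuous_within)
  ultimately show "continuous (at x within O') f" by simp
qed

lemma Ck_fun_cong:
  assumes "opn n O'" "\<And>y. y \<in> O' \<Longrightarrow> f y = g y"
  shows "Ck_fun r n O' f \<longleftrightarrow> Ck_fun r n O' g"
  using assms
proof (induction r arbitrary: f g)
  case 0
  then show ?case by (simp add: Ck_fun.simps continuous_map_iff_continuous_on opn_subset cong: continuous_on_cong)
next
  case (Suc r)
  have eq: "has_partial i f d x \<longleftrightarrow> has_partial i g d x" if "i < n" "x \<in> O'" for x i d
    by (rule has_partial_cong[OF Suc.prems(1) that(2,1)]) (rule Suc.prems(2))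
  have "continuous_on O' f \<longleftrightarrow> continuous_on O' g" using Suc by (simp cong: continuous_on_cong)
  moreover have "(\<lambda>t. f (x(i := t))) differentiable at (x i) \<longleftrightarrow>
      (\<lambda>t. g (x(i := t))) differentiable at (x i)" if "i < n" "x \<in> O'" for x i
    using eq[OF that] by (simp add: real_differentiable_def)
  moreover have "Ck_fun r n O' (partial i f) \<longleftrightarrow> Ck_fun r n O' (partial i g)" if "i < n" for i
    by (rule Suc.IH) (use partial_cong Suc.prems that in blast)+
  ultimately show ?case using Suc.prems(1)
    by (simp add: Ck_fun.simps continuous_map_iff_continuous_on opn_subset cong: conj_cong)
qed

lemma Ck_fun_0: "opn n O' \<Longrightarrow> Ck_fun 0 n O' f \<longleftrightarrow> continuous_on O' f"
  by (simp add: Ck_fun.simps continuous_map_iff_continuous_on opn_subset)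

lemma Ck_fun_Suc: "opn n O' \<Longrightarrow> Ck_fun (Suc r) n O' f \<longleftrightarrow>
   continuous_on O' f \<and> (\<forall>i<n. (\<forall>x\<in>O'. has_partial i f (partial i f x) x) \<and> Ck_fun r n O' (partial i f))"
  by (simp add: Ck_fun.simps continuous_map_iff_continuous_on opn_subset partial_def DERIV_deriv_iff_real_differentiable)

text \<open>The derivatives are handed over as explicit formulas \<open>D i\<close>, which have to
  agree with the partial derivatives on the open set only. Their regularity is what an induction
  hypothesis on r provides.\<close>

lemma Ck_fun_SucI:
  assumes "opn n O'" "continuous_on O' f"
    and "\<And>i x. i < n \<Longrightarrow> x \<in> O' \<Longrightarrow> has_partial i f (D i x) x"
    and "\<And>i. i < n \<Longrightarrow> Ck_fun r n O' (D i)"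
  shows "Ck_fun (Suc r) n O' f"
proof -
  have "partial i f x = D i x" if "i < n" "x \<in> O'" for i x
    using assms(3) that by (blast intro: has_partial_imp_partial)
  moreover from this have "Ck_fun r n O' (partial i f)" if "i < n" for i
    using Ck_fun_cong[OF assms(1), of "partial i f" "D i"] assms(4) that by blast
  ultimately show ?thesis using assms(1-3) by (simp add: Ck_fun_Suc)
qed

lemma Ck_fun_continuous: "opn n O' \<Longrightarrow> Ck_fun r n O' f \<Longrightarrow> continuous_on O' f"
  by (cases r) (simp_all only: Ck_fun_0 Ck_fun_Suc)

lemma Ck_fun_Suc_mono: "opn n O' \<Longrightarrow> Ck_fun (Suc r) n O' f \<Longrightarrow> Ck_fun r n O' f"
proof (induction r arbitrary: f)
  case 0
  then show ?case by (simp add: Ck_fun_0 Ck_fun_Suc)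
next
  case (Suc r)
  then show ?case unfolding Ck_fun_Suc[OF Suc.prems(1), of "Suc r"] Ck_fun_Suc[OF Suc.prems(1), of r]
    by blast
qed

lemma Ck_fun_subset:
  assumes "Ck_fun r n O' f" "opn n O'" "opn n W" "W \<subseteq> O'"
  shows "Ck_fun r n W f"
  using assms
proof (induction r arbitrary: f)
  case 0
  then show ?case using continuous_on_subset by (auto simp: Ck_fun_0)
next
  case (Suc r)
  then show ?case unfolding Ck_fun_Suc[OF Suc.prems(2)] Ck_fun_Suc[OF Suc.prems(3)]
    using continuous_on_subset by blast
qed

lemma Ck_fun_local:
  assumes "opn n O'" "\<And>x. x \<in> O' \<Longrightarrow> \<exists>W. opn n W \<and> x \<in> W \<and> W \<subseteq> O' \<and> Ck_fun r n W f"
  shows "Ck_fun r n O' f"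
  using assms(2)
proof (induction r arbitrary: f)
  case 0
  have "continuous_on O' f"
  proof (rule continuous_on_local[OF assms(1)])
    fix x assume "x \<in> O'"
    then obtain W where "opn n W" "x \<in> W" "W \<subseteq> O'" "Ck_fun 0 n W f" using 0[OF \<open>x \<in> O'\<close>] by (elim exE conjE)
    then show "\<exists>W. opn n W \<and> x \<in> W \<and> W \<subseteq> O' \<and> continuous_on W f"
      by (intro exI[of _ W] conjI Ck_fun_continuous[of n W 0 f])
  qed
  then show ?case using assms(1) by (simp only: Ck_fun_0)
next
  case (Suc r)
  have "continuous_on O' f"
  proof (rule continuous_on_local[OF assms(1)])
    fix x assume "x \<in> O'"
    then obtain W where "opn n W" "x \<in> W" "W \<subseteq> O'" "Ck_fun (Suc r) n W f"
      using Suc.prems[OF \<open>x \<in> O'\<close>] by (elim exE conjE)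
    then show "\<exists>W. opn n W \<and> x \<in> W \<and> W \<subseteq> O' \<and> continuous_on W f"
      by (intro exI[of _ W] conjI Ck_fun_continuous[of n W "Suc r" f])
  qed
  moreover have "has_partial i f (partial i f x) x" if i: "i < n" and x: "x \<in> O'" for i x
  proof -
    obtain W where "opn n W" "x \<in> W" "Ck_fun (Suc r) n W f"
      using Suc.prems[OF x] by (elim exE conjE)
    then show ?thesis using i by (simp add: Ck_fun_Suc)
  qed
  moreover have "Ck_fun r n O' (partial i f)" if "i < n" for i
  proof (rule Suc.IH)
    fix x assume "x \<in> O'"
    then obtain W where "opn n W" "x \<in> W" "W \<subseteq> O'" "Ck_fun (Suc r) n W f"
      using Suc.prems[OF \<open>x \<in> O'\<close>] by (elim exE conjE)
    then show "\<exists>W. opn n W \<and> x \<in> W \<and> W \<subseteq> O' \<and> Ck_fun r n W (partial i f)"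
      using that by (intro exI[of _ W]) (simp add: Ck_fun_Suc)
  qed
  ultimately show ?case using assms(1) by (simp add: Ck_fun_Suc)
qed

lemma continuous_on_coord: "continuous_on S (\<lambda>x :: nat \<Rightarrow> real. x j)"
  by (rule continuous_on_subset[OF continuous_on_product_coordinates subset_UNIV])

lemma Ck_fun_const: "opn n O' \<Longrightarrow> Ck_fun r n O' (\<lambda>_. c)"
proof (induction r arbitrary: c)
  case 0
  then show ?case by (simp add: Ck_fun_0)
next
  case (Suc r)
  then show ?case by (intro Ck_fun_SucI[where D = "\<lambda>_ _. 0"]) auto
qed

lemma Ck_fun_coord: "opn n O' \<Longrightarrow> Ck_fun r n O' (\<lambda>x. x j)"
proof (cases r)
  case 0
  assume "opn n O'"
  then show ?thesis using 0 by (simp add: Ck_fun_0 continuous_on_coord)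
next
  case (Suc r)
  assume O: "opn n O'"
  have "has_partial i (\<lambda>x. x j) (if i = j then 1 else 0) x" for i x
    by (cases "i = j") auto
  then show ?thesis unfolding Suc
    by (intro Ck_fun_SucI[where D = "\<lambda>i _. if i = j then 1 else 0"] O Ck_fun_const continuous_on_coord)
qed

lemma Ck_fun_add:
  "opn n O' \<Longrightarrow> Ck_fun r n O' f \<Longrightarrow> Ck_fun r n O' g \<Longrightarrow> Ck_fun r n O' (\<lambda>x. f x + g x)"
proof (induction r arbitrary: f g)
  case 0
  then show ?case by (simp add: Ck_fun_0 continuous_on_add)
next
  case (Suc r)
  note f = Suc.prems(2)[unfolded Ck_fun_Suc[OF Suc.prems(1)]]
  note g = Suc.prems(3)[unfolded Ck_fun_Suc[OF Suc.prems(1)]]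
  show ?case
  proof (rule Ck_fun_SucI[where D = "\<lambda>i x. partial i f x + partial i g x"])
    fix i x assume "i < n" "x \<in> O'"
    then show "has_partial i (\<lambda>x. f x + g x) (partial i f x + partial i g x) x"
      by (intro DERIV_add) (use f g in blast)+
  qed (use Suc.prems(1) f g in \<open>auto intro!: continuous_on_add Suc.IH\<close>)
qed

lemma Ck_fun_mult:
  "opn n O' \<Longrightarrow> Ck_fun r n O' f \<Longrightarrow> Ck_fun r n O' g \<Longrightarrow> Ck_fun r n O' (\<lambda>x. f x * g x)"
proof (induction r arbitrary: f g)
  case 0
  then show ?case by (simp add: Ck_fun_0 continuous_on_mult)
next
  case (Suc r)
  note O = Suc.prems(1)
  note f = Suc.prems(2)[unfolded Ck_fun_Suc[OF O]]
  note g = Suc.prems(3)[unfolded Ck_fun_Suc[OF O]]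
  note f' = Ck_fun_Suc_mono[OF O Suc.prems(2)]
  note g' = Ck_fun_Suc_mono[OF O Suc.prems(3)]
  show ?case
  proof (rule Ck_fun_SucI[where D = "\<lambda>i x. partial i f x * g x + partial i g x * f x"])
    fix i x assume "i < n" "x \<in> O'"
    then show "has_partial i (\<lambda>x. f x * g x) (partial i f x * g x + partial i g x * f x) x"
      using f g DERIV_mult[of "\<lambda>t. f (x(i := t))" "partial i f x" "x i" UNIV
          "\<lambda>t. g (x(i := t))" "partial i g x"] by simp
  qed (use O f g f' g' in \<open>auto intro!: continuous_on_mult Ck_fun_add Suc.IH\<close>)
qed

lemma Ck_fun_sum:
  "opn n O' \<Longrightarrow> (\<And>a. a \<in> A \<Longrightarrow> Ck_fun r n O' (f a)) \<Longrightarrow> Ck_fun r n O' (\<lambda>x. \<Sum>a\<in>A. f a x)"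
proof (induction A rule: infinite_finite_induct)
  case (insert a A)
  then show ?case by (simp add: Ck_fun_add)
qed (simp_all add: Ck_fun_const)

section \<open>Mean value theorem, chain rule and composition\<close>

lemma mvt_unordered:
  fixes \<phi> :: "real \<Rightarrow> real"
  assumes "\<And>s. min a b \<le> s \<Longrightarrow> s \<le> max a b \<Longrightarrow> (\<phi> has_real_derivative \<phi>' s) (at s)"
  obtains s where "min a b \<le> s" "s \<le> max a b" "\<phi> b - \<phi> a = (b - a) * \<phi>' s"
proof -
  consider "a < b" | "a = b" | "b < a" by linarith
  then show thesis
  proof cases
    case 1
    then obtain s where "a < s" "s < b" "\<phi> b - \<phi> a = (b - a) * \<phi>' s"
      using MVT2[of a b \<phi> \<phi>'] assms by auto
    then show thesis using that[of s] 1 by auto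
  next
    case 2
    then show thesis using that[of a] by auto
  next
    case 3
    then obtain s where "b < s" "s < a" "\<phi> a - \<phi> b = (a - b) * \<phi>' s"
      using MVT2[of b a \<phi> \<phi>'] assms by auto
    then show thesis using that[of s] 3 by (auto simp: algebra_simps)
  qed
qed

text \<open>Passing from \<open>x\<close> to \<open>y\<close> one coordinate at a time and using the mean value theorem
  in each step avoids total derivatives.\<close>

lemma increment_eq_sum_partials:
  assumes "\<And>j z. j < m \<Longrightarrow> z \<in> nbox m x e \<Longrightarrow> has_partial j g (partial j g z) z"
    and x: "x \<in> cart m" and y: "y \<in> nbox m x e"
  shows "\<exists>\<xi>. (\<forall>j<m. \<xi> j \<in> cart m \<and> (\<forall>i<m. \<bar>\<xi> j i - x i\<bar> \<le> \<bar>y i - x i\<bar>)) \<and>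
    g y - g x = (\<Sum>j<m. (y j - x j) * partial j g (\<xi> j))"
proof -
  define z where "z j = (\<lambda>i. if i < j then y i else x i)" for j :: nat
  have yc: "y \<in> cart m" using y by (simp add: nbox_def)
  have z: "(z j)(j := s) \<in> cart m" "\<And>i. i < m \<Longrightarrow> \<bar>((z j)(j := s)) i - x i\<bar> \<le> \<bar>y i - x i\<bar>"
    if "j < m" "min (x j) (y j) \<le> s" "s \<le> max (x j) (y j)" for j s
  proof -
    show "(z j)(j := s) \<in> cart m" using that x yc by (auto simp: z_def cart_iff)
    show "\<bar>((z j)(j := s)) i - x i\<bar> \<le> \<bar>y i - x i\<bar>" for i
      using that by (auto simp: z_def)
  qed
  have "\<exists>s. min (x j) (y j) \<le> s \<and> s \<le> max (x j) (y j) \<and>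
      g (z (Suc j)) - g (z j) = (y j - x j) * partial j g ((z j)(j := s))" if j: "j < m" for j
  proof -
    have "has_partial j g (partial j g ((z j)(j := s))) ((z j)(j := s))"
      if "min (x j) (y j) \<le> s" "s \<le> max (x j) (y j)" for s
    proof (rule assms(1)[OF j])
      show "(z j)(j := s) \<in> nbox m x e"
        using z[OF j that] y le_less_trans unfolding nbox_def by blast
    qed
    then have "((\<lambda>t. g ((z j)(j := t))) has_real_derivative partial j g ((z j)(j := s))) (at s)"
      if "min (x j) (y j) \<le> s" "s \<le> max (x j) (y j)" for s
      using that by simp
    from mvt_unordered[of "x j" "y j", OF this]
    obtain s where s: "min (x j) (y j) \<le> s" "s \<le> max (x j) (y j)"
      "g ((z j)(j := y j)) - g ((z j)(j := x j)) = (y j - x j) * partial j g ((z j)(j := s))" by metis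
    moreover have "(z j)(j := y j) = z (Suc j)" "(z j)(j := x j) = z j"
      by (auto simp: z_def fun_eq_iff)
    ultimately show ?thesis by auto
  qed
  then obtain s where s: "\<And>j. j < m \<Longrightarrow> min (x j) (y j) \<le> s j" "\<And>j. j < m \<Longrightarrow> s j \<le> max (x j) (y j)"
    "\<And>j. j < m \<Longrightarrow> g (z (Suc j)) - g (z j) = (y j - x j) * partial j g ((z j)(j := s j))"
    by metis
  have "z 0 = x" "z m = y"
    using x yc by (auto simp: z_def fun_eq_iff cart_iff)
  then have "g y - g x = (\<Sum>j<m. g (z (Suc j)) - g (z j))"
    using sum_lessThan_telescope[of "\<lambda>j. g (z j)" m] by simp
  also have "\<dots> = (\<Sum>j<m. (y j - x j) * partial j g ((z j)(j := s j)))"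
    using s(3) by simp
  finally have "g y - g x = (\<Sum>j<m. (y j - x j) * partial j g ((z j)(j := s j)))" .
  then show ?thesis
    using z s(1,2) by (intro exI[of _ "\<lambda>j. (z j)(j := s j)"]) blast
qed

text \<open>Divide the telescoped increment by t - t0. The intermediate points are squeezed
  coordinatewise towards \<open>\<gamma> t0\<close>, so continuity of the partial derivatives of
  \<open>g\<close> gives the limit. Of the curve only differentiability at \<open>t0\<close> enters,
  so the rule applies to coordinate lines composed with an inner map.\<close>

lemma chain_rule_curve:
  assumes W: "opn m W" "Ck_fun (Suc 0) m W g" "\<gamma> t0 \<in> W"
    and ev: "\<forall>\<^sub>F t in nhds t0. \<gamma> t \<in> cart m"
    and d: "\<And>j. j < m \<Longrightarrow> ((\<lambda>t. \<gamma> t j) has_real_derivative d j) (at t0)"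
  shows "((\<lambda>t. g (\<gamma> t)) has_real_derivative (\<Sum>j<m. d j * partial j g (\<gamma> t0))) (at t0)"
proof -
  define x where "x = \<gamma> t0"
  have x: "x \<in> cart m" using W opn_subset by (auto simp: x_def)
  obtain e where e: "e > 0" "nbox m x e \<subseteq> W" using opn_contains_nbox W x_def by metis
  have near: "\<forall>\<^sub>F t in at t0. \<gamma> t \<in> nbox m x r" if r: "r > 0" for r
  proof -
    have "\<forall>\<^sub>F t in at t0. \<bar>\<gamma> t j - x j\<bar> < r" if "j < m" for j
      using DERIV_isCont[OF d[OF that]] r
      by (auto simp: isCont_def tendsto_iff dist_real_def x_def)
    then have "\<forall>\<^sub>F t in at t0. \<forall>j\<in>{..<m}. \<bar>\<gamma> t j - x j\<bar> < r"
      by (intro eventually_ball_finite) auto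
    moreover have "\<forall>\<^sub>F t in at t0. \<gamma> t \<in> cart m"
      using ev by (auto simp: eventually_at_filter elim: eventually_mono)
    ultimately show ?thesis by eventually_elim (auto simp: nbox_def)
  qed
  have "has_partial j g (partial j g z) z" if "j < m" "z \<in> nbox m x e" for j z
    using W(2) that e unfolding Ck_fun_Suc[OF W(1)] by blast
  from increment_eq_sum_partials[OF this x]
  have "\<forall>y\<in>nbox m x e. \<exists>\<xi>. (\<forall>j<m. \<xi> j \<in> cart m \<and> (\<forall>i<m. \<bar>\<xi> j i - x i\<bar> \<le> \<bar>y i - x i\<bar>)) \<and>
    g y - g x = (\<Sum>j<m. (y j - x j) * partial j g (\<xi> j))" by blast
  from bchoice[OF this] obtain \<xi> where \<xi>: "\<And>y j. y \<in> nbox m x e \<Longrightarrow> j < m \<Longrightarrow> \<xi> y j \<in> cart m"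
    "\<And>y i j. y \<in> nbox m x e \<Longrightarrow> j < m \<Longrightarrow> i < m \<Longrightarrow> \<bar>\<xi> y j i - x i\<bar> \<le> \<bar>y i - x i\<bar>"
    "\<And>y. y \<in> nbox m x e \<Longrightarrow> g y - g x = (\<Sum>j<m. (y j - x j) * partial j g (\<xi> y j))"
    by blast
  have "((\<lambda>t. (\<gamma> t j - x j) / (t - t0) * partial j g (\<xi> (\<gamma> t) j)) \<longlongrightarrow> d j * partial j g x) (at t0)"
    if j: "j < m" for j
  proof (rule tendsto_mult)
    show "((\<lambda>t. (\<gamma> t j - x j) / (t - t0)) \<longlongrightarrow> d j) (at t0)"
      using d[OF j] by (simp add: has_field_derivative_iff x_def)
    have c: "continuous_on W (partial j g)"
      using W(2) j Ck_fun_0[OF W(1)] unfolding Ck_fun_Suc[OF W(1)] by blast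
    show "((\<lambda>t. partial j g (\<xi> (\<gamma> t) j)) \<longlongrightarrow> partial j g x) (at t0)"
    proof (rule tendstoI)
      fix \<epsilon> :: real assume "\<epsilon> > 0"
      then obtain r where r: "r > 0" "\<And>y. y \<in> nbox m x r \<Longrightarrow> \<bar>partial j g y - partial j g x\<bar> < \<epsilon>"
        using continuous_on_nbox[OF W(1) c] W(3) x_def by metis
      show "\<forall>\<^sub>F t in at t0. dist (partial j g (\<xi> (\<gamma> t) j)) (partial j g x) < \<epsilon>"
        using near[OF r(1)] near[OF e(1)]
      proof eventually_elim
        case (elim t)
        have "\<xi> (\<gamma> t) j \<in> nbox m x r"
          using \<xi>(1,2)[OF elim(2) j] elim(1) le_less_trans unfolding nbox_def by blast
        then show ?case using r(2) by (simp add: dist_real_def)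
      qed
    qed
  qed
  then have lim: "((\<lambda>t. \<Sum>j<m. (\<gamma> t j - x j) / (t - t0) * partial j g (\<xi> (\<gamma> t) j)) \<longlongrightarrow>
      (\<Sum>j<m. d j * partial j g x)) (at t0)"
    by (intro tendsto_sum) auto
  have "\<forall>\<^sub>F t in at t0. (\<Sum>j<m. (\<gamma> t j - x j) / (t - t0) * partial j g (\<xi> (\<gamma> t) j))
      = (g (\<gamma> t) - g x) / (t - t0)"
    using near[OF e(1)]
  proof eventually_elim
    case (elim t)
    show ?case by (simp add: \<xi>(3)[OF elim] sum_divide_distrib)
  qed
  from Lim_transform_eventually[OF lim this]
  show ?thesis by (simp add: has_field_derivative_iff x_def)
qed

lemma has_partial_compose:
  assumes O: "opn n O'" and W: "opn m W" "Ck_fun (Suc 0) m W g"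
    and f: "\<And>j. j < m \<Longrightarrow> Ck_fun (Suc 0) n O' (\<lambda>x. f x j)" "f ` O' \<subseteq> W"
    and x: "x \<in> O'" "i < n"
  shows "has_partial i (\<lambda>x. g (f x)) (\<Sum>j<m. partial i (\<lambda>x. f x j) x * partial j g (f x)) x"
proof -
  have "((\<lambda>t. g (f (x(i := t)))) has_real_derivative
      (\<Sum>j<m. partial i (\<lambda>x. f x j) x * partial j g (f (x(i := x i))))) (at (x i))"
  proof (rule chain_rule_curve[OF W])
    show "f (x(i := x i)) \<in> W" using x f by auto
    show "\<forall>\<^sub>F t in nhds (x i). f (x(i := t)) \<in> cart m"
      using opn_slice[OF O x] by eventually_elim (use f opn_subset[OF W(1)] in auto)
    show "((\<lambda>t. f (x(i := t)) j) has_real_derivative partial i (\<lambda>x. f x j) x) (at (x i))" if "j < m" for j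
      using f(1)[OF that] x unfolding Ck_fun_Suc[OF O] by blast
  qed
  then show ?thesis by simp
qed

lemma continuous_on_compose_cart:
  assumes "opn n O'" "f ` O' \<subseteq> cart m" "\<And>j. j < m \<Longrightarrow> continuous_on O' (\<lambda>x. f x j :: real)"
  shows "continuous_on O' f"
proof (rule continuous_on_coordinatewise_then_product)
  fix i show "continuous_on O' (\<lambda>x. f x i)"
  proof (cases "i < m")
    case False
    then have "f x i = 0" if "x \<in> O'" for x
      using assms(2) that by (auto simp: cart_iff)
    then show ?thesis by (simp cong: continuous_on_cong)
  qed (use assms in auto)
qed

text \<open>The induction on r has to vary \<open>g\<close>, because the chain rule produces
  \<open>partial j g\<close> composed with the same \<open>f\<close>.\<close>

lemma Ck_fun_compose:
  assumes "opn n O'" "opn m W" "f ` O' \<subseteq> W"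
    and "\<And>j. j < m \<Longrightarrow> Ck_fun r n O' (\<lambda>x. f x j)" "Ck_fun r m W g"
  shows "Ck_fun r n O' (\<lambda>x. g (f x))"
  using assms(4,5)
proof (induction r arbitrary: g)
  case (0 g)
  have "continuous_on O' f"
    by (rule continuous_on_compose_cart[of n O' f m])
      (use assms(1-3) 0 Ck_fun_0 opn_subset[of m W] in auto)
  then have "continuous_on O' (\<lambda>x. g (f x))"
    using 0(2) assms(2,3) Ck_fun_0 by (intro continuous_on_compose2[of W g O' f]) auto
  then show ?case using assms(1) by (simp add: Ck_fun_0)
next
  case (Suc r g)
  have r: "Ck_fun r n O' (\<lambda>x. f x j)" if "j < m" for j
    using Suc.prems(1)[OF that] by (rule Ck_fun_Suc_mono[OF assms(1)])
  have one: "Ck_fun (Suc 0) k V h" if "opn k V" "Ck_fun (Suc r) k V h" for k V h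
    using that by (auto simp: Ck_fun_Suc Ck_fun_0 intro: Ck_fun_continuous)
  show ?case
  proof (rule Ck_fun_SucI[OF assms(1)])
    show "continuous_on O' (\<lambda>x. g (f x))"
      by (rule Ck_fun_continuous[OF assms(1) Suc.IH[OF r]])
        (use Ck_fun_Suc_mono[OF assms(2) Suc.prems(2)] in auto)
    show "has_partial i (\<lambda>x. g (f x)) (\<Sum>j<m. partial i (\<lambda>x. f x j) x * partial j g (f x)) x"
      if "i < n" "x \<in> O'" for i x
      by (rule has_partial_compose[OF assms(1,2) one[OF assms(2) Suc.prems(2)] one[OF assms(1) Suc.prems(1)]
            assms(3) that(2,1)])
    show "Ck_fun r n O' (\<lambda>x. \<Sum>j<m. partial i (\<lambda>x. f x j) x * partial j g (f x))" if "i < n" for i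
    proof (intro Ck_fun_sum Ck_fun_mult assms(1))
      fix j assume j: "j \<in> {..<m}"
      show "Ck_fun r n O' (partial i (\<lambda>x. f x j))"
        using Suc.prems(1)[of j] j \<open>i < n\<close> unfolding Ck_fun_Suc[OF assms(1)] by blast
      show "Ck_fun r n O' (\<lambda>x. partial j g (f x))"
        by (rule Suc.IH[OF r]) (use Suc.prems(2) j in \<open>auto simp: Ck_fun_Suc[OF assms(2)]\<close>)
    qed
  qed
qed

section \<open>Smooth functions\<close>

lemma smooth_fun_cong:
  "opn n O' \<Longrightarrow> (\<And>y. y \<in> O' \<Longrightarrow> f y = g y) \<Longrightarrow> smooth_fun n O' f \<longleftrightarrow> smooth_fun n O' g"
  unfolding smooth_fun_def using Ck_fun_cong by blast

lemma smooth_fun_subset: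
  "smooth_fun n O' f \<Longrightarrow> opn n O' \<Longrightarrow> opn n W \<Longrightarrow> W \<subseteq> O' \<Longrightarrow> smooth_fun n W f"
  unfolding smooth_fun_def using Ck_fun_subset by blast

lemma smooth_fun_local:
  assumes "opn n O'" "\<And>x. x \<in> O' \<Longrightarrow> \<exists>W. opn n W \<and> x \<in> W \<and> W \<subseteq> O' \<and> smooth_fun n W f"
  shows "smooth_fun n O' f"
  unfolding smooth_fun_def
proof
  fix r show "Ck_fun r n O' f"
  proof (rule Ck_fun_local[OF assms(1)])
    fix x assume "x \<in> O'"
    from assms(2)[OF this] show "\<exists>W. opn n W \<and> x \<in> W \<and> W \<subseteq> O' \<and> Ck_fun r n W f"
      unfolding smooth_fun_def by blast
  qed
qed

lemma smooth_fun_const: "opn n O' \<Longrightarrow> smooth_fun n O' (\<lambda>_. c)"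
  by (simp add: smooth_fun_def Ck_fun_const)

lemma smooth_fun_coord: "opn n O' \<Longrightarrow> smooth_fun n O' (\<lambda>x. x j)"
  by (simp add: smooth_fun_def Ck_fun_coord)

lemma smooth_fun_add:
  "opn n O' \<Longrightarrow> smooth_fun n O' f \<Longrightarrow> smooth_fun n O' g \<Longrightarrow> smooth_fun n O' (\<lambda>x. f x + g x)"
  by (simp add: smooth_fun_def Ck_fun_add)

lemma smooth_fun_mult:
  "opn n O' \<Longrightarrow> smooth_fun n O' f \<Longrightarrow> smooth_fun n O' g \<Longrightarrow> smooth_fun n O' (\<lambda>x. f x * g x)"
  by (simp add: smooth_fun_def Ck_fun_mult)

lemma smooth_fun_diff:
  assumes "opn n O'" "smooth_fun n O' f" "smooth_fun n O' g"
  shows "smooth_fun n O' (\<lambda>x. f x - g x)"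
  using smooth_fun_add[OF assms(1,2) smooth_fun_mult[OF assms(1) smooth_fun_const[OF assms(1), of "-1"] assms(3)]]
  by simp

lemma smooth_fun_sum:
  "opn n O' \<Longrightarrow> (\<And>a. a \<in> A \<Longrightarrow> smooth_fun n O' (f a)) \<Longrightarrow> smooth_fun n O' (\<lambda>x. \<Sum>a\<in>A. f a x)"
  by (simp add: smooth_fun_def Ck_fun_sum)

lemma smooth_fun_continuous: "opn n O' \<Longrightarrow> smooth_fun n O' f \<Longrightarrow> continuous_on O' f"
  using Ck_fun_continuous smooth_fun_def by blast

lemma smooth_fun_partial: "opn n O' \<Longrightarrow> smooth_fun n O' f \<Longrightarrow> i < n \<Longrightarrow> smooth_fun n O' (partial i f)"
  unfolding smooth_fun_def using Ck_fun_Suc by blast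

lemma smooth_fun_has_partial:
  "opn n O' \<Longrightarrow> smooth_fun n O' f \<Longrightarrow> i < n \<Longrightarrow> x \<in> O' \<Longrightarrow> has_partial i f (partial i f x) x"
  unfolding smooth_fun_def using Ck_fun_Suc by blast

text \<open>A bootstrapping rule for functions whose derivatives are expressed through the function
  itself, such as the local inverse in \<open>inverse_of_coordinate_change\<close>: each order of
  regularity of \<open>f\<close> passes to the formulas \<open>D i\<close> and so yields the next
  order of \<open>f\<close>.\<close>

lemma smooth_funI:
  assumes "opn n O'" "continuous_on O' f"
    and "\<And>i x. i < n \<Longrightarrow> x \<in> O' \<Longrightarrow> has_partial i f (D i x) x"
    and "\<And>i r. i < n \<Longrightarrow> Ck_fun r n O' f \<Longrightarrow> Ck_fun r n O' (D i)"
  shows "smooth_fun n O' f"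
  unfolding smooth_fun_def
proof
  fix r show "Ck_fun r n O' f"
  proof (induction r)
    case 0
    then show ?case using assms by (simp only: Ck_fun_0)
  next
    case (Suc r)
    then show ?case by (intro Ck_fun_SucI[OF assms(1-3)] assms(4))
  qed
qed

lemma smooth_fun_compose:
  assumes "opn n O'" "opn m W" "f ` O' \<subseteq> W"
    and "\<And>j. j < m \<Longrightarrow> smooth_fun n O' (\<lambda>x. f x j)" "smooth_fun m W g"
  shows "smooth_fun n O' (\<lambda>x. g (f x))"
  using Ck_fun_compose[OF assms(1-3)] assms(4,5) unfolding smooth_fun_def by blast

text \<open>For functions whose iterated derivatives are awkward to write down but stay in an
  explicit family \<open>S\<close>. The family consists of multiples of powers of 1/t for
  \<open>inverse\<close>, and of polynomials in 1/t times exp(-1/t) for \<open>bump\<close>.\<close>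

lemma smooth_fun_closure:
  fixes S :: "(real \<Rightarrow> real) set"
  assumes "opn n O'" "smooth_fun n O' f" "f ` O' \<subseteq> T"
    and S: "\<And>g. g \<in> S \<Longrightarrow> \<exists>g'\<in>S. \<forall>t\<in>T. (g has_real_derivative g' t) (at t)"
    and "g \<in> S"
  shows "smooth_fun n O' (\<lambda>x. g (f x))"
proof -
  have c: "continuous_on O' (\<lambda>x. g (f x))" if "g \<in> S" for g
  proof (rule continuous_on_compose2[of T g])
    show "continuous_on T g"
      using S[OF that] DERIV_isCont by (metis continuous_at_imp_continuous_on)
  qed (use assms smooth_fun_continuous in auto)
  have "Ck_fun r n O' (\<lambda>x. g (f x))" if "g \<in> S" for g r
    using that
  proof (induction r arbitrary: g)
    case 0
    then show ?case using c assms(1) by (simp add: Ck_fun_0)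
  next
    case (Suc r)
    then obtain g' where g': "g' \<in> S" "\<And>t. t \<in> T \<Longrightarrow> (g has_real_derivative g' t) (at t)"
      using S by blast
    show ?case
    proof (rule Ck_fun_SucI[OF assms(1) c[OF Suc.prems]])
      fix i assume i: "i < n"
      show "Ck_fun r n O' (\<lambda>x. g' (f x) * partial i f x)"
        using Suc.IH[OF g'(1)] smooth_fun_partial[OF assms(1,2) i] assms(1)
        by (auto intro!: Ck_fun_mult simp: smooth_fun_def)
      fix x assume x: "x \<in> O'"
      have "(g has_real_derivative g' (f x)) (at (f (x(i := x i))))"
        using g'(2) x assms(3) by auto
      from DERIV_chain2[OF this smooth_fun_has_partial[OF assms(1,2) i x]]
      show "has_partial i (\<lambda>x. g (f x)) (g' (f x) * partial i f x) x" .
    qed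
  qed
  then show ?thesis using assms(5) by (simp add: smooth_fun_def)
qed

lemma smooth_fun_inverse:
  assumes "opn n O'" "smooth_fun n O' f" "\<And>x. x \<in> O' \<Longrightarrow> f x \<noteq> 0"
  shows "smooth_fun n O' (\<lambda>x. inverse (f x))"
proof -
  define S where "S = {g. \<exists>c k. g = (\<lambda>t :: real. c * inverse t ^ k)}"
  have "(\<lambda>t. 1 * inverse t ^ 1) \<in> S" unfolding S_def by blast
  then have inv: "inverse \<in> S" by simp
  show ?thesis
  proof (rule smooth_fun_closure[OF assms(1,2) _ _ inv, where T = "- {0}"])
    fix g assume "g \<in> S"
    then obtain c k where g: "g = (\<lambda>t :: real. c * inverse t ^ k)" unfolding S_def by blast
    show "\<exists>g'\<in>S. \<forall>t\<in>-{0}. (g has_real_derivative g' t) (at t)"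
    proof (intro bexI ballI)
      show "(\<lambda>t. (- c * real k) * inverse t ^ Suc k) \<in> S" unfolding S_def by blast
      fix t :: real assume "t \<in> - {0}"
      then have "(g has_real_derivative c * (real k * (- (inverse t ^ Suc (Suc 0)) * inverse t ^ (k - Suc 0)))) (at t)"
        unfolding g by (intro DERIV_cmult DERIV_power DERIV_inverse) auto
      moreover have "c * (real k * (- (inverse t ^ Suc (Suc 0)) * inverse t ^ (k - Suc 0))) =
          (- c * real k) * inverse t ^ Suc k"
        by (cases k) (auto simp: mult_ac)
      ultimately show "(g has_real_derivative (- c * real k) * inverse t ^ Suc k) (at t)"
        by (rule DERIV_cong)
    qed
  qed (use assms in auto)
qed

text \<open>The left side is symmetric in i and j. Two applications of the mean value theorem, in
  coordinate i and then in coordinate j, turn it into a mixed derivative at a nearby point;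
  exchanging the roles of i and j gives the other mixed derivative, hence the symmetry of second
  derivatives.\<close>

lemma mixed_difference:
  assumes O: "opn n O'" and f: "smooth_fun n O' f" and e: "nbox n x e \<subseteq> O'" and x: "x \<in> cart n"
    and h: "0 < h" "h < e" and ij: "i < n" "j < n" "i \<noteq> j"
  shows "\<exists>y\<in>nbox n x e. f (x(i := x i + h, j := x j + h)) - f (x(i := x i + h)) - f (x(j := x j + h)) + f x
      = h * h * partial j (partial i f) y"
proof -
  have in_box: "x(i := s, j := t) \<in> nbox n x e"
    if "\<bar>s - x i\<bar> \<le> h" "\<bar>t - x j\<bar> \<le> h" for s t
    using that x h ij by (auto simp: nbox_def intro!: cart_upd)
  have d1: "((\<lambda>s. f (x(i := s, j := t))) has_real_derivative partial i f (x(i := s, j := t))) (at s)"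
    if "\<bar>s - x i\<bar> \<le> h" "\<bar>t - x j\<bar> \<le> h" for s t
  proof -
    have "x(i := s, j := t) \<in> O'" using in_box that e by blast
    from smooth_fun_has_partial[OF O f ij(1) this]
    show ?thesis using ij by (simp add: fun_upd_twist)
  qed
  have d2: "((\<lambda>t. partial i f (x(i := s, j := t))) has_real_derivative partial j (partial i f) (x(i := s, j := t))) (at t)"
    if "\<bar>s - x i\<bar> \<le> h" "\<bar>t - x j\<bar> \<le> h" for s t
  proof -
    have "x(i := s, j := t) \<in> O'" using in_box that e by blast
    from smooth_fun_has_partial[OF O smooth_fun_partial[OF O f ij(1)] ij(2) this]
    show ?thesis by simp
  qed
  define \<phi> where "\<phi> s = f (x(i := s, j := x j + h)) - f (x(i := s, j := x j))" for s
  have "(\<phi> has_real_derivative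
      partial i f (x(i := s, j := x j + h)) - partial i f (x(i := s, j := x j))) (at s)"
    if "x i \<le> s" "s \<le> x i + h" for s
    unfolding \<phi>_def by (intro DERIV_diff d1) (use that h in auto)
  then have "\<exists>s. x i < s \<and> s < x i + h \<and> \<phi> (x i + h) - \<phi> (x i) = (x i + h - x i) *
      (partial i f (x(i := s, j := x j + h)) - partial i f (x(i := s, j := x j)))"
    by (intro MVT2) (use h in auto)
  then obtain s where s: "x i < s" "s < x i + h"
    "\<phi> (x i + h) - \<phi> (x i) = h * (partial i f (x(i := s, j := x j + h)) - partial i f (x(i := s, j := x j)))"
    by auto
  have "\<exists>t. x j < t \<and> t < x j + h \<and> partial i f (x(i := s, j := x j + h)) - partial i f (x(i := s, j := x j))
      = (x j + h - x j) * partial j (partial i f) (x(i := s, j := t))"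
    by (intro MVT2 d2) (use s h in auto)
  then obtain t where t: "x j < t" "t < x j + h"
    "partial i f (x(i := s, j := x j + h)) - partial i f (x(i := s, j := x j))
      = h * partial j (partial i f) (x(i := s, j := t))"
    by auto
  have "x(i := s, j := t) \<in> nbox n x e" using s t by (intro in_box) auto
  moreover have "f (x(i := x i + h, j := x j + h)) - f (x(i := x i + h)) - f (x(j := x j + h)) + f x
      = \<phi> (x i + h) - \<phi> (x i)"
    unfolding \<phi>_def using ij by (simp add: fun_upd_idem_iff[THEN iffD2] fun_upd_triv)
  ultimately show ?thesis using s t by auto
qed

lemma partial_commute:
  assumes O: "opn n O'" and f: "smooth_fun n O' f" and x: "x \<in> O'" and ij: "i < n" "j < n"
  shows "partial i (partial j f) x = partial j (partial i f) x"
proof (cases "i = j")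
  case False
  have xc: "x \<in> cart n" using x opn_subset[OF O] by blast
  note sm = smooth_fun_partial[OF O]
  have *: "\<bar>partial i (partial j f) x - partial j (partial i f) x\<bar> < 2 * \<epsilon>" if \<epsilon>: "\<epsilon> > 0" for \<epsilon>
  proof -
    obtain d1 where d1: "d1 > 0" "nbox n x d1 \<subseteq> O'"
      "\<And>y. y \<in> nbox n x d1 \<Longrightarrow> \<bar>partial i (partial j f) y - partial i (partial j f) x\<bar> < \<epsilon>"
      using continuous_on_nbox[OF O smooth_fun_continuous[OF O sm[OF sm[OF f ij(2)] ij(1)]] x \<epsilon>] by blast
    obtain d2 where d2: "d2 > 0" "nbox n x d2 \<subseteq> O'"
      "\<And>y. y \<in> nbox n x d2 \<Longrightarrow> \<bar>partial j (partial i f) y - partial j (partial i f) x\<bar> < \<epsilon>"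
      using continuous_on_nbox[OF O smooth_fun_continuous[OF O sm[OF sm[OF f ij(1)] ij(2)]] x \<epsilon>] by blast
    \<comment> \<open>One step size for both orders of differentiation, so that the two second
      differences are the same number.\<close>
    define h where "h = min d1 d2 / 2"
    have h: "0 < h" "h < d1" "h < d2" using d1(1) d2(1) by (auto simp: h_def)
    obtain y where y: "y \<in> nbox n x d2"
      "f (x(i := x i + h, j := x j + h)) - f (x(i := x i + h)) - f (x(j := x j + h)) + f x
        = h * h * partial j (partial i f) y"
      using mixed_difference[OF O f d2(2) xc h(1,3) ij False] by blast
    obtain z where z: "z \<in> nbox n x d1"
      "f (x(j := x j + h, i := x i + h)) - f (x(j := x j + h)) - f (x(i := x i + h)) + f x
        = h * h * partial i (partial j f) z"
      using mixed_difference[OF O f d1(2) xc h(1,2) ij(2,1)] False by blast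
    have "x(i := x i + h, j := x j + h) = x(j := x j + h, i := x i + h)"
      using False by (simp add: fun_upd_twist)
    then have "f (x(i := x i + h, j := x j + h)) = f (x(j := x j + h, i := x i + h))" by (rule arg_cong)
    with y(2) z(2) have "h * h * partial j (partial i f) y = h * h * partial i (partial j f) z"
      by (simp only: diff_right_commute)
    then have "partial j (partial i f) y = partial i (partial j f) z" using h by simp
    then show ?thesis using d1(3)[OF z(1)] d2(3)[OF y(1)] by linarith
  qed
  show ?thesis
  proof (rule ccontr)
    assume "\<not> ?thesis"
    then show False
      using *[of "\<bar>partial i (partial j f) x - partial j (partial i f) x\<bar> / 2"] by simp
  qed
qed simp

section \<open>Directional derivatives, smooth maps and Jacobians\<close>

lemma dir_deriv_cong:
  "opn n O' \<Longrightarrow> x \<in> O' \<Longrightarrow> (\<And>y. y \<in> O' \<Longrightarrow> f y = g y) \<Longrightarrow> dir_deriv n f x v = dir_deriv n g x v"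
  unfolding dir_deriv_def by (intro sum.cong refl) (metis partial_cong lessThan_iff)

lemma partial_const: "partial i (\<lambda>_. c) x = 0"
  by (simp add: partial_def)

lemma dir_deriv_const [simp]: "dir_deriv n (\<lambda>_. c) x v = 0"
  by (simp add: dir_deriv_def partial_const)

lemma partial_coord: "partial i (\<lambda>x. x j) x = (if i = j then 1 else 0)"
  by (intro has_partial_imp_partial) (cases "i = j"; simp)

lemma partial_add:
  assumes "opn n O'" "smooth_fun n O' f" "smooth_fun n O' g" "x \<in> O'" "i < n"
  shows "partial i (\<lambda>x. f x + g x) x = partial i f x + partial i g x"
  by (intro has_partial_imp_partial DERIV_add) (use assms smooth_fun_has_partial in blast)+

lemma partial_mult:
  assumes "opn n O'" "smooth_fun n O' f" "smooth_fun n O' g" "x \<in> O'" "i < n"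
  shows "partial i (\<lambda>x. f x * g x) x = partial i f x * g x + f x * partial i g x"
  using DERIV_mult[OF smooth_fun_has_partial[OF assms(1,2,5,4)] smooth_fun_has_partial[OF assms(1,3,5,4)]]
  by (intro has_partial_imp_partial) (simp add: mult.commute)

lemma dir_deriv_add:
  assumes "opn n O'" "smooth_fun n O' f" "smooth_fun n O' g" "x \<in> O'"
  shows "dir_deriv n (\<lambda>x. f x + g x) x v = dir_deriv n f x v + dir_deriv n g x v"
  using partial_add[OF assms] by (simp add: dir_deriv_def algebra_simps sum.distrib)

lemma dir_deriv_mult:
  assumes "opn n O'" "smooth_fun n O' f" "smooth_fun n O' g" "x \<in> O'"
  shows "dir_deriv n (\<lambda>x. f x * g x) x v = dir_deriv n f x v * g x + f x * dir_deriv n g x v"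
  using partial_mult[OF assms]
  by (simp add: dir_deriv_def algebra_simps sum.distrib sum_distrib_left)

lemma dir_deriv_sum:
  assumes "opn n O'" "\<And>a. a \<in> A \<Longrightarrow> smooth_fun n O' (f a)" "x \<in> O'"
  shows "dir_deriv n (\<lambda>x. \<Sum>a\<in>A. f a x) x v = (\<Sum>a\<in>A. dir_deriv n (f a) x v)"
  using assms(2)
proof (induction A rule: infinite_finite_induct)
  case (insert a A)
  have "dir_deriv n (\<lambda>x. f a x + (\<Sum>a\<in>A. f a x)) x v =
      dir_deriv n (f a) x v + dir_deriv n (\<lambda>x. \<Sum>a\<in>A. f a x) x v"
    using insert.prems assms by (intro dir_deriv_add[of n O'] smooth_fun_sum) auto
  then show ?case using insert by simp
qed auto

lemma dir_deriv_linear: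
  "dir_deriv n f x (\<lambda>j. a * u j + b * v j) = a * dir_deriv n f x u + b * dir_deriv n f x v"
  by (simp add: dir_deriv_def algebra_simps sum.distrib sum_distrib_left)

lemma smooth_fun_dir_deriv:
  assumes "opn n O'" "smooth_fun n O' f" "\<And>j. j < n \<Longrightarrow> smooth_fun n O' (\<lambda>x. V x j)"
  shows "smooth_fun n O' (\<lambda>x. dir_deriv n f x (V x))"
  unfolding dir_deriv_def
  by (intro smooth_fun_sum smooth_fun_mult smooth_fun_partial assms) (use assms in auto)

lemma smooth_cartD: "smooth_cart n O' m f \<Longrightarrow> i < m \<Longrightarrow> smooth_fun n O' (\<lambda>x. f x i)"
  "smooth_cart n O' m f \<Longrightarrow> x \<in> O' \<Longrightarrow> f x \<in> cart m"
  by (auto simp: smooth_cart_def)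

lemma smooth_cart_coord:
  assumes "opn n O'" "smooth_cart n O' m f"
  shows "smooth_fun n O' (\<lambda>x. f x i)"
proof (cases "i < m")
  case False
  then have "f x i = 0" if "x \<in> O'" for x
    using assms(2) that False unfolding smooth_cart_def by (auto simp: cart_iff image_subset_iff)
  then show ?thesis using smooth_fun_const[OF assms(1)] smooth_fun_cong[OF assms(1), of "\<lambda>x. f x i" "\<lambda>_. 0"] by blast
qed (use assms smooth_cartD in auto)

lemma smooth_cart_cong:
  "opn n O' \<Longrightarrow> (\<And>y. y \<in> O' \<Longrightarrow> f y = g y) \<Longrightarrow> smooth_cart n O' m f \<longleftrightarrow> smooth_cart n O' m g"
  unfolding smooth_cart_def by (auto simp: image_subset_iff smooth_fun_cong[of n O' "\<lambda>x. f x _" "\<lambda>x. g x _"])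

lemma smooth_cart_subset:
  "smooth_cart n O' m f \<Longrightarrow> opn n O' \<Longrightarrow> opn n W \<Longrightarrow> W \<subseteq> O' \<Longrightarrow> smooth_cart n W m f"
  unfolding smooth_cart_def using smooth_fun_subset by blast

lemma smooth_cart_local:
  assumes "opn n O'" "\<And>x. x \<in> O' \<Longrightarrow> \<exists>W. opn n W \<and> x \<in> W \<and> W \<subseteq> O' \<and> smooth_cart n W m f"
  shows "smooth_cart n O' m f"
  unfolding smooth_cart_def
proof (intro conjI allI impI)
  show "f ` O' \<subseteq> cart m" using assms(2) unfolding smooth_cart_def by blast
  fix i assume "i < m"
  show "smooth_fun n O' (\<lambda>x. f x i)"
  proof (rule smooth_fun_local[OF assms(1)])
    fix x assume "x \<in> O'"
    from assms(2)[OF this] show "\<exists>W. opn n W \<and> x \<in> W \<and> W \<subseteq> O' \<and> smooth_fun n W (\<lambda>x. f x i)"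
      using \<open>i < m\<close> unfolding smooth_cart_def by blast
  qed
qed

lemma smooth_cart_continuous: "opn n O' \<Longrightarrow> smooth_cart n O' m f \<Longrightarrow> continuous_on O' f"
  by (rule continuous_on_compose_cart) (auto simp: smooth_cart_def smooth_fun_continuous)

lemma smooth_cart_preimage:
  "opn n O' \<Longrightarrow> smooth_cart n O' m f \<Longrightarrow> opn m W \<Longrightarrow> opn n {x \<in> O'. f x \<in> W}"
  by (rule opn_preimage) (auto simp: smooth_cart_def smooth_cart_continuous)

lemma smooth_cart_compose:
  assumes "opn n O'" "opn m W" "f ` O' \<subseteq> W" "smooth_cart n O' m f" "smooth_cart m W l g"
  shows "smooth_cart n O' l (g \<circ> f)"
  unfolding smooth_cart_def
proof (intro conjI allI impI)
  show "(g \<circ> f) ` O' \<subseteq> cart l" using assms(3,5) unfolding smooth_cart_def comp_def by blast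
  show "smooth_fun n O' (\<lambda>x. (g \<circ> f) x i)" if "i < l" for i
    unfolding comp_def
    by (rule smooth_fun_compose[OF assms(1-3)]) (use assms that smooth_cartD in auto)
qed

lemma smooth_cart_id: "opn n O' \<Longrightarrow> smooth_cart n O' n (\<lambda>x. x)"
  using opn_subset by (auto simp: smooth_cart_def smooth_fun_coord)

lemma smooth_cart_const: "opn n O' \<Longrightarrow> c \<in> cart m \<Longrightarrow> smooth_cart n O' m (\<lambda>_. c)"
  by (auto simp: smooth_cart_def smooth_fun_const)

lemma jac_cart [simp]: "jac n m f x v \<in> cart m"
  by (simp add: jac_def cart_iff)

lemma jac_cong:
  assumes "opn n O'" "x \<in> O'" "\<And>y. y \<in> O' \<Longrightarrow> f y = g y"
  shows "jac n m f x v = jac n m g x v"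
proof -
  have "dir_deriv n (\<lambda>y. f y i) x v = dir_deriv n (\<lambda>y. g y i) x v" for i
    by (rule dir_deriv_cong[OF assms(1,2)]) (simp add: assms(3))
  then show ?thesis unfolding jac_def by presburger
qed

lemma dir_deriv_compose:
  assumes "opn n O'" "opn m W" "f ` O' \<subseteq> W" "smooth_cart n O' m f" "smooth_fun m W g" "x \<in> O'"
  shows "dir_deriv n (\<lambda>x. g (f x)) x v = dir_deriv m g (f x) (jac n m f x v)"
proof -
  have "partial i (\<lambda>x. g (f x)) x = (\<Sum>j<m. partial i (\<lambda>x. f x j) x * partial j g (f x))" if "i < n" for i
    by (intro has_partial_imp_partial has_partial_compose[OF assms(1,2)])
      (use assms that smooth_cartD in \<open>auto simp: smooth_fun_def\<close>)
  then have "dir_deriv n (\<lambda>x. g (f x)) x v =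
      (\<Sum>i<n. \<Sum>j<m. v i * (partial i (\<lambda>x. f x j) x * partial j g (f x)))"
    by (simp add: dir_deriv_def sum_distrib_left)
  also have "\<dots> = (\<Sum>j<m. \<Sum>i<n. v i * (partial i (\<lambda>x. f x j) x * partial j g (f x)))"
    by (rule sum.swap)
  also have "\<dots> = dir_deriv m g (f x) (jac n m f x v)"
    by (simp add: dir_deriv_def jac_def sum_distrib_right mult.assoc)
  finally show ?thesis .
qed

lemma jac_compose:
  assumes "opn n O'" "opn m W" "f ` O' \<subseteq> W" "smooth_cart n O' m f" "smooth_cart m W l g" "x \<in> O'"
  shows "jac n l (g \<circ> f) x v = jac m l g (f x) (jac n m f x v)"
proof
  fix i
  show "jac n l (g \<circ> f) x v i = jac m l g (f x) (jac n m f x v) i"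
  proof (cases "i < l")
    case True
    from dir_deriv_compose[OF assms(1-4) smooth_cartD(1)[OF assms(5) True] assms(6)] True
    show ?thesis by (simp add: jac_def[of n l] jac_def[of m l])
  qed (simp add: jac_def)
qed

lemma dir_deriv_coord: "i < n \<Longrightarrow> dir_deriv n (\<lambda>x. x i) x v = v i"
  by (simp add: dir_deriv_def partial_coord if_distrib cong: if_cong)

lemma jac_id: "v \<in> cart n \<Longrightarrow> jac n n (\<lambda>x. x) x v = v"
  by (rule cart_eqI[of _ n]) (simp_all add: jac_def dir_deriv_coord cart_iff)

lemma jac_linear:
  "jac n m f x (\<lambda>j. a * u j + b * v j) = (\<lambda>i. a * jac n m f x u i + b * jac n m f x v i)"
  by (simp add: jac_def dir_deriv_linear fun_eq_iff)

lemma smooth_cart_jac: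
  assumes "opn n O'" "smooth_cart n O' m f"
  shows "smooth_cart n O' m (\<lambda>x. jac n m f x v)"
  unfolding smooth_cart_def
proof (intro conjI allI impI)
  show "smooth_fun n O' (\<lambda>x. jac n m f x v i)" if "i < m" for i
    using that by (simp add: jac_def smooth_fun_dir_deriv smooth_fun_const smooth_cartD(1)[OF assms(2)] assms(1))
qed auto

lemma dir_deriv_commute:
  assumes "opn n O'" "smooth_fun n O' f" "x \<in> O'"
  shows "dir_deriv n (\<lambda>y. dir_deriv n f y u) x v = dir_deriv n (\<lambda>y. dir_deriv n f y v) x u"
proof -
  have *: "dir_deriv n (\<lambda>y. dir_deriv n f y u) x v = (\<Sum>j<n. \<Sum>i<n. u i * v j * partial j (partial i f) x)" for u v
  proof -
    have "dir_deriv n (\<lambda>y. dir_deriv n f y u) x v = (\<Sum>i<n. dir_deriv n (\<lambda>y. u i * partial i f y) x v)"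
      unfolding dir_deriv_def[of n f]
      by (rule dir_deriv_sum[OF assms(1) _ assms(3)])
        (use assms in \<open>auto intro!: smooth_fun_mult smooth_fun_const smooth_fun_partial\<close>)
    also have "\<dots> = (\<Sum>i<n. u i * dir_deriv n (partial i f) x v)"
      by (intro sum.cong refl, subst dir_deriv_mult[OF assms(1) smooth_fun_const[OF assms(1)]
            smooth_fun_partial[OF assms(1,2)] assms(3)]) auto
    also have "\<dots> = (\<Sum>i<n. \<Sum>j<n. u i * v j * partial j (partial i f) x)"
      by (simp add: dir_deriv_def sum_distrib_left mult.assoc)
    also have "\<dots> = (\<Sum>j<n. \<Sum>i<n. u i * v j * partial j (partial i f) x)"
      by (rule sum.swap)
    finally show ?thesis .
  qed
  have "dir_deriv n (\<lambda>y. dir_deriv n f y u) x v = (\<Sum>j<n. \<Sum>i<n. v j * u i * partial i (partial j f) x)"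
    unfolding * by (intro sum.cong refl) (simp add: partial_commute[OF assms] mult.commute)
  also have "\<dots> = (\<Sum>i<n. \<Sum>j<n. v j * u i * partial i (partial j f) x)"
    by (rule sum.swap)
  finally show ?thesis unfolding *[of v u] .
qed

text \<open>Constant vector fields commute. In the computation of the Lie derivative this exchanges
  the direction of differentiation with an argument of the form.\<close>

lemma jac_commute:
  assumes "opn n O'" "smooth_cart n O' m f" "x \<in> O'"
  shows "jac n m (\<lambda>y. jac n m f y u) x v = jac n m (\<lambda>y. jac n m f y v) x u"
  unfolding jac_def using dir_deriv_commute[OF assms(1) smooth_cartD(1)[OF assms(2)] assms(3), of _ u v]
  by (intro ext) (simp cong: if_cong)

section \<open>Alternating forms with smooth coefficients\<close>

definition ebas :: "nat \<Rightarrow> vec" where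
  "ebas j = (\<lambda>i. if i = j then 1 else 0)"

lemma ebas_cart: "j < n \<Longrightarrow> ebas j \<in> cart n"
  by (simp add: ebas_def cart_iff)

lemma zero_cart [simp]: "(\<lambda>_. 0) \<in> cart n"
  by (simp add: cart_iff)

lemma lincomb_cart: "u \<in> cart n \<Longrightarrow> v \<in> cart n \<Longrightarrow> (\<lambda>j. a * u j + b * v j) \<in> cart n"
  by (simp add: cart_iff)

lemma dir_deriv_ebas: "j < n \<Longrightarrow> dir_deriv n f x (ebas j) = partial j f x"
proof -
  assume j: "j < n"
  have "dir_deriv n f x (ebas j) = (\<Sum>i<n. if i = j then partial i f x else 0)"
    unfolding dir_deriv_def ebas_def by (intro sum.cong) auto
  then show ?thesis using j by simp
qed

lemma lforms_zero:
  "w \<in> lforms k n O' \<Longrightarrow> \<not> (x \<in> O' \<and> length vs = k \<and> set vs \<subseteq> cart n) \<Longrightarrow> w x vs = 0"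
  unfolding lforms_def by blast

lemma lforms_linear:
  "w \<in> lforms k n O' \<Longrightarrow> length vs = k \<Longrightarrow> set vs \<subseteq> cart n \<Longrightarrow> i < k \<Longrightarrow>
    u \<in> cart n \<Longrightarrow> v \<in> cart n \<Longrightarrow>
    w x (vs[i := (\<lambda>j. a * u j + b * v j)]) = a * w x (vs[i := u]) + b * w x (vs[i := v])"
  using lforms_zero[of w k n O' x] unfolding lforms_def by (cases "x \<in> O'") auto

lemma lforms_alt:
  assumes "w \<in> lforms k n O'" "length vs = k" "set vs \<subseteq> cart n" "i \<noteq> j" "i < k" "j < k" "vs ! i = vs ! j"
  shows "w x vs = 0"
proof (cases "x \<in> O'")
  case True
  consider "i < j" | "j < i" using assms(4) by linarith
  then show ?thesis
  proof cases
    case 1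
    then show ?thesis using True assms unfolding lforms_def by blast
  next
    case 2
    then show ?thesis using True assms(1-3,5) assms(7)[symmetric] unfolding lforms_def by blast
  qed
qed (use lforms_zero[OF assms(1)] in blast)

lemma lforms_smooth:
  assumes "w \<in> lforms k n O'" "opn n O'"
  shows "smooth_fun n O' (\<lambda>x. w x vs)"
proof (cases "length vs = k \<and> set vs \<subseteq> cart n")
  case True
  then show ?thesis using assms unfolding lforms_def by blast
next
  case False
  then have "(\<lambda>x. w x vs) = (\<lambda>_. 0)" using lforms_zero[OF assms(1)] by blast
  then show ?thesis using smooth_fun_const[OF assms(2)] by simp
qed

lemma set_update_cart: "set vs \<subseteq> cart n \<Longrightarrow> v \<in> cart n \<Longrightarrow> set (vs[i := v]) \<subseteq> cart n"
  using set_update_subset_insert[of vs i v] by auto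

lemma lforms_zero_slot:
  assumes "w \<in> lforms k n O'" "i < length vs" "vs ! i = (\<lambda>_. 0)"
  shows "w x vs = 0"
proof (cases "length vs = k \<and> set vs \<subseteq> cart n")
  case True
  have "vs = vs[i := (\<lambda>j. 0 * (0 :: real) + 0 * 0)]"
    using list_update_id[of vs i] assms(3) by simp
  then show ?thesis
    using lforms_linear[OF assms(1), of vs i "\<lambda>_. 0" "\<lambda>_. 0" x 0 0] True assms(2) by simp
qed (use lforms_zero[OF assms(1)] in blast)

lemma lforms_sum_slot:
  assumes "w \<in> lforms k n O'" "length vs = k" "set vs \<subseteq> cart n" "i < k" "finite A"
    and "\<And>l. l \<in> A \<Longrightarrow> u l \<in> cart n"
  shows "w x (vs[i := (\<lambda>j. \<Sum>l\<in>A. c l * u l j)]) = (\<Sum>l\<in>A. c l * w x (vs[i := u l]))"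
  using assms(5,6)
proof (induction A rule: finite_induct)
  case empty
  show ?case using lforms_zero_slot[OF assms(1), of i "vs[i := (\<lambda>_. 0)]"] assms(2,4) by simp
next
  case (insert l A)
  have "(\<lambda>j. \<Sum>l\<in>A. c l * u l j) \<in> cart n"
    using insert.prems by (auto simp: cart_iff intro!: sum.neutral)
  then have "w x (vs[i := (\<lambda>j. c l * u l j + 1 * (\<Sum>l\<in>A. c l * u l j))]) =
      c l * w x (vs[i := u l]) + 1 * w x (vs[i := (\<lambda>j. \<Sum>l\<in>A. c l * u l j)])"
    using insert.prems by (intro lforms_linear[OF assms(1-4)]) auto
  then show ?case using insert by simp
qed

lemma cart_expand: "v \<in> cart n \<Longrightarrow> v = (\<lambda>j. \<Sum>l<n. v l * ebas l j)"
  by (rule cart_eqI[of _ n])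
    (auto simp: cart_iff ebas_def if_distrib cong: if_cong intro!: sum.neutral)

lemma lforms_expand:
  assumes "w \<in> lforms k n O'" "length (us @ v # vs) = k" "set (us @ v # vs) \<subseteq> cart n"
  shows "w x (us @ v # vs) = (\<Sum>l<n. v l * w x (us @ ebas l # vs))"
proof -
  have v: "v = (\<lambda>j. \<Sum>l<n. v l * ebas l j)"
    by (rule cart_expand) (use assms(3) in auto)
  have "w x ((us @ v # vs)[length us := (\<lambda>j. \<Sum>l<n. v l * ebas l j)]) =
      (\<Sum>l<n. v l * w x ((us @ v # vs)[length us := ebas l]))"
    by (rule lforms_sum_slot[OF assms]) (use assms(2) ebas_cart in auto)
  then show ?thesis unfolding v[symmetric] by simp
qed

text \<open>Polarisation: expand the vanishing value with a + b in both slots.\<close>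

lemma lforms_swap:
  assumes w: "w \<in> lforms k n O'" and vs: "length vs = k" "set vs \<subseteq> cart n"
    and ij: "i < k" "j < k" "i \<noteq> j" and ab: "a \<in> cart n" "b \<in> cart n"
  shows "w x (vs[i := a, j := b]) = - w x (vs[i := b, j := a])"
proof -
  define s where "s = (\<lambda>l. 1 * a l + 1 * b l)"
  have s: "s \<in> cart n" unfolding s_def by (rule lincomb_cart[OF ab])
  note c = set_update_cart[OF vs(2)]
  have lin: "w x (vs[j := c', i := s]) = w x (vs[j := c', i := a]) + w x (vs[j := c', i := b])"
    if "c' \<in> cart n" for c'
    using lforms_linear[OF w, of "vs[j := c']" i a b x 1 1] that c vs ij ab unfolding s_def by simp
  have zero: "w x (vs[j := c', i := c']) = 0" if "c' \<in> cart n" for c'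
    by (rule lforms_alt[OF w, of _ i j]) (use that vs ij c set_update_cart in auto)
  have "w x (vs[i := s, j := s]) = w x (vs[i := s, j := a]) + w x (vs[i := s, j := b])"
    using lforms_linear[OF w, of "vs[i := s]" j a b x 1 1] c s vs ij ab unfolding s_def by simp
  then have "0 = w x (vs[j := a, i := s]) + w x (vs[j := b, i := s])"
    using zero[OF s] ij by (simp add: list_update_swap)
  then show ?thesis
    using lin[OF ab(1)] lin[OF ab(2)] zero[OF ab(1)] zero[OF ab(2)] ij by (simp add: list_update_swap)
qed

text \<open>Contractions are formed in the first slot, while the Lie derivative substitutes into
  every slot; a transposition reduces the latter to the former. The hypothesis allows all lists
  drawn from \<open>us\<close>, because the transposition rearranges the remaining
  arguments.\<close>

lemma lforms_slot_zeroI: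
  assumes w: "w \<in> lforms k n O'" and us: "set us \<subseteq> cart n" and u: "u \<in> cart n"
    and i: "i < length us"
    and head: "\<And>us'. set us' \<subseteq> set us \<Longrightarrow> w x (u # us') = 0"
  shows "w x (us[i := u]) = 0"
proof (cases "length us = k")
  case True
  obtain v vs where us_eq: "us = v # vs" using i by (cases us) auto
  show ?thesis
  proof (cases i)
    case 0
    then show ?thesis using head[of vs] us_eq by auto
  next
    case (Suc l)
    have "w x (us[0 := v, i := u]) = - w x (us[0 := u, i := v])"
      by (rule lforms_swap[OF w True us]) (use us_eq us u True i Suc in auto)
    moreover have "w x (u # vs[l := v]) = 0"
      using set_update_subset_insert[of vs l v] us_eq by (intro head) auto
    ultimately show ?thesis using us_eq Suc by simp
  qed
qed (use lforms_zero[OF w] in simp)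

text \<open>By definition the coefficients of a form are smooth on constant arguments only. Varying
  arguments are expanded in the standard basis one after the other; the basis vectors accumulate in
  \<open>us\<close>, and the components of the expanded field become smooth factors.\<close>

lemma lforms_subst_smooth:
  assumes W: "opn n W" "w \<in> lforms k n W" and f: "opn m O'" "smooth_cart m O' n f" "f ` O' \<subseteq> W"
    and "\<And>V. V \<in> set Vs \<Longrightarrow> smooth_cart m O' n V" "set us \<subseteq> cart n" "length us + length Vs = k"
  shows "smooth_fun m O' (\<lambda>x. w (f x) (us @ map (\<lambda>V. V x) Vs))"
  using assms(6-)
proof (induction Vs arbitrary: us)
  case Nil
  then show ?case
    using smooth_fun_compose[OF f(1) W(1) f(3) smooth_cartD(1)[OF f(2)] lforms_smooth[OF W(2,1)]] by simp
next
  case (Cons V Vs)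
  have "w (f x) (us @ map (\<lambda>V. V x) (V # Vs)) = (\<Sum>l<n. V x l * w (f x) ((us @ [ebas l]) @ map (\<lambda>V. V x) Vs))"
    if "x \<in> O'" for x
  proof -
    have "set (us @ V x # map (\<lambda>V. V x) Vs) \<subseteq> cart n"
      using Cons.prems smooth_cartD(2) that by fastforce
    from lforms_expand[OF W(2) _ this] show ?thesis using Cons.prems by simp
  qed
  moreover have "smooth_fun m O' (\<lambda>x. \<Sum>l<n. V x l * w (f x) ((us @ [ebas l]) @ map (\<lambda>V. V x) Vs))"
    using Cons.prems ebas_cart
    by (intro smooth_fun_sum smooth_fun_mult f(1) Cons.IH smooth_cartD(1)[of m O' n V]) auto
  ultimately show ?case by (subst smooth_fun_cong[OF f(1)])
qed

text \<open>The Leibniz rule for a form evaluated on varying vectors. The induction is that of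
  \<open>lforms_subst_smooth\<close>: after expansion of the first field only the product rule for
  scalar functions is used, and the basis expansions are then folded back.\<close>

lemma lforms_subst_deriv:
  assumes W: "opn n W" "w \<in> lforms k n W" and f: "opn m O'" "smooth_cart m O' n f" "f ` O' \<subseteq> W"
    and x: "x \<in> O'"
    and "\<And>V. V \<in> set Vs \<Longrightarrow> smooth_cart m O' n V" "set us \<subseteq> cart n" "length us + length Vs = k"
  shows "dir_deriv m (\<lambda>x. w (f x) (us @ map (\<lambda>V. V x) Vs)) x e =
    dir_deriv n (\<lambda>y. w y (us @ map (\<lambda>V. V x) Vs)) (f x) (jac m n f x e) +
    (\<Sum>i<length Vs. w (f x) (us @ (map (\<lambda>V. V x) Vs)[i := jac m n (Vs ! i) x e]))"
  using assms(7-)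
proof (induction Vs arbitrary: us)
  case Nil
  then show ?case
    using dir_deriv_compose[OF f(1) W(1) f(3,2) lforms_smooth[OF W(2,1)] x] by simp
next
  case (Cons V Vs)
  define R where "R = (\<lambda>x. map (\<lambda>V. V x) Vs)"
  define G where "G l = (\<lambda>x. w (f x) ((us @ [ebas l]) @ R x))" for l
  have V: "smooth_cart m O' n V" using Cons.prems by simp
  have Rc: "set (R x) \<subseteq> cart n" if "x \<in> O'" for x
    using Cons.prems smooth_cartD(2) that unfolding R_def by fastforce
  have exp: "w y (us @ v # vs) = (\<Sum>l<n. v l * w y (us @ ebas l # vs))"
    if "v \<in> cart n" "set vs \<subseteq> cart n" "length vs = length Vs" for y v vs
    by (rule lforms_expand[OF W(2)]) (use that Cons.prems in auto)
  have G: "smooth_fun m O' (G l)" if "l < n" for l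
    unfolding G_def R_def by (rule lforms_subst_smooth[OF W f]) (use Cons.prems ebas_cart[OF that] in auto)
  have DG: "dir_deriv m (G l) x e = dir_deriv n (\<lambda>y. w y (us @ ebas l # R x)) (f x) (jac m n f x e) +
      (\<Sum>i<length Vs. w (f x) (us @ ebas l # (R x)[i := jac m n (Vs ! i) x e]))" if "l < n" for l
    using Cons.IH[of "us @ [ebas l]"] Cons.prems ebas_cart[OF that] unfolding G_def R_def by simp
  have "dir_deriv m (\<lambda>x. w (f x) (us @ map (\<lambda>V. V x) (V # Vs))) x e =
      dir_deriv m (\<lambda>x. \<Sum>l<n. V x l * G l x) x e"
  proof (rule dir_deriv_cong[OF f(1) x])
    fix y assume y: "y \<in> O'"
    show "w (f y) (us @ map (\<lambda>V. V y) (V # Vs)) = (\<Sum>l<n. V y l * G l y)"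
      using exp[OF smooth_cartD(2)[OF V y] Rc[OF y]] by (simp add: G_def R_def)
  qed
  also have "\<dots> = (\<Sum>l<n. dir_deriv m (\<lambda>x. V x l * G l x) x e)"
    by (rule dir_deriv_sum[OF f(1) _ x]) (use smooth_cartD(1)[OF V] G f(1) in \<open>auto intro: smooth_fun_mult\<close>)
  also have "\<dots> = (\<Sum>l<n. jac m n V x e l * G l x + V x l * dir_deriv m (G l) x e)"
    by (intro sum.cong refl)
      (simp add: dir_deriv_mult[OF f(1) smooth_cartD(1)[OF V] G x] jac_def[of m n V])
  also have "\<dots> = (\<Sum>l<n. jac m n V x e l * G l x) + (\<Sum>l<n. V x l * dir_deriv m (G l) x e)"
    by (rule sum.distrib)
  also have "(\<Sum>l<n. jac m n V x e l * G l x) = w (f x) (us @ jac m n V x e # R x)"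
    using exp[OF jac_cart Rc[OF x]] by (simp add: G_def R_def)
  also have "(\<Sum>l<n. V x l * dir_deriv m (G l) x e) =
      (\<Sum>l<n. V x l * dir_deriv n (\<lambda>y. w y (us @ ebas l # R x)) (f x) (jac m n f x e)) +
      (\<Sum>l<n. \<Sum>i<length Vs. V x l * w (f x) (us @ ebas l # (R x)[i := jac m n (Vs ! i) x e]))"
    by (simp add: DG distrib_left sum.distrib sum_distrib_left)
  also have "(\<Sum>l<n. V x l * dir_deriv n (\<lambda>y. w y (us @ ebas l # R x)) (f x) (jac m n f x e)) =
      dir_deriv n (\<lambda>y. w y (us @ V x # R x)) (f x) (jac m n f x e)"
  proof -
    have fx: "f x \<in> W" using f x by blast
    note sm = lforms_smooth[OF W(2,1)] and cn = smooth_fun_const[OF W(1)]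
    have "dir_deriv n (\<lambda>y. w y (us @ V x # R x)) (f x) (jac m n f x e) =
        dir_deriv n (\<lambda>y. \<Sum>l<n. V x l * w y (us @ ebas l # R x)) (f x) (jac m n f x e)"
      using exp[OF smooth_cartD(2)[OF V x] Rc[OF x]] by (simp add: R_def)
    also have "\<dots> = (\<Sum>l<n. dir_deriv n (\<lambda>y. V x l * w y (us @ ebas l # R x)) (f x) (jac m n f x e))"
      by (rule dir_deriv_sum[OF W(1) _ fx]) (use sm cn W(1) in \<open>auto intro: smooth_fun_mult\<close>)
    also have "\<dots> = (\<Sum>l<n. V x l * dir_deriv n (\<lambda>y. w y (us @ ebas l # R x)) (f x) (jac m n f x e))"
      by (simp add: dir_deriv_mult[OF W(1) cn sm fx])
    finally show ?thesis by simp
  qed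
  also have "(\<Sum>l<n. \<Sum>i<length Vs. V x l * w (f x) (us @ ebas l # (R x)[i := jac m n (Vs ! i) x e])) =
      (\<Sum>i<length Vs. \<Sum>l<n. V x l * w (f x) (us @ ebas l # (R x)[i := jac m n (Vs ! i) x e]))"
    by (rule sum.swap)
  also have "\<dots> = (\<Sum>i<length Vs. w (f x) (us @ V x # (R x)[i := jac m n (Vs ! i) x e]))"
    by (intro sum.cong refl exp[symmetric] smooth_cartD(2)[OF V x] set_update_cart Rc x jac_cart)
      (simp add: R_def)
  finally show ?case
    by (simp add: R_def sum.lessThan_Suc_shift del: sum.lessThan_Suc)
qed

section \<open>Pullback and Lie derivative on Cartesian spaces\<close>

lemma set_map_jac: "set (map (jac m n f x) vs) \<subseteq> cart n"
  by auto

lemma lpull_apply: "x \<in> O' \<Longrightarrow> set vs \<subseteq> cart m \<Longrightarrow> lpull m O' n f w x vs = w (f x) (map (jac m n f x) vs)"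
  by (simp add: lpull_def)

lemma lpull_smooth:
  assumes "opn n W" "w \<in> lforms k n W" "opn m O'" "smooth_cart m O' n f" "f ` O' \<subseteq> W"
  shows "smooth_fun m O' (\<lambda>x. w (f x) (map (jac m n f x) vs))"
proof (cases "length vs = k")
  case True
  have "smooth_fun m O' (\<lambda>x. w (f x) ([] @ map (\<lambda>V. V x) (map (\<lambda>v x. jac m n f x v) vs)))"
    by (rule lforms_subst_smooth[OF assms]) (use True smooth_cart_jac[OF assms(3,4)] in auto)
  then show ?thesis by (simp add: comp_def)
next
  case False
  then have "w (f x) (map (jac m n f x) vs) = 0" for x using lforms_zero[OF assms(2)] by simp
  then show ?thesis using smooth_fun_const[OF assms(3)] by simp
qed

lemma lpull_lforms:
  assumes "opn n W" "w \<in> lforms k n W" "opn m O'" "smooth_cart m O' n f" "f ` O' \<subseteq> W"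
  shows "lpull m O' n f w \<in> lforms k m O'"
  unfolding lforms_def mem_Collect_eq
proof (intro conjI allI ballI impI)
  fix x vs assume "\<not> (x \<in> O' \<and> length vs = k \<and> set vs \<subseteq> cart m)"
  then show "lpull m O' n f w x vs = 0" using lforms_zero[OF assms(2)] by (auto simp: lpull_def)
next
  fix x vs i a b u v
  assume x: "x \<in> O'" "length vs = k" "set vs \<subseteq> cart m" "i < k" "u \<in> cart m" "v \<in> cart m"
  have "w (f x) ((map (jac m n f x) vs)[i := (\<lambda>j. a * jac m n f x u j + b * jac m n f x v j)]) =
      a * w (f x) ((map (jac m n f x) vs)[i := jac m n f x u]) + b * w (f x) ((map (jac m n f x) vs)[i := jac m n f x v])"
    by (rule lforms_linear[OF assms(2)]) (use x in auto)
  then show "lpull m O' n f w x (vs[i := \<lambda>j. a * u j + b * v j]) =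
      a * lpull m O' n f w x (vs[i := u]) + b * lpull m O' n f w x (vs[i := v])"
    using x by (simp add: lpull_apply set_update_cart lincomb_cart map_update jac_linear)
next
  fix x vs i j
  assume x: "x \<in> O'" "length vs = k" "set vs \<subseteq> cart m" "i < j" "j < k" "vs ! i = vs ! j"
  then show "lpull m O' n f w x vs = 0"
    by (auto simp: lpull_apply intro!: lforms_alt[OF assms(2), of _ i j])
next
  fix vs :: "vec list" assume "length vs = k" "set vs \<subseteq> cart m"
  then show "smooth_fun m O' (\<lambda>x. lpull m O' n f w x vs)"
    using lpull_smooth[OF assms, of vs]
      smooth_fun_cong[OF assms(3), of "\<lambda>x. lpull m O' n f w x vs" "\<lambda>x. w (f x) (map (jac m n f x) vs)"]
    by (simp add: lpull_apply)
qed

lemma lforms_local: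
  assumes "opn n O'" "\<And>x vs. \<not> (x \<in> O' \<and> set vs \<subseteq> cart n) \<Longrightarrow> w x vs = 0"
    and loc: "\<And>x. x \<in> O' \<Longrightarrow> \<exists>W w'. opn n W \<and> x \<in> W \<and> W \<subseteq> O' \<and> w' \<in> lforms k n W \<and>
      (\<forall>y\<in>W. \<forall>vs. set vs \<subseteq> cart n \<longrightarrow> w y vs = w' y vs)"
  shows "w \<in> lforms k n O'"
  unfolding lforms_def mem_Collect_eq
proof (intro conjI allI ballI impI)
  fix x vs assume "\<not> (x \<in> O' \<and> length vs = k \<and> set vs \<subseteq> cart n)"
  then show "w x vs = 0"
    using assms(2)[of x vs] loc[of x] lforms_zero by (cases "x \<in> O' \<and> set vs \<subseteq> cart n") metis+
next
  fix x vs i a b u v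
  assume x: "x \<in> O'" "length vs = k" "set vs \<subseteq> cart n" "i < k" "u \<in> cart n" "v \<in> cart n"
  obtain W w' where w': "w' \<in> lforms k n W" "\<And>vs. set vs \<subseteq> cart n \<Longrightarrow> w x vs = w' x vs"
    using loc[OF x(1)] by blast
  show "w x (vs[i := \<lambda>j. a * u j + b * v j]) = a * w x (vs[i := u]) + b * w x (vs[i := v])"
    using lforms_linear[OF w'(1) x(2-6)] x by (simp add: w'(2) set_update_cart lincomb_cart)
next
  fix x vs i j
  assume x: "x \<in> O'" "length vs = k" "set vs \<subseteq> cart n" "i < j" "j < k" "vs ! i = vs ! j"
  obtain W w' where w': "w' \<in> lforms k n W" "\<And>vs. set vs \<subseteq> cart n \<Longrightarrow> w x vs = w' x vs"
    using loc[OF x(1)] by blast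
  show "w x vs = 0"
    using lforms_alt[OF w'(1) x(2,3), of i j x] x by (simp add: w'(2))
next
  fix vs :: "vec list" assume vs: "length vs = k" "set vs \<subseteq> cart n"
  show "smooth_fun n O' (\<lambda>x. w x vs)"
  proof (rule smooth_fun_local[OF assms(1)])
    fix x assume "x \<in> O'"
    from loc[OF this] obtain W w' where W: "opn n W" "x \<in> W" "W \<subseteq> O'" "w' \<in> lforms k n W"
      "\<And>y vs. y \<in> W \<Longrightarrow> set vs \<subseteq> cart n \<Longrightarrow> w y vs = w' y vs"
      by blast
    have "smooth_fun n W (\<lambda>x. w x vs)"
      using smooth_fun_cong[OF W(1), of "\<lambda>x. w x vs" "\<lambda>x. w' x vs"] W(5) vs lforms_smooth[OF W(4,1)] by blast
    then show "\<exists>W. opn n W \<and> x \<in> W \<and> W \<subseteq> O' \<and> smooth_fun n W (\<lambda>x. w x vs)" using W by blast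
  qed
qed

text \<open>The factors 1 and -1 stay explicit so that the difference has the shape
  \<open>a * u j + b * v j\<close> of the linearity clause of \<open>lforms\<close>.\<close>

lemma jac_diff:
  assumes "opn m O'" "smooth_cart m O' n f" "smooth_cart m O' n g" "x \<in> O'"
  shows "jac m n (\<lambda>x j. 1 * f x j + (-1) * g x j) x v = (\<lambda>j. 1 * jac m n f x v j + (-1) * jac m n g x v j)"
proof
  fix i
  show "jac m n (\<lambda>x j. 1 * f x j + (-1) * g x j) x v i = 1 * jac m n f x v i + (-1) * jac m n g x v i"
  proof (cases "i < n")
    case True
    note f = smooth_cartD(1)[OF assms(2) True] and g = smooth_cartD(1)[OF assms(3) True]
      and c = smooth_fun_const[OF assms(1)]
    show ?thesis
      using True dir_deriv_add[OF assms(1) smooth_fun_mult[OF assms(1) c f] smooth_fun_mult[OF assms(1) c g] assms(4), of 1 "-1" v]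
        dir_deriv_mult[OF assms(1) c f assms(4), of 1 v] dir_deriv_mult[OF assms(1) c g assms(4), of "-1" v]
      by (simp add: jac_def)
  qed (simp add: jac_def)
qed

text \<open>The Lie derivative at a point as a derivative of the pullback along \<open>f\<close>. Both sides differ by
  the values of \<open>w\<close> on the derivatives of \<open>Z = \<partial>\<^sub>e f - X \<circ> f\<close>, which vanish because
  \<open>w(Z,\<dots>) = 0\<close> near \<open>x0\<close> and \<open>Z x0 = 0\<close>.\<close>

lemma llie_eq_deriv_pullback:
  assumes W: "opn n W" "w \<in> lforms k n W" and f: "opn m O'" "smooth_cart m O' n f" "f ` O' \<subseteq> W"
    and X: "smooth_cart n W n X" and x0: "x0 \<in> O'" "jac m n f x0 e = X (f x0)"
    and H1: "\<And>x vs. x \<in> O' \<Longrightarrow> set vs \<subseteq> cart m \<Longrightarrow> w (f x) (jac m n f x e # map (jac m n f x) vs) = 0"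
    and H2: "\<And>y us. y \<in> W \<Longrightarrow> set us \<subseteq> cart n \<Longrightarrow> w y (X y # us) = 0"
    and vs: "set vs \<subseteq> cart m"
  shows "dir_deriv m (\<lambda>x. w (f x) (map (jac m n f x) vs)) x0 e = llie n W X w (f x0) (map (jac m n f x0) vs)"
proof (cases "length vs = k")
  case False
  have "(\<lambda>x. w (f x) (map (jac m n f x) vs)) = (\<lambda>_. 0)" "(\<lambda>y. w y (map (jac m n f x0) vs)) = (\<lambda>_. 0)"
    "w (f x0) ((map (jac m n f x0) vs)[i := u]) = 0" for i u
    using False by (auto intro!: lforms_zero[OF W(2)])
  then show ?thesis by (simp add: llie_def)
next
  case True
  define us where "us = map (jac m n f x0) vs"
  define Vs where "Vs = map (\<lambda>v x. jac m n f x v) vs"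
  have us: "set us \<subseteq> cart n" "length us = k" using True by (auto simp: us_def)
  have Vs: "length Vs = k" "\<And>x. map (\<lambda>V. V x) Vs = map (jac m n f x) vs"
    using True by (auto simp: Vs_def)
  have VsS: "smooth_cart m O' n V" if "V \<in> set Vs" for V
    using that smooth_cart_jac[OF f(1,2)] by (auto simp: Vs_def)
  have Xf: "smooth_cart m O' n (X \<circ> f)" by (rule smooth_cart_compose[OF f(1) W(1) f(3,2) X])
  have De: "smooth_cart m O' n (\<lambda>x. jac m n f x e)" by (rule smooth_cart_jac[OF f(1,2)])
  define Z where "Z = (\<lambda>x j. 1 * jac m n f x e j + (-1) * (X \<circ> f) x j)"
  have Z: "smooth_cart m O' n Z"
    unfolding smooth_cart_def
  proof (intro conjI allI impI)
    show "Z ` O' \<subseteq> cart n"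
      unfolding Z_def by (intro image_subsetI lincomb_cart jac_cart smooth_cartD(2)[OF Xf])
    show "smooth_fun m O' (\<lambda>x. Z x i)" if "i < n" for i
      unfolding Z_def using smooth_cartD(1)[OF De that] smooth_cartD(1)[OF Xf that] f(1)
      by (intro smooth_fun_add smooth_fun_mult smooth_fun_const)
  qed
  have Z0: "Z x0 = (\<lambda>_. 0)" using x0 by (simp add: Z_def)
  have wZ: "w (f x) ((map (jac m n f x) vs)[i := Z x]) = 0" if x: "x \<in> O'" and i: "i < k" for x i
  proof -
    have fx: "f x \<in> W" using f x by blast
    have Xc: "X (f x) \<in> cart n" using smooth_cartD(2)[OF X fx] .
    have "w (f x) ((map (jac m n f x) vs)[i := jac m n f x e]) = 0"
    proof (rule lforms_slot_zeroI[OF W(2) set_map_jac jac_cart])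
      fix us' assume "set us' \<subseteq> set (map (jac m n f x) vs)"
      then have "us' \<in> lists (jac m n f x ` set vs)" by auto
      then obtain vs' where "us' = map (jac m n f x) vs'" "set vs' \<subseteq> set vs"
        unfolding lists_image by auto
      then show "w (f x) (jac m n f x e # us') = 0" using H1[OF x, of vs'] vs by auto
    qed (use i True in simp)
    moreover have "w (f x) ((map (jac m n f x) vs)[i := X (f x)]) = 0"
    proof (rule lforms_slot_zeroI[OF W(2) set_map_jac Xc])
      fix us' assume "set us' \<subseteq> set (map (jac m n f x) vs)"
      then show "w (f x) (X (f x) # us') = 0" using set_map_jac[of m n f x vs] by (intro H2[OF fx]) blast
    qed (use i True in simp)
    ultimately show ?thesis
      unfolding Z_def using lforms_linear[OF W(2) _ set_map_jac i jac_cart Xc, of m f x vs "f x" 1 m f x e "-1"] True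
      by simp
  qed
  have slot: "w (f x0) (us[i := jac m n (Vs ! i) x0 e]) = w (f x0) (us[i := jac n n X (f x0) (us ! i)])"
    if i: "i < k" for i
  proof -
    have fx: "f x0 \<in> W" using f x0 by blast
    define v where "v = vs ! i"
    \<comment> \<open>Both arguments are rewritten as derivatives in direction v of the two parts of
      \<open>Z\<close>: the first by symmetry of second derivatives, the second by the chain
      rule.\<close>
    have A: "jac m n (Vs ! i) x0 e = jac m n (\<lambda>x. jac m n f x e) x0 v"
      using jac_commute[OF f(1,2) x0(1), of v e] i True by (simp add: Vs_def v_def)
    have B: "jac n n X (f x0) (us ! i) = jac m n (X \<circ> f) x0 v"
      using i True by (simp add: us_def v_def jac_compose[OF f(1) W(1) f(3,2) X x0(1)])
    have Zs: "V \<in> set (Vs[i := Z]) \<Longrightarrow> smooth_cart m O' n V" for V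
      using set_update_subset_insert[of Vs i Z] VsS Z by auto
    \<comment> \<open>Differentiate the identity \<open>wZ\<close>, with \<open>Z\<close> in slot i,
      in direction v. Since \<open>Z x0\<close> is zero, every Leibniz term still has a zero
      argument, except the one in which \<open>Z\<close> itself is differentiated.\<close>
    have "dir_deriv m (\<lambda>x. w (f x) ([] @ map (\<lambda>V. V x) (Vs[i := Z]))) x0 v = dir_deriv m (\<lambda>_. 0) x0 v"
      by (rule dir_deriv_cong[OF f(1) x0(1)]) (use wZ i in \<open>simp add: map_update Vs\<close>)
    then have "0 = dir_deriv m (\<lambda>x. w (f x) ([] @ map (\<lambda>V. V x) (Vs[i := Z]))) x0 v" by simp
    also have "\<dots> = dir_deriv n (\<lambda>y. w y (us[i := (\<lambda>_. 0)])) (f x0) (jac m n f x0 v) +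
        (\<Sum>l<k. w (f x0) ((us[i := (\<lambda>_. 0)])[l := jac m n (Vs[i := Z] ! l) x0 v]))"
      using lforms_subst_deriv[OF W f x0(1) Zs, where us = "[]" and e = v and Vs = "Vs[i := Z]"] Vs by (simp add: map_update us_def Z0)
    also have "(\<lambda>y. w y (us[i := (\<lambda>_. 0)])) = (\<lambda>_. 0)"
      using i us by (auto intro!: lforms_zero_slot[OF W(2), of i])
    also have "(\<Sum>l<k. w (f x0) ((us[i := (\<lambda>_. 0)])[l := jac m n (Vs[i := Z] ! l) x0 v])) =
        (\<Sum>l<k. if l = i then w (f x0) (us[i := jac m n Z x0 v]) else 0)"
      using i us Vs by (intro sum.cong refl) (auto intro!: lforms_zero_slot[OF W(2), of i])
    also have "\<dots> = w (f x0) (us[i := jac m n Z x0 v])" using i by simp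
    finally have "w (f x0) (us[i := jac m n Z x0 v]) = 0" by simp
    moreover have "jac m n Z x0 v =
        (\<lambda>j. 1 * jac m n (\<lambda>x. jac m n f x e) x0 v j + (-1) * jac m n (X \<circ> f) x0 v j)"
      unfolding Z_def by (rule jac_diff[OF f(1) De Xf x0(1)])
    ultimately show ?thesis
      using lforms_linear[OF W(2) us(2,1) i jac_cart jac_cart,
          of "f x0" 1 m "\<lambda>x. jac m n f x e" x0 v "-1" m "X \<circ> f" x0 v]
      unfolding A B by simp
  qed
  have "dir_deriv m (\<lambda>x. w (f x) (map (jac m n f x) vs)) x0 e =
      dir_deriv n (\<lambda>y. w y us) (f x0) (jac m n f x0 e) + (\<Sum>i<k. w (f x0) (us[i := jac m n (Vs ! i) x0 e]))"
    using lforms_subst_deriv[OF W f x0(1) VsS, where us = "[]" and e = e and Vs = Vs] Vs by (simp add: us_def)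
  also have "\<dots> = llie n W X w (f x0) us"
    using slot f(3) x0 us by (auto simp: llie_def intro!: sum.cong)
  finally show ?thesis by (simp add: us_def)
qed

section \<open>Smooth maps into manifolds and pullbacks of forms\<close>

lemma manifold_chart:
  assumes "smooth_manifold N" "c \<in> atlas N"
  shows "cdom c \<subseteq> mpts N" "inj_on (cmap c) (cdom c)" "opn (mdim N) (cimg c)"
  using assms by (auto simp: smooth_manifold_def is_chart_def)

lemma manifold_cover: "smooth_manifold N \<Longrightarrow> x \<in> mpts N \<Longrightarrow> \<exists>c\<in>atlas N. x \<in> cdom c"
  unfolding smooth_manifold_def by blast

lemma cinv_cmap: "smooth_manifold N \<Longrightarrow> c \<in> atlas N \<Longrightarrow> x \<in> cdom c \<Longrightarrow> cinv c (cmap c x) = x"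
  using manifold_chart(2) inv_into_f_f by metis

lemma cmap_cinv: "z \<in> cimg c \<Longrightarrow> cmap c (cinv c z) = z"
  by (rule f_inv_into_f)

lemma cinv_cdom: "z \<in> cimg c \<Longrightarrow> cinv c z \<in> cdom c"
  by (rule inv_into_into)

lemma transition_smooth:
  assumes "smooth_manifold N" "c \<in> atlas N" "c' \<in> atlas N"
  shows "opn (mdim N) (cmap c ` (cdom c \<inter> cdom c'))"
    "smooth_cart (mdim N) (cmap c ` (cdom c \<inter> cdom c')) (mdim N) (transition c c')"
  using assms unfolding smooth_manifold_def chart_compatible_def by blast+

lemma smooth_intoI:
  assumes "q ` O' \<subseteq> mpts N"
    and "\<And>r. r \<in> O' \<Longrightarrow> \<exists>c\<in>atlas N. \<exists>W. opn n W \<and> r \<in> W \<and> W \<subseteq> O' \<and> q ` W \<subseteq> cdom c \<and>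
      smooth_cart n W (mdim N) (cmap c \<circ> q)"
  shows "smooth_into n O' N q"
  using assms unfolding smooth_into_def by blast

lemma smooth_into_mpts: "smooth_into n O' N q \<Longrightarrow> x \<in> O' \<Longrightarrow> q x \<in> mpts N"
  unfolding smooth_into_def by blast

text \<open>\<open>smooth_into\<close> provides some chart near each point. Transition maps make
  every chart of the atlas usable, and the openness of the preimage of a chart domain takes the
  place of continuity for maps into a manifold.\<close>

lemma smooth_into_chart:
  assumes N: "smooth_manifold N" and O: "opn n O'" and q: "smooth_into n O' N q" and c: "c \<in> atlas N"
  shows "opn n {r \<in> O'. q r \<in> cdom c}" (is "opn n ?D")
    and "smooth_cart n {r \<in> O'. q r \<in> cdom c} (mdim N) (cmap c \<circ> q)"
proof -
  have *: "\<exists>W. opn n W \<and> r \<in> W \<and> W \<subseteq> ?D \<and> smooth_cart n W (mdim N) (cmap c \<circ> q)"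
    if r: "r \<in> ?D" for r
  proof -
    obtain c0 W0 where c0: "c0 \<in> atlas N" and W0: "opn n W0" "r \<in> W0" "W0 \<subseteq> O'" "q ` W0 \<subseteq> cdom c0"
      "smooth_cart n W0 (mdim N) (cmap c0 \<circ> q)"
      using q r unfolding smooth_into_def by blast
    define T where "T = cmap c0 ` (cdom c0 \<inter> cdom c)"
    note T = transition_smooth[OF N c0 c, folded T_def]
    define W where "W = {s \<in> W0. (cmap c0 \<circ> q) s \<in> T}"
    have W: "opn n W" unfolding W_def by (rule smooth_cart_preimage[OF W0(1,5) T(1)])
    have qW: "q s \<in> cdom c0 \<inter> cdom c" if "s \<in> W" for s
    proof -
      obtain y where y: "y \<in> cdom c0 \<inter> cdom c" "cmap c0 (q s) = cmap c0 y"
        using \<open>s \<in> W\<close> unfolding W_def T_def by auto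
      moreover have "q s \<in> cdom c0" using \<open>s \<in> W\<close> W0(4) unfolding W_def by blast
      ultimately show ?thesis using inj_onD[OF manifold_chart(2)[OF N c0], of "q s" y] by auto
    qed
    have "smooth_cart n W (mdim N) (transition c0 c \<circ> (cmap c0 \<circ> q))"
      by (rule smooth_cart_compose[OF W T(1) _ smooth_cart_subset[OF W0(5,1) W] T(2)]) (auto simp: W_def)
    moreover have "(transition c0 c \<circ> (cmap c0 \<circ> q)) s = (cmap c \<circ> q) s" if "s \<in> W" for s
      using qW[OF that] cinv_cmap[OF N c0] by simp
    ultimately have "smooth_cart n W (mdim N) (cmap c \<circ> q)"
      using smooth_cart_cong[OF W, of "transition c0 c \<circ> (cmap c0 \<circ> q)" "cmap c \<circ> q"] by blast
    moreover have "r \<in> W" using r W0(2,4) unfolding W_def T_def by auto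
    moreover have "W \<subseteq> ?D" using qW W0(3) unfolding W_def by blast
    ultimately show ?thesis using W by blast
  qed
  show D: "opn n ?D" by (rule opnI) (use * in blast)
  show "smooth_cart n ?D (mdim N) (cmap c \<circ> q)" by (rule smooth_cart_local[OF D]) (use * in blast)
qed

lemma smooth_into_local:
  assumes "\<And>r. r \<in> O' \<Longrightarrow> \<exists>W. opn n W \<and> r \<in> W \<and> W \<subseteq> O' \<and> smooth_into n W N q"
  shows "smooth_into n O' N q"
proof (rule smooth_intoI)
  show "q ` O' \<subseteq> mpts N" using assms smooth_into_mpts by blast
  fix r assume "r \<in> O'"
  from assms[OF this] obtain W where W: "r \<in> W" "W \<subseteq> O'" "smooth_into n W N q" by blast
  from this(3) W(1) obtain c V where "c \<in> atlas N" "opn n V" "r \<in> V" "V \<subseteq> W" "q ` V \<subseteq> cdom c"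
    "smooth_cart n V (mdim N) (cmap c \<circ> q)"
    unfolding smooth_into_def by blast
  then show "\<exists>c\<in>atlas N. \<exists>W. opn n W \<and> r \<in> W \<and> W \<subseteq> O' \<and> q ` W \<subseteq> cdom c \<and>
      smooth_cart n W (mdim N) (cmap c \<circ> q)"
    using W(2) by blast
qed

lemma smooth_into_compose:
  assumes "smooth_into n O' N q" "opn n O'" "opn m W" "smooth_cart m W n f" "f ` W \<subseteq> O'"
  shows "smooth_into m W N (q \<circ> f)"
proof (rule smooth_intoI)
  show "(q \<circ> f) ` W \<subseteq> mpts N" using assms(1,5) smooth_into_mpts by fastforce
  fix r assume r: "r \<in> W"
  then have "f r \<in> O'" using assms(5) by blast
  then obtain c V where c: "c \<in> atlas N" and V: "opn n V" "f r \<in> V" "V \<subseteq> O'" "q ` V \<subseteq> cdom c"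
    "smooth_cart n V (mdim N) (cmap c \<circ> q)"
    using assms(1) unfolding smooth_into_def by blast
  define T where "T = {s \<in> W. f s \<in> V}"
  have T: "opn m T" unfolding T_def by (rule smooth_cart_preimage[OF assms(3,4) V(1)])
  have TW: "T \<subseteq> W" and fT: "f ` T \<subseteq> V" by (auto simp: T_def)
  have "smooth_cart m T (mdim N) (cmap c \<circ> q \<circ> f)"
    by (rule smooth_cart_compose[OF T V(1) fT smooth_cart_subset[OF assms(4,3) T TW] V(5)])
  moreover have "r \<in> T" using r V by (simp add: T_def)
  moreover have "(q \<circ> f) ` T \<subseteq> cdom c" using fT V(4) by auto
  ultimately show "\<exists>c\<in>atlas N. \<exists>T. opn m T \<and> r \<in> T \<and> T \<subseteq> W \<and> (q \<circ> f) ` T \<subseteq> cdom c \<and>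
      smooth_cart m T (mdim N) (cmap c \<circ> (q \<circ> f))"
    using c T TW by (auto simp: comp_assoc)
qed

lemma smooth_into_subset:
  "smooth_into n O' N q \<Longrightarrow> opn n O' \<Longrightarrow> opn n W \<Longrightarrow> W \<subseteq> O' \<Longrightarrow> smooth_into n W N q"
  using smooth_into_compose[of n O' N q n W "\<lambda>x. x"] smooth_cart_id[of n W] by (simp add: comp_def)

lemma smooth_into_cong:
  assumes "smooth_into n O' N q" "\<And>x. x \<in> O' \<Longrightarrow> q x = q' x"
  shows "smooth_into n O' N q'"
proof (rule smooth_intoI)
  show "q' ` O' \<subseteq> mpts N" using assms smooth_into_mpts by fastforce
  fix r assume "r \<in> O'"
  then obtain c V where c: "c \<in> atlas N" and V: "opn n V" "r \<in> V" "V \<subseteq> O'" "q ` V \<subseteq> cdom c"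
    "smooth_cart n V (mdim N) (cmap c \<circ> q)"
    using assms(1) unfolding smooth_into_def by blast
  have eq: "q x = q' x" if "x \<in> V" for x using that V(3) assms(2) by blast
  then have "smooth_cart n V (mdim N) (cmap c \<circ> q')"
    using smooth_cart_cong[OF V(1), of "cmap c \<circ> q" "cmap c \<circ> q'"] V(5) by simp
  moreover have "q' ` V \<subseteq> cdom c" using eq V(4) by (metis image_cong)
  ultimately show "\<exists>c\<in>atlas N. \<exists>W. opn n W \<and> r \<in> W \<and> W \<subseteq> O' \<and> q' ` W \<subseteq> cdom c \<and>
      smooth_cart n W (mdim N) (cmap c \<circ> q')"
    using c V(1-3) by blast
qed

lemma smooth_into_cinv:
  assumes "smooth_manifold N" "c \<in> atlas N"
  shows "smooth_into (mdim N) (cimg c) N (cinv c)"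
proof (rule smooth_intoI)
  show "cinv c ` cimg c \<subseteq> mpts N" using manifold_chart(1)[OF assms] cinv_cdom[of _ c] by blast
  fix r assume "r \<in> cimg c"
  moreover have "smooth_cart (mdim N) (cimg c) (mdim N) (cmap c \<circ> cinv c)"
    using smooth_cart_id[OF manifold_chart(3)[OF assms]]
      smooth_cart_cong[OF manifold_chart(3)[OF assms], of "\<lambda>x. x" "cmap c \<circ> cinv c"] cmap_cinv[of _ c] by simp
  ultimately show "\<exists>c'\<in>atlas N. \<exists>W. opn (mdim N) W \<and> r \<in> W \<and> W \<subseteq> cimg c \<and> cinv c ` W \<subseteq> cdom c' \<and>
      smooth_cart (mdim N) W (mdim N) (cmap c' \<circ> cinv c)"
    using assms(2) manifold_chart(3)[OF assms] cinv_cdom[of _ c] by blast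
qed

lemma smooth_into_cinv_comp:
  assumes "smooth_manifold N" "c \<in> atlas N" "opn n O'" "smooth_cart n O' (mdim N) g" "g ` O' \<subseteq> cimg c"
  shows "smooth_into n O' N (\<lambda>x. cinv c (g x))"
  using smooth_into_compose[OF smooth_into_cinv[OF assms(1,2)] manifold_chart(3)[OF assms(1,2)] assms(3-5)]
  by (simp add: comp_def)

lemma smooth_map_compose:
  assumes M: "smooth_manifold M" and p: "smooth_map M N p" and O: "opn n O'" and q: "smooth_into n O' M q"
  shows "smooth_into n O' N (\<lambda>x. p (q x))"
proof (rule smooth_into_local)
  fix r assume r: "r \<in> O'"
  obtain c where c: "c \<in> atlas M" "q r \<in> cdom c" using manifold_cover[OF M smooth_into_mpts[OF q r]] by blast
  define W where "W = {r \<in> O'. q r \<in> cdom c}"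
  note W = smooth_into_chart[OF M O q c(1), folded W_def]
  have "(cmap c \<circ> q) ` W \<subseteq> cimg c" by (auto simp: W_def)
  moreover have "smooth_into (mdim M) (cimg c) N (p \<circ> cinv c)" using p c(1) by (simp add: smooth_map_def)
  ultimately have "smooth_into n W N (p \<circ> cinv c \<circ> (cmap c \<circ> q))"
    using W by (intro smooth_into_compose[OF _ manifold_chart(3)[OF M c(1)]])
  then have "smooth_into n W N (\<lambda>x. p (q x))"
    by (rule smooth_into_cong) (simp add: W_def cinv_cmap[OF M c(1)])
  moreover have "r \<in> W" "W \<subseteq> O'" using r c(2) by (auto simp: W_def)
  ultimately show "\<exists>W. opn n W \<and> r \<in> W \<and> W \<subseteq> O' \<and> smooth_into n W N (\<lambda>x. p (q x))" using W(1) by blast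
qed

text \<open>The chart is chosen anew at each point, so that nothing has to be patched. Compatibility
  of \<open>\<beta>\<close> with the transition maps makes the choice irrelevant
  (\<open>mpull_eq\<close>), and smoothness is recovered locally in one fixed chart
  (\<open>mpull_lforms\<close>).\<close>

definition mpull :: "'a manifold \<Rightarrow> nat \<Rightarrow> vec set \<Rightarrow> (vec \<Rightarrow> 'a) \<Rightarrow> 'a mform \<Rightarrow> lform" where
  "mpull N n O' q \<beta> = (\<lambda>x vs. if x \<in> O' \<and> set vs \<subseteq> cart n
     then let c = SOME c. c \<in> atlas N \<and> q x \<in> cdom c in
       \<beta> c (cmap c (q x)) (map (jac n (mdim N) (cmap c \<circ> q) x) vs)
     else 0)"

lemma mforms_lforms: "\<beta> \<in> mforms N k \<Longrightarrow> c \<in> atlas N \<Longrightarrow> \<beta> c \<in> lforms k (mdim N) (cimg c)"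
  unfolding mforms_def by blast

lemma mforms_transition:
  "\<beta> \<in> mforms N k \<Longrightarrow> c \<in> atlas N \<Longrightarrow> c' \<in> atlas N \<Longrightarrow> x \<in> cdom c \<Longrightarrow> x \<in> cdom c' \<Longrightarrow>
    set vs \<subseteq> cart (mdim N) \<Longrightarrow>
    \<beta> c (cmap c x) vs = \<beta> c' (cmap c' x) (map (jac (mdim N) (mdim N) (transition c c') (cmap c x)) vs)"
  unfolding mforms_def by blast

lemma jac_change_chart:
  assumes N: "smooth_manifold N" and O: "opn n O'" and q: "smooth_into n O' N q"
    and c: "c \<in> atlas N" "c' \<in> atlas N" and x: "x \<in> O'" "q x \<in> cdom c" "q x \<in> cdom c'"
  shows "jac n (mdim N) (cmap c' \<circ> q) x v =
    jac (mdim N) (mdim N) (transition c c') (cmap c (q x)) (jac n (mdim N) (cmap c \<circ> q) x v)"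
proof -
  define W where "W = {r \<in> O'. q r \<in> cdom c} \<inter> {r \<in> O'. q r \<in> cdom c'}"
  have W: "opn n W" unfolding W_def using smooth_into_chart[OF N O q] c by blast
  have xW: "x \<in> W" using x by (simp add: W_def)
  have s: "smooth_cart n W (mdim N) (cmap c \<circ> q)"
    by (rule smooth_cart_subset[OF smooth_into_chart(2,1)[OF N O q c(1)] W]) (auto simp: W_def)
  note t = transition_smooth[OF N c]
  have "jac n (mdim N) (cmap c' \<circ> q) x v = jac n (mdim N) (transition c c' \<circ> (cmap c \<circ> q)) x v"
    by (rule jac_cong[OF W xW]) (simp add: W_def cinv_cmap[OF N c(1)])
  also have "\<dots> = jac (mdim N) (mdim N) (transition c c') ((cmap c \<circ> q) x) (jac n (mdim N) (cmap c \<circ> q) x v)"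
    by (rule jac_compose[OF W t(1) _ s t(2) xW]) (auto simp: W_def)
  finally show ?thesis by simp
qed

lemma mpull_eq:
  assumes N: "smooth_manifold N" and O: "opn n O'" and q: "smooth_into n O' N q" and \<beta>: "\<beta> \<in> mforms N k"
    and c: "c \<in> atlas N" and x: "x \<in> O'" "q x \<in> cdom c" and vs: "set vs \<subseteq> cart n"
  shows "mpull N n O' q \<beta> x vs = \<beta> c (cmap c (q x)) (map (jac n (mdim N) (cmap c \<circ> q) x) vs)"
proof -
  define c0 where "c0 = (SOME c. c \<in> atlas N \<and> q x \<in> cdom c)"
  have c0: "c0 \<in> atlas N" "q x \<in> cdom c0"
    unfolding c0_def using someI[of "\<lambda>c. c \<in> atlas N \<and> q x \<in> cdom c" c] c x by auto
  have "mpull N n O' q \<beta> x vs = \<beta> c0 (cmap c0 (q x)) (map (jac n (mdim N) (cmap c0 \<circ> q) x) vs)"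
    using x vs by (simp add: mpull_def c0_def Let_def)
  also have "\<dots> = \<beta> c (cmap c (q x)) (map (jac (mdim N) (mdim N) (transition c0 c) (cmap c0 (q x)))
      (map (jac n (mdim N) (cmap c0 \<circ> q) x) vs))"
    by (rule mforms_transition[OF \<beta> c0(1) c c0(2) x(2) set_map_jac])
  also have "map (jac (mdim N) (mdim N) (transition c0 c) (cmap c0 (q x)))
      (map (jac n (mdim N) (cmap c0 \<circ> q) x) vs) = map (jac n (mdim N) (cmap c \<circ> q) x) vs"
    unfolding map_map jac_change_chart[OF N O q c0(1) c x(1) c0(2) x(2)] by (intro map_cong refl) (rule o_apply)
  finally show ?thesis .
qed

lemma mpull_eq_lpull:
  assumes N: "smooth_manifold N" and O: "opn n O'" and q: "smooth_into n O' N q" and \<beta>: "\<beta> \<in> mforms N k"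
    and c: "c \<in> atlas N" and W: "W \<subseteq> O'" "q ` W \<subseteq> cdom c" "x \<in> W" and vs: "set vs \<subseteq> cart n"
  shows "mpull N n O' q \<beta> x vs = lpull n W (mdim N) (cmap c \<circ> q) (\<beta> c) x vs"
  using mpull_eq[OF N O q \<beta> c _ _ vs, of x] W vs by (auto simp: lpull_apply)

lemma mpull_outside: "\<not> (x \<in> O' \<and> set vs \<subseteq> cart n) \<Longrightarrow> mpull N n O' q \<beta> x vs = 0"
  by (auto simp: mpull_def)

lemma mpull_lforms:
  assumes N: "smooth_manifold N" and O: "opn n O'" and q: "smooth_into n O' N q" and \<beta>: "\<beta> \<in> mforms N k"
  shows "mpull N n O' q \<beta> \<in> lforms k n O'"
proof (rule lforms_local[OF O mpull_outside])
  fix x assume x: "x \<in> O'"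
  obtain c where c: "c \<in> atlas N" "q x \<in> cdom c" using manifold_cover[OF N smooth_into_mpts[OF q x]] by blast
  define W where "W = {r \<in> O'. q r \<in> cdom c}"
  note W = smooth_into_chart[OF N O q c(1), folded W_def]
  have WO: "W \<subseteq> O'" "q ` W \<subseteq> cdom c" "x \<in> W" using x c by (auto simp: W_def)
  have "lpull n W (mdim N) (cmap c \<circ> q) (\<beta> c) \<in> lforms k n W"
    by (rule lpull_lforms[OF manifold_chart(3)[OF N c(1)] mforms_lforms[OF \<beta> c(1)] W]) (use WO in auto)
  then show "\<exists>W w'. opn n W \<and> x \<in> W \<and> W \<subseteq> O' \<and> w' \<in> lforms k n W \<and>
      (\<forall>y\<in>W. \<forall>vs. set vs \<subseteq> cart n \<longrightarrow> mpull N n O' q \<beta> y vs = w' y vs)"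
    using mpull_eq_lpull[OF N O q \<beta> c(1) WO(1,2)] W(1) WO by blast
qed auto

lemma mpull_subset: "W \<subseteq> O' \<Longrightarrow> x \<in> W \<Longrightarrow> mpull N n W q \<beta> x vs = mpull N n O' q \<beta> x vs"
  by (auto simp: mpull_def)

lemma mpull_cong:
  assumes N: "smooth_manifold N" and O: "opn n O'" "opn n O2" and q: "smooth_into n O' N q" "smooth_into n O2 N q'"
    and \<beta>: "\<beta> \<in> mforms N k" and W: "opn n W" "W \<subseteq> O'" "W \<subseteq> O2" "x \<in> W"
    and eq: "\<And>y. y \<in> W \<Longrightarrow> q y = q' y"
  shows "mpull N n O' q \<beta> x vs = mpull N n O2 q' \<beta> x vs"
proof (cases "set vs \<subseteq> cart n")
  case True
  have x: "x \<in> O'" "x \<in> O2" using W by auto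
  obtain c where c: "c \<in> atlas N" "q x \<in> cdom c" using manifold_cover[OF N smooth_into_mpts[OF q(1) x(1)]] by blast
  have "jac n (mdim N) (cmap c \<circ> q) x = jac n (mdim N) (cmap c \<circ> q') x"
    by (intro ext jac_cong[OF W(1,4)]) (simp add: eq)
  then show ?thesis
    using mpull_eq[OF N O(1) q(1) \<beta> c(1) x(1) c(2) True] mpull_eq[OF N O(2) q(2) \<beta> c(1) x(2) _ True]
      c(2) eq[OF W(4)] by simp
qed (simp add: mpull_outside)

lemma mpull_compose:
  assumes N: "smooth_manifold N" and O: "opn n O'" and q: "smooth_into n O' N q" and \<beta>: "\<beta> \<in> mforms N k"
    and f: "opn m W" "smooth_cart m W n f" "f ` W \<subseteq> O'"
  shows "mpull N m W (q \<circ> f) \<beta> = lpull m W n f (mpull N n O' q \<beta>)"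
proof (intro ext)
  fix x vs
  show "mpull N m W (q \<circ> f) \<beta> x vs = lpull m W n f (mpull N n O' q \<beta>) x vs"
  proof (cases "x \<in> W \<and> set vs \<subseteq> cart m")
    case True
    then have x: "x \<in> W" and vs: "set vs \<subseteq> cart m" by auto
    have fx: "f x \<in> O'" using f(3) x by blast
    obtain c where c: "c \<in> atlas N" "q (f x) \<in> cdom c"
      using manifold_cover[OF N smooth_into_mpts[OF q fx]] by blast
    define D where "D = {r \<in> O'. q r \<in> cdom c}"
    note D = smooth_into_chart[OF N O q c(1), folded D_def]
    define T where "T = {s \<in> W. f s \<in> D}"
    have T: "opn m T" unfolding T_def by (rule smooth_cart_preimage[OF f(1,2) D(1)])
    have "jac m (mdim N) (cmap c \<circ> q \<circ> f) x v = jac n (mdim N) (cmap c \<circ> q) (f x) (jac m n f x v)" for v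
      by (rule jac_compose[OF T D(1) _ smooth_cart_subset[OF f(2,1) T] D(2)])
        (use x fx c in \<open>auto simp: T_def D_def\<close>)
    then have jf: "map (jac m (mdim N) (cmap c \<circ> (q \<circ> f)) x) vs =
        map (jac n (mdim N) (cmap c \<circ> q) (f x)) (map (jac m n f x) vs)"
      unfolding map_map comp_assoc by (intro map_cong refl) simp
    have "mpull N m W (q \<circ> f) \<beta> x vs =
        \<beta> c (cmap c (q (f x))) (map (jac n (mdim N) (cmap c \<circ> q) (f x)) (map (jac m n f x) vs))"
      using mpull_eq[OF N f(1) smooth_into_compose[OF q O f] \<beta> c(1) x _ vs] c(2)
      unfolding jf by simp
    also have "\<dots> = mpull N n O' q \<beta> (f x) (map (jac m n f x) vs)"
      by (rule mpull_eq[OF N O q \<beta> c(1) fx c(2) set_map_jac, symmetric])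
    finally show ?thesis using x vs by (simp add: lpull_apply)
  next
    case False
    then show ?thesis by (simp only: mpull_outside[OF False] lpull_def if_False)
  qed
qed

text \<open>Inverse charts are plots, so a form is recovered from its pullbacks. This is the point
  where conditions on all pullbacks become conditions on the form.\<close>

lemma mpull_cinv:
  assumes N: "smooth_manifold N" and \<beta>: "\<beta> \<in> mforms N k" and c: "c \<in> atlas N"
  shows "mpull N (mdim N) (cimg c) (cinv c) \<beta> = \<beta> c"
proof (intro ext)
  fix x vs
  show "mpull N (mdim N) (cimg c) (cinv c) \<beta> x vs = \<beta> c x vs"
  proof (cases "x \<in> cimg c \<and> set vs \<subseteq> cart (mdim N)")
    case True
    then have x: "x \<in> cimg c" and vs: "set vs \<subseteq> cart (mdim N)" by auto
    note O = manifold_chart(3)[OF N c]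
    have "jac (mdim N) (mdim N) (cmap c \<circ> cinv c) x v = v" if "v \<in> set vs" for v
    proof -
      have "jac (mdim N) (mdim N) (cmap c \<circ> cinv c) x v = jac (mdim N) (mdim N) (\<lambda>x. x) x v"
        by (rule jac_cong[OF O x]) (simp add: cmap_cinv)
      then show ?thesis using jac_id vs that by auto
    qed
    then have "map (jac (mdim N) (mdim N) (cmap c \<circ> cinv c) x) vs = vs" by (simp add: map_idI)
    then show ?thesis
      using mpull_eq[OF N O smooth_into_cinv[OF N c] \<beta> c x cinv_cdom[OF x] vs] cmap_cinv[OF x] by simp
  next
    case False
    then show ?thesis using mpull_outside lforms_zero[OF mforms_lforms[OF \<beta> c]] by metis
  qed
qed

section \<open>Forms on the leaf space\<close>

lemma leaf_of_eq: "partition_on A F \<Longrightarrow> L \<in> F \<Longrightarrow> x \<in> L \<Longrightarrow> leaf_of F x = L"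
  unfolding leaf_of_def by (rule the_equality) (auto simp: partition_on_def disjoint_def)

lemma leaf_of_in: "partition_on A F \<Longrightarrow> x \<in> A \<Longrightarrow> leaf_of F x \<in> F \<and> x \<in> leaf_of F x"
proof -
  assume F: "partition_on A F" and "x \<in> A"
  then obtain L where "L \<in> F" "x \<in> L" unfolding partition_on_def by blast
  then show ?thesis using leaf_of_eq[OF F] by simp
qed

abbreviation leaf_plot :: "'a set set \<Rightarrow> vec set \<Rightarrow> (vec \<Rightarrow> 'a) \<Rightarrow> vec \<Rightarrow> 'a set" where
  "leaf_plot F O' q \<equiv> restrict (\<lambda>x. leaf_of F (q x)) O'"

lemma leaf_plot_in:
  assumes "partition_on (mpts N) F" "opn n O'" "smooth_into n O' N q"
  shows "(n, O', leaf_plot F O' q) \<in> leaf_space_plots N F"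
  unfolding leaf_space_plots_def
  using assms leaf_of_in[OF assms(1)] smooth_into_mpts[OF assms(3)] by auto

lemma lpull_id:
  assumes "opn n W" "x \<in> W" "set vs \<subseteq> cart n"
  shows "lpull n W n (\<lambda>x. x) w x vs = w x vs"
proof -
  have "map (jac n n (\<lambda>x. x) x) vs = vs" using assms(3) by (intro map_idI jac_id) auto
  then show ?thesis using assms by (simp add: lpull_apply)
qed

lemma dforms_lforms: "\<alpha> \<in> dforms D k \<Longrightarrow> (n, O', q) \<in> D \<Longrightarrow> \<alpha> (n, O', q) \<in> lforms k n O'"
  unfolding dforms_def by blast

lemma dforms_lpull:
  "\<alpha> \<in> dforms D k \<Longrightarrow> (n, O', q) \<in> D \<Longrightarrow> opn m W \<Longrightarrow> smooth_cart m W n f \<Longrightarrow> f ` W \<subseteq> O' \<Longrightarrow>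
    \<alpha> (m, W, restrict (q \<circ> f) W) = lpull m W n f (\<alpha> (n, O', q))"
  unfolding dforms_def by blast

lemma dforms_restrict:
  assumes "\<alpha> \<in> dforms D k" "(n, O', q) \<in> D" "opn n W" "W \<subseteq> O'" "x \<in> W" "set vs \<subseteq> cart n"
  shows "\<alpha> (n, W, restrict q W) x vs = \<alpha> (n, O', q) x vs"
proof -
  have "\<alpha> (n, W, restrict (q \<circ> (\<lambda>x. x)) W) = lpull n W n (\<lambda>x. x) (\<alpha> (n, O', q))"
    by (rule dforms_lpull[OF assms(1-3) smooth_cart_id[OF assms(3)]]) (use assms(4) in auto)
  then show ?thesis using lpull_id[OF assms(3,5,6)] by (simp add: comp_def)
qed

lemma dforms_leaf_lpull:
  assumes F: "partition_on (mpts N) F" and \<alpha>: "\<alpha> \<in> dforms (leaf_space_plots N F) k"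
    and q: "opn n O'" "smooth_into n O' N q" and f: "opn m W" "smooth_cart m W n f" "f ` W \<subseteq> O'"
    and eq: "\<And>x. x \<in> W \<Longrightarrow> q' x = q (f x)"
  shows "\<alpha> (m, W, leaf_plot F W q') = lpull m W n f (\<alpha> (n, O', leaf_plot F O' q))"
proof -
  have "leaf_plot F W q' = restrict (leaf_plot F O' q \<circ> f) W"
    using eq f(3) by (auto simp: restrict_def fun_eq_iff)
  then show ?thesis using dforms_lpull[OF \<alpha> leaf_plot_in[OF F q] f] by simp
qed

lemma quot_pull_chart:
  assumes N: "smooth_manifold N" and c: "c \<in> atlas N"
  shows "quot_pull N F \<alpha> c = \<alpha> (mdim N, cimg c, leaf_plot F (cimg c) (cinv c))"
proof -
  have "smooth_into (mdim N) (cimg c) N (restrict (cinv c) (cimg c))"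
    by (rule smooth_into_cong[OF smooth_into_cinv[OF N c]]) simp
  then have "(mdim N, cimg c, restrict (cinv c) (cimg c)) \<in> manifold_plots N"
    using manifold_chart(3)[OF N c] by (simp add: manifold_plots_def)
  moreover have "restrict (leaf_of F \<circ> restrict (cinv c) (cimg c)) (cimg c) = leaf_plot F (cimg c) (cinv c)"
    by (auto simp: restrict_def fun_eq_iff)
  ultimately show ?thesis using c by (simp add: quot_pull_def mform_of_def dpull_def)
qed

lemma quot_pull_off: "c \<notin> atlas N \<Longrightarrow> quot_pull N F \<alpha> c = (\<lambda>_ _. 0)"
  by (simp add: quot_pull_def mform_of_def)

lemma quot_pull_mforms:
  assumes N: "smooth_manifold N" and F: "partition_on (mpts N) F"
    and \<alpha>: "\<alpha> \<in> dforms (leaf_space_plots N F) k"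
  shows "quot_pull N F \<alpha> \<in> mforms N k"
  unfolding mforms_def mem_Collect_eq
proof (intro conjI allI ballI impI)
  fix c assume c: "c \<in> atlas N"
  then show "quot_pull N F \<alpha> c \<in> lforms k (mdim N) (cimg c)"
    unfolding quot_pull_chart[OF N c]
    by (intro dforms_lforms[OF \<alpha>] leaf_plot_in[OF F] manifold_chart(3)[OF N] smooth_into_cinv[OF N])
next
  fix c c' x and vs :: "vec list"
  assume c: "c \<in> atlas N" "c' \<in> atlas N" and x: "x \<in> cdom c \<inter> cdom c'" and vs: "set vs \<subseteq> cart (mdim N)"
  define T where "T = cmap c ` (cdom c \<inter> cdom c')"
  note T = transition_smooth[OF N c, folded T_def]
  have xT: "cmap c x \<in> T" using x by (simp add: T_def)
  have tT: "transition c c' ` T \<subseteq> cimg c'" using cinv_cmap[OF N c(1)] by (auto simp: T_def)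
  have ti: "cinv c z = cinv c' (transition c c' z)" if "z \<in> T" for z
    using that cinv_cmap[OF N c(1)] cinv_cmap[OF N c(2)] by (auto simp: T_def)
  note D = leaf_plot_in[OF F manifold_chart(3)[OF N c(1)] smooth_into_cinv[OF N c(1)]]
  have "quot_pull N F \<alpha> c (cmap c x) vs = \<alpha> (mdim N, T, leaf_plot F T (cinv c)) (cmap c x) vs"
  proof -
    have TC: "T \<subseteq> cimg c" by (auto simp: T_def)
    then have "restrict (leaf_plot F (cimg c) (cinv c)) T = leaf_plot F T (cinv c)"
      by (auto simp: restrict_def fun_eq_iff)
    then show ?thesis
      using dforms_restrict[OF \<alpha> D T(1) TC xT vs] quot_pull_chart[OF N c(1), of F \<alpha>] by simp
  qed
  also have "\<dots> = lpull (mdim N) T (mdim N) (transition c c') (quot_pull N F \<alpha> c') (cmap c x) vs"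
    unfolding quot_pull_chart[OF N c(2)]
    by (subst dforms_leaf_lpull[OF F \<alpha> manifold_chart(3)[OF N c(2)] smooth_into_cinv[OF N c(2)] T tT ti]) auto
  also have "\<dots> = quot_pull N F \<alpha> c' (cmap c' x)
      (map (jac (mdim N) (mdim N) (transition c c') (cmap c x)) vs)"
    using xT vs x cinv_cmap[OF N c(1)] by (simp add: lpull_apply)
  finally show "quot_pull N F \<alpha> c (cmap c x) vs = quot_pull N F \<alpha> c' (cmap c' x)
      (map (jac (mdim N) (mdim N) (transition c c') (cmap c x)) vs)" .
qed (simp add: quot_pull_off)

text \<open>Locally the lift \<open>q\<close> factors through a chart, and naturality of
  \<open>\<alpha>\<close> reduces the plot to the plot given by the inverse chart, whose value is
  recorded in the quotient pullback. Injectivity and invariance of the quotient pullback both rest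
  on this formula.\<close>

lemma dforms_leaf_plot_eq_mpull:
  assumes N: "smooth_manifold N" and F: "partition_on (mpts N) F"
    and \<alpha>: "\<alpha> \<in> dforms (leaf_space_plots N F) k" and O: "opn n O'" and q: "smooth_into n O' N q"
  shows "\<alpha> (n, O', leaf_plot F O' q) = mpull N n O' q (quot_pull N F \<alpha>)"
proof (intro ext)
  fix x vs
  note D = leaf_plot_in[OF F O q]
  show "\<alpha> (n, O', leaf_plot F O' q) x vs = mpull N n O' q (quot_pull N F \<alpha>) x vs"
  proof (cases "x \<in> O' \<and> set vs \<subseteq> cart n")
    case True
    then have x: "x \<in> O'" and vs: "set vs \<subseteq> cart n" by auto
    obtain c where c: "c \<in> atlas N" "q x \<in> cdom c" using manifold_cover[OF N smooth_into_mpts[OF q x]] by blast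
    define W where "W = {r \<in> O'. q r \<in> cdom c}"
    note W = smooth_into_chart[OF N O q c(1), folded W_def]
    have WO: "W \<subseteq> O'" "q ` W \<subseteq> cdom c" "x \<in> W" using x c by (auto simp: W_def)
    have cq: "(cmap c \<circ> q) ` W \<subseteq> cimg c" using WO by auto
    have eq: "q y = cinv c ((cmap c \<circ> q) y)" if "y \<in> W" for y
      using that cinv_cmap[OF N c(1)] WO by auto
    have "restrict (leaf_plot F O' q) W = leaf_plot F W q"
      using WO by (auto simp: restrict_def fun_eq_iff)
    then have "\<alpha> (n, O', leaf_plot F O' q) x vs = \<alpha> (n, W, leaf_plot F W q) x vs"
      using dforms_restrict[OF \<alpha> D W(1) WO(1,3) vs] by simp
    also have "\<dots> = lpull n W (mdim N) (cmap c \<circ> q) (quot_pull N F \<alpha> c) x vs"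
      unfolding quot_pull_chart[OF N c(1)]
      by (subst dforms_leaf_lpull[OF F \<alpha> manifold_chart(3)[OF N c(1)] smooth_into_cinv[OF N c(1)] W cq eq]) auto
    also have "\<dots> = mpull N n O' q (quot_pull N F \<alpha>) x vs"
      by (rule mpull_eq_lpull[OF N O q quot_pull_mforms[OF N F \<alpha>] c(1) WO vs, symmetric])
    finally show ?thesis .
  next
    case False
    then have "\<alpha> (n, O', leaf_plot F O' q) x vs = 0" by (intro lforms_zero[OF dforms_lforms[OF \<alpha> D]]) blast
    then show ?thesis by (simp only: mpull_outside[OF False])
  qed
qed

lemma leaf_space_plot_lift:
  assumes "(n, O', q) \<in> leaf_space_plots N F" "x \<in> O'"
  obtains W q' where "opn n W" "x \<in> W" "W \<subseteq> O'" "smooth_into n W N q'" "\<And>s. s \<in> W \<Longrightarrow> q s = leaf_of F (q' s)"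
proof -
  have "\<forall>r\<in>O'. \<exists>W q'. opn n W \<and> r \<in> W \<and> W \<subseteq> O' \<and> smooth_into n W N q' \<and> (\<forall>s\<in>W. q s = leaf_of F (q' s))"
    using assms(1) by (simp add: leaf_space_plots_def)
  from this[rule_format, OF assms(2)] show thesis
    by (elim exE conjE) (rule that, auto)
qed

text \<open>Plots of the leaf space lift locally, and on a lifted plot the form is a pullback of its
  own quotient pullback.\<close>

lemma quot_pull_inj:
  assumes N: "smooth_manifold N" and F: "partition_on (mpts N) F"
  shows "inj_on (quot_pull N F) (dforms (leaf_space_plots N F) k)"
proof (rule inj_onI)
  fix \<alpha> \<beta> assume \<alpha>: "\<alpha> \<in> dforms (leaf_space_plots N F) k" and \<beta>: "\<beta> \<in> dforms (leaf_space_plots N F) k"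
    and eq: "quot_pull N F \<alpha> = quot_pull N F \<beta>"
  have "\<alpha> (n, O', q) x vs = \<beta> (n, O', q) x vs" for n O' q x vs
  proof (cases "(n, O', q) \<in> leaf_space_plots N F")
    case D: True
    show ?thesis
    proof (cases "x \<in> O' \<and> set vs \<subseteq> cart n")
      case True
      then have x: "x \<in> O'" and vs: "set vs \<subseteq> cart n" by auto
      obtain W q' where W: "opn n W" "x \<in> W" "W \<subseteq> O'" "smooth_into n W N q'"
        "\<And>s. s \<in> W \<Longrightarrow> q s = leaf_of F (q' s)" using leaf_space_plot_lift[OF D x] by blast
      have rq: "restrict q W = leaf_plot F W q'" using W(5) by (auto simp: restrict_def fun_eq_iff)
      have "\<alpha> (n, W, restrict q W) = \<beta> (n, W, restrict q W)"
        unfolding rq dforms_leaf_plot_eq_mpull[OF N F \<alpha> W(1,4)] dforms_leaf_plot_eq_mpull[OF N F \<beta> W(1,4)] eq ..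
      then show ?thesis
        using dforms_restrict[OF \<alpha> D W(1,3,2) vs] dforms_restrict[OF \<beta> D W(1,3,2) vs] by simp
    next
      case False
      then show ?thesis
        using lforms_zero[OF dforms_lforms[OF \<alpha> D], of x vs] lforms_zero[OF dforms_lforms[OF \<beta> D], of x vs]
        by auto
    qed
  next
    case False
    then show ?thesis using \<alpha> \<beta> unfolding dforms_def by simp
  qed
  then show "\<alpha> = \<beta>" by (auto simp: fun_eq_iff)
qed

text \<open>The standard criterion for a form to descend along a subduction, here along the quotient
  map to the leaf space.\<close>

definition plot_invariant :: "'a manifold \<Rightarrow> 'a set set \<Rightarrow> 'a mform \<Rightarrow> bool" where
  "plot_invariant N F \<beta> \<longleftrightarrow> (\<forall>n O' q q'. opn n O' \<longrightarrow> smooth_into n O' N q \<longrightarrow> smooth_into n O' N q' \<longrightarrow>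
     (\<forall>x\<in>O'. leaf_of F (q x) = leaf_of F (q' x)) \<longrightarrow>
     (\<forall>x\<in>O'. \<forall>vs. mpull N n O' q \<beta> x vs = mpull N n O' q' \<beta> x vs))"

text \<open>Invariance under homotopies along the leaves, in infinitesimal form. For forms it is
  equivalent to being basic, but it refers neither to tangent spaces nor to global vector fields,
  and this makes it easy to transport.\<close>

definition leafwise_invariant :: "'a manifold \<Rightarrow> 'a set set \<Rightarrow> 'a mform \<Rightarrow> bool" where
  "leafwise_invariant N F \<beta> \<longleftrightarrow> (\<forall>n O' f j. opn n O' \<longrightarrow> smooth_into n O' N f \<longrightarrow> j < n \<longrightarrow>
     (\<forall>x\<in>O'. \<forall>t. x(j := t) \<in> O' \<longrightarrow> leaf_of F (f (x(j := t))) = leaf_of F (f x)) \<longrightarrow>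
     (\<forall>x\<in>O'. \<forall>vs. set vs \<subseteq> cart n \<longrightarrow> mpull N n O' f \<beta> x (ebas j # vs) = 0 \<and>
        partial j (\<lambda>y. mpull N n O' f \<beta> y vs) x = 0))"

lemma quot_pull_plot_invariant:
  assumes N: "smooth_manifold N" and F: "partition_on (mpts N) F"
    and \<alpha>: "\<alpha> \<in> dforms (leaf_space_plots N F) k"
  shows "plot_invariant N F (quot_pull N F \<alpha>)"
  unfolding plot_invariant_def
proof (intro allI impI ballI)
  fix n O' q q' x vs
  assume O: "opn n O'" and q: "smooth_into n O' N q" "smooth_into n O' N q'"
    and eq: "\<forall>x\<in>O'. leaf_of F (q x) = leaf_of F (q' x)"
  have "leaf_plot F O' q = leaf_plot F O' q'" using eq by (auto simp: restrict_def fun_eq_iff)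
  then show "mpull N n O' q (quot_pull N F \<alpha>) x vs = mpull N n O' q' (quot_pull N F \<alpha>) x vs"
    using dforms_leaf_plot_eq_mpull[OF N F \<alpha> O q(1)] dforms_leaf_plot_eq_mpull[OF N F \<alpha> O q(2)] by simp
qed

text \<open>Let \<open>g\<close> freeze coordinate j at its value in x. Then f and its composite
  with \<open>g\<close> have the same leaves, so the pullback along f equals its own pullback along
  \<open>g\<close>. A form pulled back along \<open>g\<close> contains no dx_j, and its coefficients
  do not depend on x_j.\<close>

lemma plot_invariant_imp_leafwise:
  assumes N: "smooth_manifold N" and \<beta>: "\<beta> \<in> mforms N k" and inv: "plot_invariant N F \<beta>"
  shows "leafwise_invariant N F \<beta>"
  unfolding leafwise_invariant_def
proof (intro allI impI ballI)
  fix n O' f j x and vs :: "vec list"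
  assume O: "opn n O'" and f: "smooth_into n O' N f" and j: "j < n"
    and leaf: "\<forall>x\<in>O'. \<forall>t. x(j := t) \<in> O' \<longrightarrow> leaf_of F (f (x(j := t))) = leaf_of F (f x)"
    and x: "x \<in> O'" and vs: "set vs \<subseteq> cart n"
  define \<gamma> where "\<gamma> = mpull N n O' f \<beta>"
  have \<gamma>: "\<gamma> \<in> lforms k n O'" unfolding \<gamma>_def by (rule mpull_lforms[OF N O f \<beta>])
  obtain e where e: "e > 0" "nbox n x e \<subseteq> O'" using opn_contains_nbox[OF O x] by blast
  \<comment> \<open>A cube around x, so that freezing coordinate j maps the domain into
    itself.\<close>
  define B where "B = nbox n x e"
  have B: "opn n B" "B \<subseteq> O'" "x \<in> B"
    using e x opn_subset[OF O] opn_nbox nbox_self unfolding B_def by blast+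
  define g where "g = (\<lambda>y :: vec. y(j := x j))"
  have gB: "g ` B \<subseteq> B" using e(1) by (auto simp: g_def B_def nbox_def intro!: cart_upd[OF _ j])
  have "smooth_fun n B (\<lambda>y. g y i)" for i
    by (cases "i = j") (simp_all add: g_def smooth_fun_const smooth_fun_coord B(1))
  then have g: "smooth_cart n B n g"
    using gB opn_subset[OF B(1)] unfolding smooth_cart_def by blast
  have fB: "smooth_into n B N f" by (rule smooth_into_subset[OF f O B(1,2)])
  have fg: "smooth_into n B N (f \<circ> g)" by (rule smooth_into_compose[OF fB B(1,1) g gB])
  have jg: "jac n n g y v = v(j := 0)" if "v \<in> cart n" for y v
  proof (rule cart_eqI[of _ n])
    fix i assume "i < n"
    then show "jac n n g y v i = (v(j := 0)) i"
      by (cases "i = j") (simp_all add: jac_def g_def dir_deriv_coord)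
  next
    show "v(j := 0) \<in> cart n" by (rule cart_upd[OF that j])
  qed simp
  have eq: "\<gamma> y us = \<gamma> (g y) (map (\<lambda>v. v(j := 0)) us)" if y: "y \<in> B" and us: "set us \<subseteq> cart n" for y us
  proof -
    have "leaf_of F (f y) = leaf_of F ((f \<circ> g) y)" if "y \<in> B" for y
    proof -
      have "y \<in> O'" "y(j := x j) \<in> O'" using that B(2) gB by (auto simp: g_def)
      then show ?thesis using leaf by (metis comp_apply g_def)
    qed
    then have "mpull N n B f \<beta> y us = mpull N n B (f \<circ> g) \<beta> y us"
      using inv fB fg B(1) y unfolding plot_invariant_def by blast
    also have "\<dots> = mpull N n B f \<beta> (g y) (map (jac n n g y) us)"
      using y us by (simp add: mpull_compose[OF N B(1) fB \<beta> B(1) g gB] lpull_apply)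
    also have "map (jac n n g y) us = map (\<lambda>v. v(j := 0)) us" using us jg by (intro map_cong) auto
    finally show ?thesis using mpull_subset[OF B(2)] y gB unfolding \<gamma>_def by (metis image_subset_iff)
  qed
  have "\<gamma> x (ebas j # vs) = \<gamma> (g x) (map (\<lambda>v. v(j := 0)) (ebas j # vs))"
    by (rule eq) (use B vs ebas_cart[OF j] in auto)
  also have "\<dots> = 0"
    by (rule lforms_zero_slot[OF \<gamma>, of 0]) (auto simp: ebas_def fun_eq_iff)
  finally have 1: "\<gamma> x (ebas j # vs) = 0" .
  have "has_partial j (\<lambda>y. \<gamma> y vs) 0 x \<longleftrightarrow> has_partial j (\<lambda>y. \<gamma> (g y) (map (\<lambda>v. v(j := 0)) vs)) 0 x"
    by (rule has_partial_cong[OF B(1,3) j]) (use eq vs in blast)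
  then have "has_partial j (\<lambda>y. \<gamma> y vs) 0 x" by (simp add: g_def)
  then have 2: "partial j (\<lambda>y. \<gamma> y vs) x = 0" by (rule has_partial_imp_partial)
  show "mpull N n O' f \<beta> x (ebas j # vs) = 0 \<and> partial j (\<lambda>y. mpull N n O' f \<beta> y vs) x = 0"
    using 1 2 unfolding \<gamma>_def by blast
qed

text \<open>On a plot of the leaf space the form is defined, point by point, as the pullback of
  \<open>\<beta>\<close> along some local lift. Plot invariance on the intersection of two domains
  makes the value independent of the lift; locality and naturality follow because restrictions of
  lifts, and lifts composed with smooth maps, are again lifts.\<close>

lemma plot_invariant_imp_quot_pull:
  assumes N: "smooth_manifold N" and F: "partition_on (mpts N) F"
    and \<beta>: "\<beta> \<in> mforms N k" and inv: "plot_invariant N F \<beta>"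
  shows "\<exists>\<alpha>\<in>dforms (leaf_space_plots N F) k. quot_pull N F \<alpha> = \<beta>"
proof -
  define lift where "lift n O' q x W q' \<longleftrightarrow> opn n W \<and> x \<in> W \<and> W \<subseteq> O' \<and> smooth_into n W N q' \<and>
    (\<forall>s\<in>W. q s = leaf_of F (q' s))" for n O' q x W q'
  define \<alpha> where "\<alpha> = (\<lambda>(n, O', q) x vs. if (n, O', q) \<in> leaf_space_plots N F \<and> x \<in> O'
    then case SOME (W, q'). lift n O' q x W q' of (W, q') \<Rightarrow> mpull N n W q' \<beta> x vs else 0)"
  have unique: "mpull N n W q' \<beta> x vs = mpull N n W2 q2 \<beta> x vs"
    if "lift n O' q x W q'" "lift n O2 q x W2 q2" for n O' O2 q x W q' W2 q2 vs
  proof -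
    have I: "opn n (W \<inter> W2)" "x \<in> W \<inter> W2" using that by (auto simp: lift_def)
    have "smooth_into n (W \<inter> W2) N q'" "smooth_into n (W \<inter> W2) N q2"
      using that I(1) unfolding lift_def by (metis smooth_into_subset inf_le1, metis smooth_into_subset inf_le2)
    moreover have "\<forall>s\<in>W \<inter> W2. leaf_of F (q' s) = leaf_of F (q2 s)"
      using that unfolding lift_def by auto
    ultimately have "mpull N n (W \<inter> W2) q' \<beta> x vs = mpull N n (W \<inter> W2) q2 \<beta> x vs"
      using inv I unfolding plot_invariant_def by blast
    then show ?thesis
      using mpull_subset[of "W \<inter> W2" W x N n q' \<beta> vs] mpull_subset[of "W \<inter> W2" W2 x N n q2 \<beta> vs] I(2) by simp
  qed
  have \<alpha>_eq: "\<alpha> (n, O', q) x vs = mpull N n W q' \<beta> x vs"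
    if D: "(n, O', q) \<in> leaf_space_plots N F" and l: "lift n O' q x W q'" for n O' q x vs W q'
  proof -
    obtain W2 q2 where s: "(SOME (W, q'). lift n O' q x W q') = (W2, q2)" by (meson surj_pair)
    have "case (SOME (W, q'). lift n O' q x W q') of (W, q') \<Rightarrow> lift n O' q x W q'"
      by (rule someI[of _ "(W, q')"]) (use l in simp)
    then have "lift n O' q x W2 q2" using s by simp
    moreover have "x \<in> O'" using l by (auto simp: lift_def)
    ultimately show ?thesis using D s unique[OF _ l] by (simp add: \<alpha>_def)
  qed
  have ex_lift: "\<exists>W q'. lift n O' q x W q'" if D: "(n, O', q) \<in> leaf_space_plots N F" and x: "x \<in> O'" for n O' q x
    using leaf_space_plot_lift[OF that] unfolding lift_def by metis
  have "\<alpha> \<in> dforms (leaf_space_plots N F) k"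
    unfolding dforms_def mem_Collect_eq
  proof (intro conjI allI impI ballI)
    fix p assume "p \<notin> leaf_space_plots N F"
    then show "\<alpha> p = (\<lambda>_ _. 0)" by (cases p) (simp add: \<alpha>_def)
  next
    fix p assume p: "p \<in> leaf_space_plots N F"
    obtain n O' q where peq: "p = (n, O', q)" by (cases p)
    note D = p[unfolded peq]
    have O: "opn n O'" using D by (simp add: leaf_space_plots_def)
    have "\<alpha> (n, O', q) \<in> lforms k n O'"
    proof (rule lforms_local[OF O])
      fix x vs assume "\<not> (x \<in> O' \<and> set vs \<subseteq> cart n)"
      then show "\<alpha> (n, O', q) x vs = 0"
      proof (cases "x \<in> O'")
        case True
        then obtain W q' where "lift n O' q x W q'" using ex_lift[OF D] by blast
        from \<alpha>_eq[OF D this] show ?thesis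
          using \<open>\<not> (x \<in> O' \<and> set vs \<subseteq> cart n)\<close> True by (simp add: mpull_def)
      qed (simp add: \<alpha>_def)
    next
      fix x assume "x \<in> O'"
      then obtain W q' where l: "lift n O' q x W q'" using ex_lift[OF D] by blast
      then have W: "opn n W" "x \<in> W" "W \<subseteq> O'" "smooth_into n W N q'" by (auto simp: lift_def)
      have "\<alpha> (n, O', q) y vs = mpull N n W q' \<beta> y vs" if "y \<in> W" for y vs
        by (rule \<alpha>_eq[OF D]) (use l that in \<open>auto simp: lift_def\<close>)
      then show "\<exists>W w'. opn n W \<and> x \<in> W \<and> W \<subseteq> O' \<and> w' \<in> lforms k n W \<and>
          (\<forall>y\<in>W. \<forall>vs. set vs \<subseteq> cart n \<longrightarrow> \<alpha> (n, O', q) y vs = w' y vs)"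
        using W mpull_lforms[OF N W(1,4) \<beta>] by blast
    qed
    moreover have "\<alpha> (m, W, restrict (q \<circ> f) W) = lpull m W n f (\<alpha> (n, O', q))"
      if f: "opn m W" "smooth_cart m W n f" "f ` W \<subseteq> O'" for m W f
    proof -
      have l: "lift m W (restrict (q \<circ> f) W) x {s \<in> W. f s \<in> V} (q' \<circ> f)"
        if x: "x \<in> W" and l: "lift n O' q (f x) V q'" for x V q'
      proof -
        have V: "opn n V" "f x \<in> V" "V \<subseteq> O'" "smooth_into n V N q'" "\<And>s. s \<in> V \<Longrightarrow> q s = leaf_of F (q' s)"
          using l by (auto simp: lift_def)
        have T: "opn m {s \<in> W. f s \<in> V}" by (rule smooth_cart_preimage[OF f(1,2) V(1)])
        have "smooth_into m {s \<in> W. f s \<in> V} N (q' \<circ> f)"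
          by (rule smooth_into_compose[OF V(4,1) T smooth_cart_subset[OF f(2,1) T]]) auto
        then show ?thesis using T V x by (auto simp: lift_def)
      qed
      have Df: "(m, W, restrict (q \<circ> f) W) \<in> leaf_space_plots N F"
        unfolding leaf_space_plots_def
      proof (clarify, intro conjI ballI)
        show "restrict (q \<circ> f) W ` W \<subseteq> F" using f(3) D by (auto simp: leaf_space_plots_def)
        fix r assume r: "r \<in> W"
        then obtain V q' where "lift n O' q (f r) V q'" using ex_lift[OF D] f(3) by blast
        from l[OF r this] show "\<exists>O'' q'. opn m O'' \<and> r \<in> O'' \<and> O'' \<subseteq> W \<and> smooth_into m O'' N q' \<and>
            (\<forall>s\<in>O''. restrict (q \<circ> f) W s = leaf_of F (q' s))"
          unfolding lift_def by blast
      qed (use f in auto)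
      show ?thesis
      proof (intro ext)
        fix x vs
        show "\<alpha> (m, W, restrict (q \<circ> f) W) x vs = lpull m W n f (\<alpha> (n, O', q)) x vs"
        proof (cases "x \<in> W")
          case x: True
          then obtain V q' where lV: "lift n O' q (f x) V q'" using ex_lift[OF D] f(3) by blast
          then have V: "opn n V" "f x \<in> V" "smooth_into n V N q'" by (auto simp: lift_def)
          define T where "T = {s \<in> W. f s \<in> V}"
          have T: "opn m T" unfolding T_def by (rule smooth_cart_preimage[OF f(1,2) V(1)])
          have TW: "T \<subseteq> W" "x \<in> T" "f ` T \<subseteq> V" using x V by (auto simp: T_def)
          have "\<alpha> (m, W, restrict (q \<circ> f) W) x vs = mpull N m T (q' \<circ> f) \<beta> x vs"
            by (rule \<alpha>_eq[OF Df]) (use l[OF x lV] in \<open>simp add: T_def\<close>)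
          also have "\<dots> = lpull m T n f (mpull N n V q' \<beta>) x vs"
            by (simp add: mpull_compose[OF N V(1,3) \<beta> T smooth_cart_subset[OF f(2,1) T TW(1)] TW(3)])
          also have "\<dots> = lpull m W n f (\<alpha> (n, O', q)) x vs"
            using TW x \<alpha>_eq[OF D lV] by (simp add: lpull_def)
          finally show ?thesis .
        qed (simp add: lpull_def \<alpha>_def)
      qed
    qed
    ultimately show "case p of (n, O', q) \<Rightarrow> \<alpha> (n, O', q) \<in> lforms k n O' \<and>
        (\<forall>m O'' f. opn m O'' \<longrightarrow> smooth_cart m O'' n f \<longrightarrow> f ` O'' \<subseteq> O' \<longrightarrow>
           \<alpha> (m, O'', restrict (q \<circ> f) O'') = lpull m O'' n f (\<alpha> (n, O', q)))"
      unfolding peq by blast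
  qed
  moreover have "quot_pull N F \<alpha> = \<beta>"
  proof
    fix c
    show "quot_pull N F \<alpha> c = \<beta> c"
    proof (cases "c \<in> atlas N")
      case c: True
      note D = leaf_plot_in[OF F manifold_chart(3)[OF N c] smooth_into_cinv[OF N c]]
      have "\<alpha> (mdim N, cimg c, leaf_plot F (cimg c) (cinv c)) x vs = mpull N (mdim N) (cimg c) (cinv c) \<beta> x vs" for x vs
      proof (cases "x \<in> cimg c")
        case True
        then show ?thesis
          by (intro \<alpha>_eq[OF D]) (simp add: lift_def manifold_chart(3)[OF N c] smooth_into_cinv[OF N c])
      next
        case False
        then show ?thesis by (simp add: \<alpha>_def mpull_outside)
      qed
      then show ?thesis
        by (simp add: quot_pull_chart[OF N c] mpull_cinv[OF N \<beta> c] fun_eq_iff)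
    next
      case False
      then have "\<beta> c = (\<lambda>_ _. 0)" using \<beta> unfolding mforms_def by blast
      then show ?thesis using quot_pull_off[OF False] by metis
    qed
  qed
  ultimately show ?thesis by blast
qed

section \<open>Submersions\<close>

lemma opn_cart: "opn n (cart n)"
  by simp

lemma smooth_cart_upd_const:
  assumes "opn n O'" "j < n"
  shows "smooth_cart n O' n (\<lambda>w. w(j := c))"
  unfolding smooth_cart_def
proof (intro conjI allI impI)
  show "(\<lambda>w. w(j := c)) ` O' \<subseteq> cart n" using opn_subset[OF assms(1)] cart_upd[OF _ assms(2)] by auto
  show "smooth_fun n O' (\<lambda>w. (w(j := c)) i)" if "i < n" for i
    by (cases "i = j") (simp_all add: smooth_fun_const smooth_fun_coord assms)
qed

lemma continuous_on_nboxI: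
  assumes "opn n W" "\<And>w e. w \<in> W \<Longrightarrow> e > 0 \<Longrightarrow> \<exists>d>0. \<forall>y\<in>nbox n w d. \<bar>h y - h w\<bar> < (e :: real)"
  shows "continuous_on W h"
  unfolding continuous_on_topological
proof (intro ballI allI impI)
  fix w B assume w: "w \<in> W" and B: "open B" "h w \<in> B"
  then obtain e where e: "e > 0" "\<And>t. dist t (h w) < e \<Longrightarrow> t \<in> B" unfolding open_dist by blast
  obtain d where d: "d > 0" "\<And>y. y \<in> nbox n w d \<Longrightarrow> \<bar>h y - h w\<bar> < e" using assms(2)[OF w e(1)] by blast
  have wc: "w \<in> cart n" using w opn_subset[OF assms(1)] by blast
  obtain A where A: "open A" "nbox n w d = {x. \<forall>i\<ge>n. x i = 0} \<inter> A"
    using opn_nbox[of n w d] unfolding Euclidean_space_eq openin_open by blast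
  have "w \<in> A" using nbox_self[OF wc d(1)] A(2) by blast
  moreover have "h y \<in> B" if "y \<in> W" "y \<in> A" for y
  proof -
    have "y \<in> nbox n w d" using that A(2) opn_subset[OF assms(1)] cart_iff by blast
    then show ?thesis using d(2) e(2) by (simp add: dist_real_def)
  qed
  ultimately show "\<exists>A. open A \<and> w \<in> A \<and> (\<forall>y\<in>W. y \<in> A \<longrightarrow> h y \<in> B)" using A(1) by blast
qed

text \<open>The inverse function theorem for maps which change only one coordinate; there it reduces to
  the intermediate value theorem.\<close>

lemma inverse_of_coordinate_change:
  assumes O: "opn n O'" and f: "smooth_fun n O' f" and x0: "x0 \<in> O'" and j: "j < n"
    and nz: "partial j f x0 \<noteq> 0"
  shows "\<exists>V W \<phi>. opn n V \<and> x0 \<in> V \<and> V \<subseteq> O' \<and> opn n W \<and> smooth_cart n W n \<phi> \<and> \<phi> ` W \<subseteq> V \<and>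
    (\<forall>x\<in>V. x(j := f x) \<in> W \<and> \<phi> (x(j := f x)) = x) \<and> (\<forall>w\<in>W. (\<phi> w)(j := f (\<phi> w)) = w)"
proof -
  \<comment> \<open>The sign is normalised so that \<open>F\<close> is strictly increasing along
    coordinate j, which leaves a single monotone case.\<close>
  define \<sigma> where "\<sigma> = sgn (partial j f x0)"
  have \<sigma>: "\<sigma> \<noteq> 0" "\<sigma> * partial j f x0 > 0" using nz by (auto simp: \<sigma>_def sgn_if)
  have x0c: "x0 \<in> cart n" using x0 opn_subset[OF O] by blast
  have pf: "smooth_fun n O' (partial i f)" if "i < n" for i by (rule smooth_fun_partial[OF O f that])
  obtain e where e: "e > 0" "nbox n x0 e \<subseteq> O'"
    "\<And>y. y \<in> nbox n x0 e \<Longrightarrow> \<bar>partial j f y - partial j f x0\<bar> < \<bar>partial j f x0\<bar>"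
    using continuous_on_nbox[OF O smooth_fun_continuous[OF O pf[OF j]] x0, of "\<bar>partial j f x0\<bar>"] nz by auto
  define B where "B = nbox n x0 e"
  have B: "opn n B" "x0 \<in> B" "B \<subseteq> O'" using e x0c nbox_self opn_nbox unfolding B_def by auto
  have pos: "\<sigma> * partial j f y > 0" if "y \<in> B" for y
    using e(3)[of y] that nz unfolding B_def \<sigma>_def by (auto simp: sgn_if)
  have fB: "smooth_fun n B f" by (rule smooth_fun_subset[OF f O B(1,3)])
  define F where "F = (\<lambda>x. \<sigma> * f x)"
  have FB: "smooth_fun n B F" unfolding F_def by (intro smooth_fun_mult smooth_fun_const fB B(1))
  have dF: "((\<lambda>t. F (w(j := t))) has_real_derivative \<sigma> * partial j f (w(j := t))) (at t)"
    if "w(j := t) \<in> B" for w t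
    using DERIV_cmult[OF smooth_fun_has_partial[OF B(1) fB j that], of \<sigma>] by (simp add: F_def)
  \<comment> \<open>The cube is a product: the entry j can be moved in its own interval, whatever
    the other entries are.\<close>
  have Bj: "w(j := s) \<in> B" if "w(j := t) \<in> B" "\<bar>s - x0 j\<bar> < e" for w s t
    using that cart_upd[of "w(j := t)" n j s] j unfolding B_def nbox_def by (auto split: if_splits)
  have Bj': "\<bar>t - x0 j\<bar> < e" if "w(j := t) \<in> B" for w t
    using that j unfolding B_def nbox_def by auto
  have between: "w(j := s) \<in> B" if "w(j := t1) \<in> B" "w(j := t2) \<in> B" "t1 \<le> s" "s \<le> t2" for w s t1 t2
    using Bj[OF that(1), of s] Bj'[OF that(1)] Bj'[OF that(2)] that(3,4) by linarith
  have mono: "F (w(j := t1)) < F (w(j := t2))" if t: "t1 < t2" "w(j := t1) \<in> B" "w(j := t2) \<in> B" for w t1 t2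
  proof (rule DERIV_pos_imp_increasing[OF t(1)])
    fix s assume "t1 \<le> s" "s \<le> t2"
    then show "\<exists>d. ((\<lambda>t. F (w(j := t))) has_real_derivative d) (at s) \<and> 0 < d"
      using dF pos between[OF t(2,3)] by blast
  qed
  \<comment> \<open>The implicit equation for the inverse: t is the j-th entry of the preimage of w,
    all other entries being those of w.\<close>
  define S where "S w t \<longleftrightarrow> w(j := t) \<in> B \<and> f (w(j := t)) = w j" for w t
  have S_unique: "t = s" if "S w t" "S w s" for w t s
    using mono[of t s w] mono[of s t w] that by (cases t s rule: linorder_cases) (auto simp: S_def F_def)
  define W where "W = {w \<in> cart n. \<exists>t. S w t}"
  define h where "h w = (THE t. S w t)" for w
  have h_eq: "h w = t" if "S w t" for w t
    unfolding h_def using that S_unique by blast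
  have hS: "S w (h w)" if "w \<in> W" for w
    using that h_eq by (auto simp: W_def)
  \<comment> \<open>Strict inequalities at the two times t0 - \<delta> and t0 + \<delta> persist for
    nearby w, and the intermediate value theorem then places a solution between them. This yields
    the openness of \<open>W\<close> and the continuity of \<open>h\<close> together.\<close>
  have near: "\<exists>d>0. \<forall>w\<in>nbox n w0 d. w \<in> W \<and> \<bar>h w - h w0\<bar> < \<epsilon>" if w0: "w0 \<in> W" and \<epsilon>: "\<epsilon> > 0" for w0 \<epsilon>
  proof -
    define t0 where "t0 = h w0"
    have S0: "S w0 t0" unfolding t0_def by (rule hS[OF w0])
    then have B0: "w0(j := t0) \<in> B" by (simp add: S_def)
    define \<delta> where "\<delta> = min (\<epsilon> / 2) ((e - \<bar>t0 - x0 j\<bar>) / 2)"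
    have \<delta>: "\<delta> > 0" "\<delta> < \<epsilon>" "\<bar>t0 - x0 j\<bar> + \<delta> < e"
    proof -
      have "\<delta> \<le> \<epsilon> / 2" "\<delta> \<le> (e - \<bar>t0 - x0 j\<bar>) / 2"
        unfolding \<delta>_def by (rule min.cobounded1, rule min.cobounded2)
      moreover show "\<delta> > 0" unfolding \<delta>_def using \<epsilon> Bj'[OF B0] by simp
      ultimately show "\<delta> < \<epsilon>" "\<bar>t0 - x0 j\<bar> + \<delta> < e" by argo+
    qed
    define t1 t2 where "t1 = t0 - \<delta>" and "t2 = t0 + \<delta>"
    have Bt: "w0(j := t1) \<in> B" "w0(j := t2) \<in> B"
      by (rule Bj[OF B0]; use \<delta> in \<open>simp add: t1_def t2_def\<close>)+
    have w0c: "w0 \<in> cart n" using w0 by (simp add: W_def)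
    have op: "opn n {w \<in> {w \<in> cart n. w(j := c) \<in> B}. F (w(j := c)) - \<sigma> * w j \<in> A}" if "open A" for A c
    proof (rule opn_preimage_real[OF _ _ that])
      show C: "opn n {w \<in> cart n. w(j := c) \<in> B}"
        by (rule smooth_cart_preimage[OF opn_cart smooth_cart_upd_const[OF opn_cart j] B(1)])
      show "continuous_on {w \<in> cart n. w(j := c) \<in> B} (\<lambda>w. F (w(j := c)) - \<sigma> * w j)"
        by (intro smooth_fun_continuous[OF C] smooth_fun_diff smooth_fun_mult smooth_fun_const
            smooth_fun_coord smooth_fun_compose[OF C B(1) _ _ FB] smooth_cartD(1)[OF smooth_cart_upd_const[OF C j]] C)
          auto
    qed
    define U where "U = {w \<in> {w \<in> cart n. w(j := t1) \<in> B}. F (w(j := t1)) - \<sigma> * w j \<in> {..<0}} \<inter>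
      {w \<in> {w \<in> cart n. w(j := t2) \<in> B}. F (w(j := t2)) - \<sigma> * w j \<in> {0<..}}"
    have "opn n U" unfolding U_def by (intro openin_Int op) auto
    moreover have "F (w0(j := t0)) = \<sigma> * w0 j" using S0 by (simp add: S_def F_def)
    then have "w0 \<in> U"
      using mono[of t1 t0 w0] mono[of t0 t2 w0] Bt B0 \<delta>(1) w0c by (simp add: U_def t1_def t2_def)
    ultimately obtain d where d: "d > 0" "nbox n w0 d \<subseteq> U" using opn_contains_nbox by blast
    have "w \<in> W \<and> \<bar>h w - h w0\<bar> < \<epsilon>" if "w \<in> nbox n w0 d" for w
    proof -
      have w: "w \<in> cart n" "w(j := t1) \<in> B" "w(j := t2) \<in> B" "F (w(j := t1)) < \<sigma> * w j" "\<sigma> * w j < F (w(j := t2))"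
        using that d(2) unfolding U_def by auto
      have "\<exists>t\<ge>t1. t \<le> t2 \<and> F (w(j := t)) = \<sigma> * w j"
      proof (rule IVT')
        show "continuous_on {t1..t2} (\<lambda>t. F (w(j := t)))"
          using dF between[OF w(2,3)] DERIV_isCont by (intro continuous_at_imp_continuous_on) force
      qed (use w \<delta>(1) in \<open>auto simp: t1_def t2_def\<close>)
      then obtain t where t: "t1 \<le> t" "t \<le> t2" "F (w(j := t)) = \<sigma> * w j" by blast
      have "S w t" using t between[OF w(2,3) t(1,2)] \<sigma>(1) by (simp add: S_def F_def)
      then have "w \<in> W" "h w = t" using w(1) h_eq by (auto simp: W_def)
      then show ?thesis using t(1,2) \<delta>(2) by (auto simp: t0_def[symmetric] t1_def t2_def)
    qed
    then show ?thesis using d(1) by blast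
  qed
  have W: "opn n W"
  proof (rule opnI)
    fix w assume w: "w \<in> W"
    obtain d where "d > 0" "\<forall>y\<in>nbox n w d. y \<in> W \<and> \<bar>h y - h w\<bar> < 1" using near[OF w, of 1] by auto
    then show "\<exists>T. opn n T \<and> w \<in> T \<and> T \<subseteq> W"
      using w opn_nbox nbox_self[of w n d] by (intro exI[of _ "nbox n w d"]) (auto simp: W_def)
  qed
  define \<phi> where "\<phi> w = w(j := h w)" for w :: vec
  have \<phi>B: "\<phi> w \<in> B" "f (\<phi> w) = w j" if "w \<in> W" for w
    using hS[OF that] by (auto simp: S_def \<phi>_def)
  have ch: "continuous_on W h"
    by (rule continuous_on_nboxI[OF W]) (use near in blast)
  \<comment> \<open>Implicit differentiation of f(w(j := h w)) = w j: the i-th partial derivative of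
    \<open>h\<close> at w is \<open>G i\<close> at \<open>\<phi> w\<close>, equal to 1 / (partial j
    f) for i = j, and to -(partial i f) / (partial j f) otherwise.\<close>
  define G where "G i y = ((if i = j then 1 else 0) - (if i = j then 0 else partial i f y)) * inverse (partial j f y)" for i y
  have smG: "smooth_fun n B (G i)" if "i < n" for i
  proof -
    have p: "smooth_fun n B (partial i f)" "smooth_fun n B (partial j f)"
      using smooth_fun_partial[OF B(1) fB] that j by auto
    have "smooth_fun n B (\<lambda>y. (if i = j then 1 else 0) - (if i = j then 0 else partial i f y))"
      using smooth_fun_diff[OF B(1) smooth_fun_const[OF B(1), of 0] p(1)] smooth_fun_const[OF B(1), of 1]
      by (cases "i = j") simp_all
    moreover from p pos have "smooth_fun n B (\<lambda>y. inverse (partial j f y))"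
      by (intro smooth_fun_inverse B(1)) force+
    ultimately show ?thesis unfolding G_def
      by (intro smooth_fun_mult B(1))
  qed
  have dh: "has_partial i h (G i (\<phi> w)) w" if w: "w \<in> W" and i: "i < n" for w i
  proof -
    define x where "x = \<phi> w"
    have x: "x \<in> B" "x \<in> cart n" using \<phi>B(1)[OF w] opn_subset[OF B(1)] by (auto simp: x_def)
    have wc: "w \<in> cart n" using w by (simp add: W_def)
    define y where "y s = \<phi> (w(i := s))" for s
    obtain r where r: "r > 0" "nbox n x r \<subseteq> B" using opn_contains_nbox[OF B(1) x(1)] by blast
    have yW: "\<forall>\<^sub>F s in at (w i). w(i := s) \<in> W"
      using opn_slice[OF W w i] by (rule filter_leD[OF at_within_le_nhds])
    have ynear: "\<forall>\<^sub>F s in at (w i). y s \<in> nbox n x q" if q: "q > 0" for q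
    proof -
      obtain d where d: "d > 0" "\<And>z. z \<in> nbox n w d \<Longrightarrow> \<bar>h z - h w\<bar> < q" using near[OF w q] by blast
      have "\<forall>\<^sub>F s in at (w i). dist s (w i) < min d q"
        unfolding eventually_at using d(1) q by (intro exI[of _ "min d q"]) auto
      then show ?thesis using yW
      proof eventually_elim
        case (elim s)
        have "w(i := s) \<in> nbox n w d"
          using elim(1) d(1) cart_upd[OF wc i] by (auto simp: nbox_def dist_real_def)
        then have "\<bar>h (w(i := s)) - h w\<bar> < q" by (rule d(2))
        moreover have "y s \<in> cart n" using \<phi>B(1)[OF elim(2)] opn_subset[OF B(1)] unfolding y_def by blast
        ultimately show ?case
          using elim(1) q by (auto simp: nbox_def y_def x_def \<phi>_def dist_real_def)
      qed
    qed
    have "has_partial l f (partial l f z) z" if "l < n" "z \<in> nbox n x r" for l z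
      using smooth_fun_has_partial[OF B(1) fB that(1)] that(2) r(2) by blast
    from increment_eq_sum_partials[OF this x(2)]
    have "\<forall>y\<in>nbox n x r. \<exists>\<xi>. (\<forall>l<n. \<xi> l \<in> cart n \<and> (\<forall>i<n. \<bar>\<xi> l i - x i\<bar> \<le> \<bar>y i - x i\<bar>)) \<and>
      f y - f x = (\<Sum>l<n. (y l - x l) * partial l f (\<xi> l))" by blast
    from bchoice[OF this] obtain \<xi> where \<xi>: "\<And>y l. y \<in> nbox n x r \<Longrightarrow> l < n \<Longrightarrow> \<xi> y l \<in> cart n"
      "\<And>y i l. y \<in> nbox n x r \<Longrightarrow> l < n \<Longrightarrow> i < n \<Longrightarrow> \<bar>\<xi> y l i - x i\<bar> \<le> \<bar>y i - x i\<bar>"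
      "\<And>y. y \<in> nbox n x r \<Longrightarrow> f y - f x = (\<Sum>l<n. (y l - x l) * partial l f (\<xi> y l))"
      by blast
    have lim: "((\<lambda>s. partial l f (\<xi> (y s) l)) \<longlongrightarrow> partial l f x) (at (w i))" if l: "l < n" for l
    proof (rule tendstoI)
      fix \<epsilon> :: real assume "\<epsilon> > 0"
      then obtain q where q: "q > 0" "\<And>z. z \<in> nbox n x q \<Longrightarrow> \<bar>partial l f z - partial l f x\<bar> < \<epsilon>"
        using continuous_on_nbox[OF B(1) smooth_fun_continuous[OF B(1) smooth_fun_partial[OF B(1) fB l]] x(1)] by metis
      show "\<forall>\<^sub>F s in at (w i). dist (partial l f (\<xi> (y s) l)) (partial l f x) < \<epsilon>"
        using ynear[OF q(1)] ynear[OF r(1)]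
      proof eventually_elim
        case (elim s)
        have "\<xi> (y s) l \<in> nbox n x q"
          using \<xi>(1,2)[OF elim(2) l] elim(1) le_less_trans unfolding nbox_def by blast
        then show ?case using q(2) by (simp add: dist_real_def)
      qed
    qed
    define Q where "Q s = ((if i = j then 1 else 0) - (if i = j then 0 else partial i f (\<xi> (y s) i))) *
        inverse (partial j f (\<xi> (y s) j))" for s
    have "(Q \<longlongrightarrow> G i x) (at (w i))"
    proof -
      have "((\<lambda>s. (if i = j then 1 else 0) - (if i = j then 0 else partial i f (\<xi> (y s) i))) \<longlongrightarrow>
          (if i = j then 1 else 0) - (if i = j then 0 else partial i f x)) (at (w i))"
        using tendsto_diff[OF tendsto_const lim[OF i], of 0] by (cases "i = j") simp_all
      moreover have "partial j f x \<noteq> 0" using pos[OF x(1)] by auto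
      ultimately show ?thesis
        unfolding Q_def G_def by (intro tendsto_mult tendsto_inverse lim[OF j])
    qed
    moreover have "\<forall>\<^sub>F s in at (w i). Q s = (h (w(i := s)) - h w) / (s - w i)"
      using ynear[OF r(1)] yW eventually_neq_at_within[of "w i" "w i" UNIV]
    proof eventually_elim
      case (elim s)
      define t where "t = h (w(i := s)) - h w"
      have "f (y s) - f x = (w(i := s)) j - w j"
        using \<phi>B(2)[OF elim(2)] \<phi>B(2)[OF w] by (simp add: y_def x_def)
      moreover have "f (y s) - f x = (\<Sum>l<n. (y s l - x l) * partial l f (\<xi> (y s) l))"
        by (rule \<xi>(3)[OF elim(1)])
      \<comment> \<open>When w moves along coordinate i, only the entries i and j of
        \<open>\<phi> w\<close> change, so at most two terms of the telescoped increment
        survive.\<close>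
      moreover have "(\<Sum>l<n. (y s l - x l) * partial l f (\<xi> (y s) l)) =
          (\<Sum>l<n. (if l = j then t * partial j f (\<xi> (y s) j) else 0) +
            (if l = i then (if i = j then 0 else (s - w i) * partial i f (\<xi> (y s) i)) else 0))"
        by (intro sum.cong refl) (auto simp: y_def x_def \<phi>_def t_def)
      ultimately have "(w(i := s)) j - w j =
          t * partial j f (\<xi> (y s) j) + (if i = j then 0 else (s - w i) * partial i f (\<xi> (y s) i))"
        using i j by (simp add: sum.distrib)
      moreover have "partial j f (\<xi> (y s) j) \<noteq> 0"
      proof -
        have "\<xi> (y s) j \<in> nbox n x r"
          using \<xi>(1,2)[OF elim(1) j] elim(1) le_less_trans unfolding nbox_def by blast
        then show ?thesis using pos r(2) by force
      qed
      ultimately show ?case using elim(3) unfolding Q_def t_def[symmetric]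
        by (cases "i = j") (auto simp: field_simps)
    qed
    ultimately have "((\<lambda>s. (h (w(i := s)) - h w) / (s - w i)) \<longlongrightarrow> G i x) (at (w i))"
      by (rule Lim_transform_eventually)
    then show ?thesis by (simp add: has_field_derivative_iff x_def)
  qed
  have \<phi>l: "\<phi> w l = (if l = j then h w else w l)" for w l by (simp add: \<phi>_def)
  have sh: "smooth_fun n W h"
  \<comment> \<open>The derivatives of \<open>h\<close> involve \<open>h\<close> itself, through
    \<open>\<phi>\<close>; this is the situation of the bootstrapping rule.\<close>
  proof (rule smooth_funI[OF W ch dh])
    fix i r assume i: "i < n" and hr: "Ck_fun r n W h"
    show "Ck_fun r n W (\<lambda>w. G i (\<phi> w))"
    proof (rule Ck_fun_compose[OF W B(1), where f = \<phi> and g = "G i"])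
      show "Ck_fun r n B (G i)" using smG[OF i] by (simp add: smooth_fun_def)
      show "Ck_fun r n W (\<lambda>w. \<phi> w l)" for l
        unfolding \<phi>l using hr W by (cases "l = j") (simp_all add: Ck_fun_coord)
    qed (use \<phi>B in auto)
  qed auto
  have "smooth_cart n W n \<phi>"
    unfolding smooth_cart_def
  proof (intro conjI allI impI)
    show "\<phi> ` W \<subseteq> cart n" using \<phi>B(1) opn_subset[OF B(1)] by blast
    show "smooth_fun n W (\<lambda>w. \<phi> w l)" for l
      unfolding \<phi>l using sh W by (cases "l = j") (simp_all add: smooth_fun_coord)
  qed
  moreover have "x(j := f x) \<in> W \<and> \<phi> (x(j := f x)) = x" if "x \<in> B" for x
  proof -
    have "S (x(j := f x)) (x j)" using that by (simp add: S_def)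
    moreover have "x \<in> cart n" using that opn_subset[OF B(1)] by blast
    ultimately show ?thesis using h_eq cart_upd[OF _ j] by (auto simp: W_def \<phi>_def)
  qed
  moreover have "(\<phi> w)(j := f (\<phi> w)) = w" if "w \<in> W" for w
    using \<phi>B(2)[OF that] by (simp add: \<phi>_def)
  moreover have "\<phi> ` W \<subseteq> B" using \<phi>B by blast
  ultimately show ?thesis using B W by blast
qed

text \<open>Components are straightened one at a time. When the first m of them are already
  coordinates, surjectivity of the differential yields a coordinate outside the range of
  \<open>\<iota>\<close> along which the next component has a nonzero derivative, and that
  coordinate is replaced by the component. Recording positions in \<open>\<iota>\<close> avoids
  permutations of coordinates.\<close>

lemma local_submersion_normal_form:
  fixes m :: nat
  assumes O: "opn n O'" and x0: "x0 \<in> O'" and p: "\<forall>i<m. smooth_fun n O' (p i)"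
    and surj: "\<forall>b. \<exists>v\<in>cart n. \<forall>i<m. dir_deriv n (p i) x0 v = b i"
  shows "\<exists>V W \<theta> \<phi> \<iota>. opn n V \<and> x0 \<in> V \<and> V \<subseteq> O' \<and> opn n W \<and>
    smooth_cart n V n \<theta> \<and> \<theta> ` V \<subseteq> W \<and> smooth_cart n W n \<phi> \<and> \<phi> ` W \<subseteq> V \<and>
    (\<forall>x\<in>V. \<phi> (\<theta> x) = x) \<and> (\<forall>w\<in>W. \<theta> (\<phi> w) = w) \<and>
    inj_on \<iota> {..<m} \<and> \<iota> ` {..<m} \<subseteq> {..<n} \<and> (\<forall>w\<in>W. \<forall>i<m. p i (\<phi> w) = w (\<iota> i))"
  using p surj
proof (induction m)
  case 0
  show ?case
    by (rule exI[of _ O'], rule exI[of _ O'], rule exI[of _ "\<lambda>x. x"], rule exI[of _ "\<lambda>x. x"], rule exI[of _ id])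
      (use O x0 smooth_cart_id[OF O] in auto)
next
  case (Suc m)
  have "\<forall>i<m. smooth_fun n O' (p i)" using Suc.prems(1) by simp
  moreover have "\<forall>b. \<exists>v\<in>cart n. \<forall>i<m. dir_deriv n (p i) x0 v = b i"
  proof
    fix b
    obtain v where "v \<in> cart n" "\<forall>i<Suc m. dir_deriv n (p i) x0 v = b i"
      using Suc.prems(2)[rule_format, of b] by (elim bexE)
    then show "\<exists>v\<in>cart n. \<forall>i<m. dir_deriv n (p i) x0 v = b i" by (intro bexI[of _ v]) simp_all
  qed
  ultimately have nf: "\<exists>V W \<theta> \<phi> \<iota>. opn n V \<and> x0 \<in> V \<and> V \<subseteq> O' \<and> opn n W \<and>
    smooth_cart n V n \<theta> \<and> \<theta> ` V \<subseteq> W \<and> smooth_cart n W n \<phi> \<and> \<phi> ` W \<subseteq> V \<and>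
    (\<forall>x\<in>V. \<phi> (\<theta> x) = x) \<and> (\<forall>w\<in>W. \<theta> (\<phi> w) = w) \<and>
    inj_on \<iota> {..<m} \<and> \<iota> ` {..<m} \<subseteq> {..<n} \<and> (\<forall>w\<in>W. \<forall>i<m. p i (\<phi> w) = w (\<iota> i))" by (rule Suc.IH)
  from nf obtain V W \<theta> \<phi> \<iota> where
    V: "opn n V" "x0 \<in> V" "V \<subseteq> O'" and W: "opn n W"
    and \<theta>: "smooth_cart n V n \<theta>" "\<theta> ` V \<subseteq> W" and \<phi>: "smooth_cart n W n \<phi>" "\<phi> ` W \<subseteq> V"
    and inv': "\<forall>x\<in>V. \<phi> (\<theta> x) = x" "\<forall>w\<in>W. \<theta> (\<phi> w) = w"
    and \<iota>': "inj_on \<iota> {..<m}" "\<iota> ` {..<m} \<subseteq> {..<n}" "\<forall>w\<in>W. \<forall>i<m. p i (\<phi> w) = w (\<iota> i)"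
    by (elim exE conjE) (rule that; assumption)
  note inv = inv'[rule_format] and \<iota> = \<iota>'(1,2) \<iota>'(3)[rule_format]
  have pV: "smooth_fun n V (p i)" if "i < Suc m" for i
    by (rule smooth_fun_subset[OF Suc.prems(1)[rule_format, OF that] O V(1,3)])
  define w0 where "w0 = \<theta> x0"
  have w0: "w0 \<in> W" "\<phi> w0 = x0" using \<theta>(2) V inv by (auto simp: w0_def)
  define g where "g = (\<lambda>w. p m (\<phi> w))"
  have g: "smooth_fun n W g" unfolding g_def
    by (rule smooth_fun_compose[OF W V(1) \<phi>(2) smooth_cartD(1)[OF \<phi>(1)] pV]) auto
  \<comment> \<open>A vector killed by the differentials of the first m components but not by that
    of component m. Read in the straightened coordinates as \<open>u\<close>, it has no entries in
    the range of \<open>\<iota>\<close>, so the derivative of \<open>g\<close> along it must come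
    from another coordinate.\<close>
  obtain v where v: "v \<in> cart n" "\<And>i. i < Suc m \<Longrightarrow> dir_deriv n (p i) x0 v = (if i = m then 1 else 0)"
    using Suc.prems(2)[rule_format, of "\<lambda>i. if i = m then 1 else 0"] by blast
  define u where "u = jac n n \<theta> x0 v"
  have ju: "jac n n \<phi> w0 u = v"
  proof -
    have "jac n n \<phi> w0 u = jac n n (\<phi> \<circ> \<theta>) x0 v"
      unfolding u_def w0_def by (rule jac_compose[OF V(1) W \<theta>(2,1) \<phi>(1) V(2), symmetric])
    also have "\<dots> = jac n n (\<lambda>x. x) x0 v" by (rule jac_cong[OF V(1,2)]) (simp add: inv)
    finally show ?thesis by (simp add: jac_id[OF v(1)])
  qed
  have dp: "dir_deriv n (\<lambda>w. p i (\<phi> w)) w0 u = (if i = m then 1 else 0)" if "i < Suc m" for i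
    using dir_deriv_compose[OF W V(1) \<phi>(2,1) pV[OF that] w0(1), of u] v(2)[OF that] by (simp add: ju w0)
  have u0: "u (\<iota> i) = 0" if i: "i < m" for i
  proof -
    have "\<iota> i < n" using \<iota>(2) i by auto
    then have "u (\<iota> i) = dir_deriv n (\<lambda>w. w (\<iota> i)) w0 u" by (simp add: dir_deriv_coord)
    also have "\<dots> = dir_deriv n (\<lambda>w. p i (\<phi> w)) w0 u"
      by (rule dir_deriv_cong[OF W w0(1)]) (simp add: \<iota>(3) i)
    finally show ?thesis using dp[of i] i by simp
  qed
  have "\<exists>j<n. j \<notin> \<iota> ` {..<m} \<and> partial j g w0 \<noteq> 0"
  proof (rule ccontr)
    assume "\<not> ?thesis"
    then have "u j * partial j g w0 = 0" if "j < n" for j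
      using u0 that by (cases "j \<in> \<iota> ` {..<m}") auto
    then have "dir_deriv n g w0 u = 0" unfolding dir_deriv_def by (intro sum.neutral) auto
    then show False using dp[of m] by (simp add: g_def)
  qed
  then obtain j where j: "j < n" "j \<notin> \<iota> ` {..<m}" "partial j g w0 \<noteq> 0" by blast
  obtain V' W' \<phi>' where V': "opn n V'" "w0 \<in> V'" "V' \<subseteq> W" and W': "opn n W'"
    and \<phi>': "smooth_cart n W' n \<phi>'" "\<phi>' ` W' \<subseteq> V'"
    and inv'': "\<And>x. x \<in> V' \<Longrightarrow> x(j := g x) \<in> W'" "\<And>x. x \<in> V' \<Longrightarrow> \<phi>' (x(j := g x)) = x"
      "\<And>w. w \<in> W' \<Longrightarrow> (\<phi>' w)(j := g (\<phi>' w)) = w"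
    using inverse_of_coordinate_change[OF W g w0(1) j(1,3)] by blast
  define \<theta>' where "\<theta>' = (\<lambda>x. x(j := g x))"
  have \<theta>': "smooth_cart n V' n \<theta>'"
    unfolding smooth_cart_def
  proof (intro conjI allI impI)
    show "\<theta>' ` V' \<subseteq> cart n" using inv''(1) opn_subset[OF W'] by (auto simp: \<theta>'_def)
    show "smooth_fun n V' (\<lambda>x. \<theta>' x i)" if "i < n" for i
      by (cases "i = j") (simp_all add: \<theta>'_def smooth_fun_coord V' smooth_fun_subset[OF g W V'(1,3)])
  qed
  define V2 where "V2 = {x \<in> V. \<theta> x \<in> V'}"
  have V2: "opn n V2" unfolding V2_def by (rule smooth_cart_preimage[OF V(1) \<theta>(1) V'(1)])
  have sub: "V2 \<subseteq> V" "\<theta> ` V2 \<subseteq> V'" by (auto simp: V2_def)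
  have \<theta>2: "smooth_cart n V2 n (\<theta>' \<circ> \<theta>)"
    by (rule smooth_cart_compose[OF V2 V'(1) sub(2) smooth_cart_subset[OF \<theta>(1) V(1) V2 sub(1)] \<theta>'])
  have \<phi>2: "smooth_cart n W' n (\<phi> \<circ> \<phi>')"
    by (rule smooth_cart_compose[OF W' V'(1) \<phi>'(2,1) smooth_cart_subset[OF \<phi>(1) W V'(1,3)]])
  have \<phi>'W: "\<phi>' w \<in> V'" "\<phi>' w \<in> W" if "w \<in> W'" for w using that \<phi>'(2) V'(3) by auto
  have \<phi>'c: "\<phi>' w i = w i" if "w \<in> W'" "i \<noteq> j" for w i
    using fun_cong[OF inv''(3)[OF that(1)], of i] that(2) by simp
  have "p i ((\<phi> \<circ> \<phi>') w) = w ((\<iota>(m := j)) i)" if w: "w \<in> W'" and i: "i < Suc m" for w i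
  proof (cases "i = m")
    case True
    have "g (\<phi>' w) = w j" using fun_cong[OF inv''(3)[OF w], of j] by simp
    then show ?thesis using True by (simp add: g_def)
  next
    case False
    then have "i < m" "\<iota> i \<noteq> j" using i j by auto
    then show ?thesis using \<iota>(3)[OF \<phi>'W(2)[OF w]] \<phi>'c[OF w] by simp
  qed
  then have f1: "\<forall>w\<in>W'. \<forall>i<Suc m. p i ((\<phi> \<circ> \<phi>') w) = w ((\<iota>(m := j)) i)" by blast
  have f2: "inj_on (\<iota>(m := j)) {..<Suc m}" "(\<iota>(m := j)) ` {..<Suc m} \<subseteq> {..<n}"
    using \<iota>(1,2) j(1,2) by (auto simp: lessThan_Suc inj_on_fun_updI fun_upd_image)
  have f3: "(\<theta>' \<circ> \<theta>) ` V2 \<subseteq> W'" using inv''(1) by (auto simp: V2_def \<theta>'_def)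
  have f4: "(\<phi> \<circ> \<phi>') ` W' \<subseteq> V2" using \<phi>'W \<phi>(2) inv(2) by (auto simp: V2_def)
  have f5: "\<forall>x\<in>V2. (\<phi> \<circ> \<phi>') ((\<theta>' \<circ> \<theta>) x) = x" using inv''(2) inv(1) by (simp add: V2_def \<theta>'_def)
  have f6: "\<forall>w\<in>W'. (\<theta>' \<circ> \<theta>) ((\<phi> \<circ> \<phi>') w) = w" using inv''(3) inv(2) \<phi>'W by (simp add: \<theta>'_def)
  have f7: "x0 \<in> V2" "V2 \<subseteq> O'" using V V'(2) by (auto simp: V2_def w0_def)
  show ?case
    by (intro exI[of _ V2] exI[of _ W'] exI[of _ "\<theta>' \<circ> \<theta>"] exI[of _ "\<phi> \<circ> \<phi>'"] exI[of _ "\<iota>(m := j)"] conjI; fact)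
qed

section \<open>Submersions of manifolds: normal form and local lifts\<close>

lemma openin_mtop:
  "openin (mtop M) A \<longleftrightarrow> A \<subseteq> mpts M \<and> (\<forall>c\<in>atlas M. opn (mdim M) (cmap c ` (A \<inter> cdom c)))"
  if M: "smooth_manifold M"
proof -
  have "istopology (\<lambda>A. A \<subseteq> mpts M \<and> (\<forall>c\<in>atlas M. opn (mdim M) (cmap c ` (A \<inter> cdom c))))"
    unfolding istopology_def
  proof (intro conjI allI impI ballI)
    fix A B c
    assume A: "A \<subseteq> mpts M \<and> (\<forall>c\<in>atlas M. opn (mdim M) (cmap c ` (A \<inter> cdom c)))"
      and B: "B \<subseteq> mpts M \<and> (\<forall>c\<in>atlas M. opn (mdim M) (cmap c ` (B \<inter> cdom c)))"
    show "A \<inter> B \<subseteq> mpts M" using A by blast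
    assume c: "c \<in> atlas M"
    have "cmap c ` (A \<inter> B \<inter> cdom c) = cmap c ` (A \<inter> cdom c) \<inter> cmap c ` (B \<inter> cdom c)"
      using inj_on_image_Int[OF manifold_chart(2)[OF M c], of "A \<inter> cdom c" "B \<inter> cdom c"]
      by (simp add: Int_ac)
    then show "opn (mdim M) (cmap c ` (A \<inter> B \<inter> cdom c))" using A B c by (simp add: openin_Int)
  next
    fix K c
    assume K: "\<forall>A\<in>K. A \<subseteq> mpts M \<and> (\<forall>c\<in>atlas M. opn (mdim M) (cmap c ` (A \<inter> cdom c)))"
    then show "\<Union> K \<subseteq> mpts M" by blast
    assume c: "c \<in> atlas M"
    have "cmap c ` (\<Union> K \<inter> cdom c) = \<Union> ((\<lambda>A. cmap c ` (A \<inter> cdom c)) ` K)" by blast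
    then show "opn (mdim M) (cmap c ` (\<Union> K \<inter> cdom c))" using K c by auto
  qed
  then show ?thesis unfolding mtop_def by (subst topology_inverse') auto
qed

text \<open>The coordinate image \<open>W\<close> is a cube because homotopies will run along
  straight segments in it. The coordinate map \<open>\<Theta>\<close> is described by its effect on
  smooth maps into M, which is how it is used for homotopies, so it need not be exhibited as a
  member of the atlas.\<close>

lemma submersion_normal_form:
  assumes M: "smooth_manifold M" and N: "smooth_manifold N" and p: "submersion M N p" and x: "x \<in> mpts M"
  obtains b W \<Theta> \<Phi> V \<iota> w0 \<epsilon> where "b \<in> atlas N" "W = nbox (mdim M) w0 \<epsilon>" "w0 = \<Theta> x"
    "smooth_into (mdim M) W M \<Phi>" "\<Phi> ` W \<subseteq> V" "openin (mtop M) V" "x \<in> V" "p ` V \<subseteq> cdom b" "\<Theta> ` V \<subseteq> W"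
    "\<forall>y\<in>V. \<Phi> (\<Theta> y) = y"
    "\<forall>l O' f. opn l O' \<longrightarrow> smooth_into l O' M f \<longrightarrow>
      opn l {s \<in> O'. f s \<in> V} \<and> smooth_cart l {s \<in> O'. f s \<in> V} (mdim M) (\<Theta> \<circ> f)"
    "inj_on \<iota> {..<mdim N}" "\<iota> ` {..<mdim N} \<subseteq> {..<mdim M}"
    "\<forall>w\<in>W. \<forall>i<mdim N. cmap b (p (\<Phi> w)) i = w (\<iota> i)"
proof -
  define n where "n = mdim M"
  define m where "m = mdim N"
  have ps: "smooth_map M N p" using p by (simp add: submersion_def)
  obtain c where c: "c \<in> atlas M" "x \<in> cdom c" using manifold_cover[OF M x] by blast
  have sp: "smooth_into n (cimg c) N (p \<circ> cinv c)" using ps c(1) by (simp add: smooth_map_def n_def)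
  have xc: "cmap c x \<in> cimg c" using c by blast
  have cx: "cinv c (cmap c x) = x" using cinv_cmap[OF M c] .
  have "p x \<in> mpts N" using smooth_into_mpts[OF sp xc] cx by simp
  then obtain b where b: "b \<in> atlas N" "p x \<in> cdom b" using manifold_cover[OF N] by blast
  define D where "D = {r \<in> cimg c. (p \<circ> cinv c) r \<in> cdom b}"
  define P where "P = cmap b \<circ> (p \<circ> cinv c)"
  note cop = manifold_chart(3)[OF M c(1), folded n_def]
  note D = smooth_into_chart[OF N cop sp b(1), folded D_def P_def m_def]
  have xD: "cmap c x \<in> D" using xc cx b by (simp add: D_def)
  have surj: "\<forall>a. \<exists>v\<in>cart n. \<forall>i<m. dir_deriv n (\<lambda>y. P y i) (cmap c x) v = a i"
    (is "\<forall>a. ?Q a")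
  proof
    fix a
    have "(\<lambda>i. if i < m then a i else 0) \<in> diff_in_charts M N p c b x ` cart n"
      using p c b unfolding submersion_def n_def m_def by (auto simp: cart_iff)
    then obtain v where "v \<in> cart n" "(\<lambda>i. if i < m then a i else 0) = diff_in_charts M N p c b x v" by blast
    then show "?Q a"
      by (intro bexI[of _ v]) (auto simp: diff_in_charts_def jac_def fun_eq_iff n_def m_def P_def comp_assoc split: if_splits)
  qed
  have "\<forall>i<m. smooth_fun n D (\<lambda>y. P y i)" using smooth_cartD(1)[OF D(2)] by blast
  from local_submersion_normal_form[OF D(1) xD this surj]
  obtain V0 W0 \<theta> \<phi> \<iota> where V0: "opn n V0" "cmap c x \<in> V0" "V0 \<subseteq> D" and W0: "opn n W0"
    and \<theta>: "smooth_cart n V0 n \<theta>" "\<theta> ` V0 \<subseteq> W0" and \<phi>: "smooth_cart n W0 n \<phi>" "\<phi> ` W0 \<subseteq> V0"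
    and inv': "\<forall>x\<in>V0. \<phi> (\<theta> x) = x" "\<forall>w\<in>W0. \<theta> (\<phi> w) = w"
    and \<iota>': "inj_on \<iota> {..<m}" "\<iota> ` {..<m} \<subseteq> {..<n}" "\<forall>w\<in>W0. \<forall>i<m. P (\<phi> w) i = w (\<iota> i)"
    by (elim exE conjE) (rule that; assumption)
  note inv = inv'[rule_format] and \<iota> = \<iota>'(1,2) \<iota>'(3)[rule_format]
  define w0 where "w0 = \<theta> (cmap c x)"
  have w0: "w0 \<in> W0" using \<theta>(2) V0(2) by (auto simp: w0_def)
  obtain \<epsilon> where \<epsilon>: "\<epsilon> > 0" "nbox n w0 \<epsilon> \<subseteq> W0" using opn_contains_nbox[OF W0 w0] by blast
  define W where "W = nbox n w0 \<epsilon>"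
  have W: "opn n W" "W \<subseteq> W0" "w0 \<in> W"
    using \<epsilon> opn_nbox nbox_self w0 opn_subset[OF W0] unfolding W_def by blast+
  define V1 where "V1 = {z \<in> V0. \<theta> z \<in> W}"
  have V1: "opn n V1" unfolding V1_def by (rule smooth_cart_preimage[OF V0(1) \<theta>(1) W(1)])
  have V1c: "V1 \<subseteq> cimg c" "V1 \<subseteq> V0" using V0(3) by (auto simp: V1_def D_def)
  define V where "V = {y \<in> cdom c. cmap c y \<in> V1}"
  define \<Theta> where "\<Theta> = (\<lambda>y. \<theta> (cmap c y))"
  define \<Phi> where "\<Phi> = (\<lambda>w. cinv c (\<phi> w))"
  have \<phi>V: "\<phi> w \<in> V1" if "w \<in> W" for w
    using that W(2) \<phi>(2) inv(2) by (auto simp: V1_def)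
  have \<Phi>: "smooth_into n W M \<Phi>"
    unfolding \<Phi>_def n_def
    by (rule smooth_into_cinv_comp[OF M c(1)])
      (use W(1) smooth_cart_subset[OF \<phi>(1) W0 W(1,2)] \<phi>V V1c in \<open>auto simp: n_def\<close>)
  have c\<Phi>: "cmap c (\<Phi> w) = \<phi> w" "\<Phi> w \<in> cdom c" if "w \<in> W" for w
  proof -
    have "\<phi> w \<in> cimg c" using \<phi>V[OF that] V1c(1) by blast
    then show "cmap c (\<Phi> w) = \<phi> w" "\<Phi> w \<in> cdom c"
      unfolding \<Phi>_def by (rule cmap_cinv, rule cinv_cdom)
  qed
  have pre: "opn l {s \<in> O'. f s \<in> V}" "smooth_cart l {s \<in> O'. f s \<in> V} n (\<Theta> \<circ> f)"
    if O: "opn l O'" and f: "smooth_into l O' M f" for l O' f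
  proof -
    define T where "T = {s \<in> O'. f s \<in> cdom c}"
    note T = smooth_into_chart[OF M O f c(1), folded T_def n_def]
    have eq: "{s \<in> O'. f s \<in> V} = {s \<in> T. (cmap c \<circ> f) s \<in> V1}" by (auto simp: T_def V_def)
    show op: "opn l {s \<in> O'. f s \<in> V}" unfolding eq by (rule smooth_cart_preimage[OF T V1])
    have "smooth_cart l {s \<in> O'. f s \<in> V} n (\<theta> \<circ> (cmap c \<circ> f))"
      by (rule smooth_cart_compose[OF op V1 _ smooth_cart_subset[OF T(2,1) op] smooth_cart_subset[OF \<theta>(1) V0(1) V1 V1c(2)]])
        (auto simp: eq)
    then show "smooth_cart l {s \<in> O'. f s \<in> V} n (\<Theta> \<circ> f)" by (simp add: \<Theta>_def comp_def)
  qed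
  have V: "openin (mtop M) V"
    unfolding openin_mtop[OF M]
  proof (intro conjI ballI)
    show "V \<subseteq> mpts M" using manifold_chart(1)[OF M c(1)] by (auto simp: V_def)
    fix c' assume c': "c' \<in> atlas M"
    have "cmap c' ` (V \<inter> cdom c') = {z \<in> cimg c'. cinv c' z \<in> V}"
      using cinv_cmap[OF M c'] cmap_cinv[of _ c'] cinv_cdom[of _ c'] by force
    then show "opn (mdim M) (cmap c' ` (V \<inter> cdom c'))"
      using pre(1)[OF manifold_chart(3)[OF M c'] smooth_into_cinv[OF M c']] by simp
  qed
  have q1: "x \<in> V" using c(2) V0(2) W(3) by (simp add: V_def V1_def w0_def)
  have q2: "p ` V \<subseteq> cdom b"
  proof
    fix z assume "z \<in> p ` V"
    then obtain y where y: "z = p y" "y \<in> cdom c" "cmap c y \<in> D" using V1c(2) V0(3) by (auto simp: V_def)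
    then show "z \<in> cdom b" using cinv_cmap[OF M c(1) y(2)] by (simp add: D_def)
  qed
  have q3: "\<Theta> ` V \<subseteq> W" by (auto simp: V_def V1_def \<Theta>_def)
  have q4: "\<Phi> ` W \<subseteq> V" using c\<Phi> \<phi>V by (auto simp: V_def)
  have q5: "\<forall>y\<in>V. \<Phi> (\<Theta> y) = y"
    using inv(1) V1c(2) cinv_cmap[OF M c(1)] by (auto simp: V_def \<Theta>_def \<Phi>_def)
  have q7: "\<forall>w\<in>W. \<forall>i<m. cmap b (p (\<Phi> w)) i = w (\<iota> i)"
    using \<iota>(3) W(2) by (auto simp: P_def \<Phi>_def)
  have q6: "\<forall>l O' f. opn l O' \<longrightarrow> smooth_into l O' M f \<longrightarrow>
      opn l {s \<in> O'. f s \<in> V} \<and> smooth_cart l {s \<in> O'. f s \<in> V} n (\<Theta> \<circ> f)"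
    using pre by blast
  have q8: "w0 = \<Theta> x" by (simp add: \<Theta>_def w0_def)
  have Wn: "W = nbox n w0 \<epsilon>" by (rule W_def)
  show thesis
    by (rule that[of b W w0 \<epsilon> \<Theta> \<Phi> V \<iota>]; (fold n_def m_def)?; fact)
qed

lemma chart_map_eqI:
  assumes "smooth_manifold N" "b \<in> atlas N" "y \<in> cdom b" "z \<in> cdom b"
    and "\<And>i. i < mdim N \<Longrightarrow> cmap b y i = cmap b z i"
  shows "y = z"
proof (rule inj_onD[OF manifold_chart(2)[OF assms(1,2)] _ assms(3,4)])
  have "cimg b \<subseteq> cart (mdim N)" by (rule opn_subset[OF manifold_chart(3)[OF assms(1,2)]])
  then show "cmap b y = cmap b z" using assms(3-) by (intro cart_eqI[of _ "mdim N"]) auto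
qed

text \<open>In the normal form p reads off the coordinates in the range of \<open>\<iota>\<close>.
  The lift takes these from f and freezes the others at their values at x, so it passes through the
  prescribed point x.\<close>

lemma submersion_lift:
  assumes M: "smooth_manifold M" and N: "smooth_manifold N" and p: "submersion M N p"
    and O: "opn l O'" and f: "smooth_into l O' N f" and r: "r \<in> O'" and x: "x \<in> mpts M" "p x = f r"
  shows "\<exists>W g. opn l W \<and> r \<in> W \<and> W \<subseteq> O' \<and> smooth_into l W M g \<and> (\<forall>s\<in>W. p (g s) = f s) \<and> g r = x"
proof -
  define n m where "n = mdim M" and "m = mdim N"
  obtain b W \<Theta> \<Phi> V \<iota> w0 \<epsilon> where b: "b \<in> atlas N" and Wn: "W = nbox n w0 \<epsilon>"
    and \<Phi>: "smooth_into n W M \<Phi>" "\<Phi> ` W \<subseteq> V" and V: "x \<in> V" "p ` V \<subseteq> cdom b" "\<Theta> ` V \<subseteq> W"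
    and inv': "\<forall>y\<in>V. \<Phi> (\<Theta> y) = y" and w0x: "w0 = \<Theta> x"
    and \<iota>: "inj_on \<iota> {..<m}" "\<iota> ` {..<m} \<subseteq> {..<n}"
    and p\<Phi>': "\<forall>w\<in>W. \<forall>i<m. cmap b (p (\<Phi> w)) i = w (\<iota> i)"
    by (rule submersion_normal_form[OF M N p x(1), folded n_def m_def]) (rule that; assumption)
  note inv = inv'[rule_format] and p\<Phi> = p\<Phi>'[rule_format]
  note W = Wn w0x
  have Wo: "opn n W" unfolding Wn by (rule opn_nbox)
  have w0: "w0 \<in> W" using V W(2) by auto
  then have w0c: "w0 \<in> cart n" using opn_subset[OF Wo] by blast
  define D where "D = {s \<in> O'. f s \<in> cdom b}"
  note D = smooth_into_chart[OF N O f b, folded D_def m_def]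
  have rD: "r \<in> D" using r x(2) V by (auto simp: D_def)
  define \<omega> where "\<omega> s = (\<lambda>i. if i \<in> \<iota> ` {..<m} then cmap b (f s) (inv_into {..<m} \<iota> i) else w0 i)" for s
  have \<omega>: "smooth_cart l D n \<omega>"
    unfolding smooth_cart_def
  proof (intro conjI allI impI)
    have "i \<notin> \<iota> ` {..<m}" if "n \<le> i" for i using \<iota>(2) that by auto
    then show "\<omega> ` D \<subseteq> cart n" using w0c by (simp add: image_subset_iff cart_iff \<omega>_def)
    fix i assume "i < n"
    show "smooth_fun l D (\<lambda>s. \<omega> s i)"
      using smooth_cart_coord[OF D, of "inv_into {..<m} \<iota> i"] smooth_fun_const[OF D(1)]
      by (cases "i \<in> \<iota> ` {..<m}") (simp_all add: \<omega>_def comp_def)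
  qed
  have \<omega>\<iota>: "\<omega> s (\<iota> i) = cmap b (f s) i" if "i < m" for s i
    using that \<iota>(1) by (simp add: \<omega>_def)
  have "\<omega> r = w0"
  proof
    fix j
    show "\<omega> r j = w0 j"
    proof (cases "j \<in> \<iota> ` {..<m}")
      case True
      then obtain i where i: "i < m" "j = \<iota> i" by auto
      have "cmap b (p (\<Phi> w0)) i = w0 (\<iota> i)" by (rule p\<Phi>[OF w0 i(1)])
      then show ?thesis using i \<omega>\<iota> x(2) inv[OF V(1)] W(2) by simp
    qed (simp add: \<omega>_def)
  qed
  define T where "T = {s \<in> D. \<omega> s \<in> W}"
  have T: "opn l T" unfolding T_def by (rule smooth_cart_preimage[OF D(1) \<omega> Wo])
  have \<omega>T: "\<omega> ` T \<subseteq> W" "T \<subseteq> D" by (auto simp: T_def)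
  have "smooth_into l T M (\<Phi> \<circ> \<omega>)"
    by (rule smooth_into_compose[OF \<Phi>(1) Wo T smooth_cart_subset[OF \<omega> D(1) T \<omega>T(2)] \<omega>T(1)])
  moreover have "p ((\<Phi> \<circ> \<omega>) s) = f s" if "s \<in> T" for s
  proof (rule chart_map_eqI[OF N b])
    have w: "\<omega> s \<in> W" using that by (simp add: T_def)
    then show "p ((\<Phi> \<circ> \<omega>) s) \<in> cdom b" using \<Phi>(2) V(2) by auto
    show "f s \<in> cdom b" using that by (simp add: T_def D_def)
    show "cmap b (p ((\<Phi> \<circ> \<omega>) s)) i = cmap b (f s) i" if "i < mdim N" for i
      using p\<Phi>[OF w] \<omega>\<iota> that by (simp add: m_def)
  qed
  moreover have "(\<Phi> \<circ> \<omega>) r = x" using \<open>\<omega> r = w0\<close> W(2) inv V(1) by simp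
  moreover have "r \<in> T" "T \<subseteq> O'" using rD w0 \<open>\<omega> r = w0\<close> by (auto simp: T_def D_def)
  ultimately show ?thesis using T by (intro exI[of _ T] exI[of _ "\<Phi> \<circ> \<omega>"]) blast
qed

section \<open>Homotopies inside the fibers\<close>

lemma cart_mono: "m \<le> n \<Longrightarrow> cart m \<subseteq> cart n"
  by simp

lemma nbox_convex:
  assumes "a \<in> nbox n x e" "b \<in> nbox n x e" "0 \<le> t" "t \<le> 1"
  shows "(\<lambda>i. (1 - t) * a i + t * b i) \<in> nbox n x e"
  unfolding nbox_def
proof (intro CollectI conjI allI impI)
  show "(\<lambda>i. (1 - t) * a i + t * b i) \<in> cart n"
    using assms(1,2) by (intro lincomb_cart) (auto simp: nbox_def)
  fix i assume i: "i < n"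
  have "\<bar>a i - x i\<bar> < e" "\<bar>b i - x i\<bar> < e" using assms(1,2) i by (auto simp: nbox_def)
  then have "a i \<in> {x i - e<..<x i + e}" "b i \<in> {x i - e<..<x i + e}" by auto
  then have "(1 - t) *\<^sub>R a i + t *\<^sub>R b i \<in> {x i - e<..<x i + e}"
    using assms(3,4) by (intro convexD) auto
  then show "\<bar>(1 - t) * a i + t * b i - x i\<bar> < e" by auto
qed

lemma smooth_cart_drop_last: "opn (Suc l) O' \<Longrightarrow> smooth_cart (Suc l) O' l (\<lambda>y. y(l := 0))"
  unfolding smooth_cart_def
proof (intro conjI allI impI)
  assume O: "opn (Suc l) O'"
  show "(\<lambda>y. y(l := 0)) ` O' \<subseteq> cart l"
    using opn_subset[OF O] by (auto simp: cart_iff)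
  show "smooth_fun (Suc l) O' (\<lambda>y. (y(l := 0)) i)" if "i < l" for i
    using that by (simp add: smooth_fun_coord O)
qed

lemma smooth_cart_append:
  assumes "opn l O'"
  shows "smooth_cart l O' (Suc l) (\<lambda>s. s(l := t))"
    and "v \<in> cart l \<Longrightarrow> jac l (Suc l) (\<lambda>s. s(l := t)) s v = v"
proof -
  show "smooth_cart l O' (Suc l) (\<lambda>s. s(l := t))"
    unfolding smooth_cart_def
  proof (intro conjI allI impI)
    show "(\<lambda>s. s(l := t)) ` O' \<subseteq> cart (Suc l)" using opn_subset[OF assms] by (auto simp: cart_iff)
    show "smooth_fun l O' (\<lambda>s. (s(l := t)) i)" for i
      by (cases "i = l") (simp_all add: smooth_fun_coord smooth_fun_const assms)
  qed
  assume v: "v \<in> cart l"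
  show "jac l (Suc l) (\<lambda>s. s(l := t)) s v = v"
  proof (rule cart_eqI[of _ "Suc l"])
    show "v \<in> cart (Suc l)" using v by (simp add: cart_iff)
    fix i assume "i < Suc l"
    then show "jac l (Suc l) (\<lambda>s. s(l := t)) s v i = v i"
      using v by (cases "i = l") (simp_all add: jac_def dir_deriv_coord cart_iff)
  qed simp
qed

text \<open>Smoothness is defined on open sets only, so the homotopy lives on an open
  \<open>T\<close> around the product of \<open>O2\<close> with the closed interval [0, 1]. Time is
  the coordinate with index l, and \<open>y(l := 0)\<close> is the space part of a point y.\<close>

definition fiber_homotopic ::
  "'a manifold \<Rightarrow> ('a \<Rightarrow> 'b) \<Rightarrow> nat \<Rightarrow> vec set \<Rightarrow> (vec \<Rightarrow> 'a) \<Rightarrow> (vec \<Rightarrow> 'a) \<Rightarrow> vec \<Rightarrow> bool" where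
  "fiber_homotopic M p l O' f g r \<longleftrightarrow>
    (\<exists>O2 T h. opn l O2 \<and> r \<in> O2 \<and> O2 \<subseteq> O' \<and> opn (Suc l) T \<and> smooth_into (Suc l) T M h \<and>
      (\<forall>s\<in>O2. \<forall>t. 0 \<le> t \<longrightarrow> t \<le> 1 \<longrightarrow> s(l := t) \<in> T) \<and>
      (\<forall>s\<in>O2. h (s(l := 0)) = f s \<and> h (s(l := 1)) = g s) \<and>
      (\<forall>y\<in>T. y(l := 0) \<in> O2 \<and> p (h y) = p (f (y(l := 0)))))"

text \<open>The homotopy is a straight line in coordinates in which \<open>p\<close> is a projection. The time is the
  last coordinate.\<close>

lemma submersion_homotopy:
  assumes M: "smooth_manifold M" and N: "smooth_manifold N" and p: "submersion M N p" and x: "x \<in> mpts M"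
  shows "\<exists>V. openin (mtop M) V \<and> x \<in> V \<and> (\<forall>l O' f g r. opn l O' \<longrightarrow> smooth_into l O' M f \<longrightarrow>
    smooth_into l O' M g \<longrightarrow> (\<forall>s\<in>O'. p (f s) = p (g s)) \<longrightarrow> r \<in> O' \<longrightarrow> f r \<in> V \<longrightarrow> g r \<in> V \<longrightarrow>
    fiber_homotopic M p l O' f g r)"
proof -
  define n m where "n = mdim M" and "m = mdim N"
  obtain b W \<Theta> \<Phi> V \<iota> w0 \<epsilon> where b: "b \<in> atlas N" and W: "W = nbox n w0 \<epsilon>"
    and \<Phi>: "smooth_into n W M \<Phi>" "\<Phi> ` W \<subseteq> V" and V: "openin (mtop M) V" "x \<in> V" "p ` V \<subseteq> cdom b" "\<Theta> ` V \<subseteq> W"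
    and inv': "\<forall>y\<in>V. \<Phi> (\<Theta> y) = y"
    and \<Theta>': "\<forall>l O' f. opn l O' \<longrightarrow> smooth_into l O' M f \<longrightarrow>
      opn l {s \<in> O'. f s \<in> V} \<and> smooth_cart l {s \<in> O'. f s \<in> V} n (\<Theta> \<circ> f)"
    and p\<Phi>': "\<forall>w\<in>W. \<forall>i<m. cmap b (p (\<Phi> w)) i = w (\<iota> i)"
    by (rule submersion_normal_form[OF M N p x, folded n_def m_def]) (rule that; assumption)
  note inv = inv'[rule_format] and p\<Phi> = p\<Phi>'[rule_format]
  have \<Theta>: "opn l {s \<in> O'. f s \<in> V}" "smooth_cart l {s \<in> O'. f s \<in> V} n (\<Theta> \<circ> f)"
    if "opn l O'" "smooth_into l O' M f" for l O' f using \<Theta>' that by blast+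
  have Wo: "opn n W" unfolding W by (rule opn_nbox)
  have main: "fiber_homotopic M p l O' f g r"
    if O: "opn l O'" and f: "smooth_into l O' M f" and g: "smooth_into l O' M g"
      and fg: "\<forall>s\<in>O'. p (f s) = p (g s)" and r: "r \<in> O'" "f r \<in> V" "g r \<in> V" for l O' f g r
  proof -
    define O2 where "O2 = {s \<in> O'. f s \<in> V} \<inter> {s \<in> O'. g s \<in> V}"
    have O2: "opn l O2" unfolding O2_def by (intro openin_Int \<Theta>(1) O f g)
    have O2V: "f s \<in> V" "g s \<in> V" "s \<in> O'" "s \<in> cart l" if "s \<in> O2" for s
      using that opn_subset[OF O] by (auto simp: O2_def)
    have sf: "smooth_cart l O2 n (\<Theta> \<circ> f)"
      by (rule smooth_cart_subset[OF \<Theta>(2,1)[OF O f] O2]) (auto simp: O2_def)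
    have sg: "smooth_cart l O2 n (\<Theta> \<circ> g)"
      by (rule smooth_cart_subset[OF \<Theta>(2,1)[OF O g] O2]) (auto simp: O2_def)
    define T1 where "T1 = {y \<in> cart (Suc l). y(l := 0) \<in> O2}"
    have T1: "opn (Suc l) T1"
      unfolding T1_def by (rule smooth_cart_preimage[OF opn_cart smooth_cart_drop_last[OF opn_cart] O2])
    define \<omega> where "\<omega> y = (\<lambda>i. (1 - y l) * \<Theta> (f (y(l := 0))) i + y l * \<Theta> (g (y(l := 0))) i)" for y :: vec
    have dr: "smooth_cart (Suc l) T1 l (\<lambda>y. y(l := 0))" "(\<lambda>y. y(l := 0)) ` T1 \<subseteq> O2"
      using smooth_cart_drop_last[OF T1] by (auto simp: T1_def)
    note sf1 = smooth_cart_compose[OF T1 O2 dr(2,1) sf]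
    note sg1 = smooth_cart_compose[OF T1 O2 dr(2,1) sg]
    have \<omega>: "smooth_cart (Suc l) T1 n \<omega>"
      unfolding smooth_cart_def
    proof (intro conjI allI impI)
      show "\<omega> ` T1 \<subseteq> cart n"
        unfolding \<omega>_def using smooth_cartD(2)[OF sf1] smooth_cartD(2)[OF sg1]
        by (intro image_subsetI lincomb_cart) auto
      fix i assume i: "i < n"
      show "smooth_fun (Suc l) T1 (\<lambda>y. \<omega> y i)"
        unfolding \<omega>_def using smooth_cartD(1)[OF sf1 i] smooth_cartD(1)[OF sg1 i]
        by (intro smooth_fun_add smooth_fun_mult smooth_fun_diff smooth_fun_const smooth_fun_coord T1) (simp_all add: comp_def)
    qed
    \<comment> \<open>All times at which the full line through the two points is still in
      \<open>W\<close>. This set is open, and convexity of the cube puts the times from 0 to 1 into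
      it.\<close>
    define T where "T = {y \<in> T1. \<omega> y \<in> W}"
    have T: "opn (Suc l) T" unfolding T_def by (rule smooth_cart_preimage[OF T1 \<omega> Wo])
    have TT: "\<omega> ` T \<subseteq> W" "T \<subseteq> T1" by (auto simp: T_def)
    have h: "smooth_into (Suc l) T M (\<Phi> \<circ> \<omega>)"
      by (rule smooth_into_compose[OF \<Phi>(1) Wo T smooth_cart_subset[OF \<omega> T1 T TT(2)] TT(1)])
    have s0: "s(l := 0) = s" if "s \<in> O2" for s
      using O2V(4)[OF that] by (auto simp: cart_iff fun_eq_iff)
    have \<omega>s: "\<omega> (s(l := t)) = (\<lambda>i. (1 - t) * \<Theta> (f s) i + t * \<Theta> (g s) i)" if "s \<in> O2" for s t
      by (simp add: \<omega>_def s0[OF that])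
    have "s(l := t) \<in> T" if s: "s \<in> O2" and t: "0 \<le> t" "t \<le> 1" for s t
    proof -
      have "\<omega> (s(l := t)) \<in> W"
        unfolding \<omega>s[OF s] W by (rule nbox_convex) (use O2V[OF s] V(4) W t in auto)
      moreover have "s(l := t) \<in> cart (Suc l)" using O2V(4)[OF s] by (auto simp: cart_iff)
      ultimately show ?thesis using s s0[OF s] by (simp add: T_def T1_def)
    qed
    moreover have "(\<Phi> \<circ> \<omega>) (s(l := 0)) = f s" "(\<Phi> \<circ> \<omega>) (s(l := 1)) = g s" if "s \<in> O2" for s
      using \<omega>s[OF that, of 0] \<omega>s[OF that, of 1] inv O2V[OF that] by simp_all
    moreover have "y(l := 0) \<in> O2 \<and> p ((\<Phi> \<circ> \<omega>) y) = p (f (y(l := 0)))" if y: "y \<in> T" for y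
    proof
      define s where "s = y(l := 0)"
      show s: "y(l := 0) \<in> O2" using y by (simp add: T_def T1_def)
      note sV = O2V[OF s, folded s_def]
      have w: "\<omega> y \<in> W" using y by (simp add: T_def)
      show "p ((\<Phi> \<circ> \<omega>) y) = p (f (y(l := 0)))"
      proof (rule chart_map_eqI[OF N b])
        show "p ((\<Phi> \<circ> \<omega>) y) \<in> cdom b" using w \<Phi>(2) V(3) by auto
        show "p (f (y(l := 0))) \<in> cdom b" using sV V(3) by (auto simp: s_def)
        fix i assume "i < mdim N"
        then have i: "i < m" by (simp add: m_def)
        \<comment> \<open>In the coordinates that p reads off, the two ends agree, so the segment is
          constant there.\<close>
        have "\<Theta> (f s) (\<iota> i) = cmap b (p (f s)) i" "\<Theta> (g s) (\<iota> i) = cmap b (p (g s)) i"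
          using p\<Phi>[OF _ i, of "\<Theta> (f s)"] p\<Phi>[OF _ i, of "\<Theta> (g s)"] sV V(4) inv by auto
        moreover have "p (g s) = p (f s)" using fg sV by simp
        ultimately show "cmap b (p ((\<Phi> \<circ> \<omega>) y)) i = cmap b (p (f (y(l := 0)))) i"
          using p\<Phi>[OF w i] by (simp add: \<omega>_def s_def[symmetric] algebra_simps)
      qed
    qed
    moreover have "r \<in> O2" "O2 \<subseteq> O'" using r by (auto simp: O2_def)
    ultimately show ?thesis using O2 T h unfolding fiber_homotopic_def
      by (intro exI[of _ O2] exI[of _ T] exI[of _ "\<Phi> \<circ> \<omega>"] conjI ballI allI impI; simp)
  qed
  show ?thesis
    by (intro exI[of _ V] conjI allI impI V(1,2)) (rule main; assumption)
qed

text \<open>The homotopy moves inside fibers of \<open>p0\<close>, hence its image under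
  \<open>p1\<close> stays in a leaf while time varies. Leafwise invariance in the time coordinate
  then makes the coefficients of the pullback constant in t. The two ends are pullbacks along s
  \<mapsto> \<open>s(l := t)\<close>, whose differential is the inclusion, so the argument list
  \<open>vs\<close> does not change.\<close>

lemma homotopy_invariance:
  assumes M: "smooth_manifold M" and N1: "smooth_manifold N1" and p1: "smooth_map M N1 p1"
    and \<beta>: "\<beta> \<in> mforms N1 k" "leafwise_invariant N1 F1 \<beta>"
    and leaf: "\<And>x y. x \<in> mpts M \<Longrightarrow> y \<in> mpts M \<Longrightarrow> p0 x = p0 y \<Longrightarrow> leaf_of F1 (p1 x) = leaf_of F1 (p1 y)"
    and T: "opn (Suc l) T" "smooth_into (Suc l) T M h" and O2: "opn l O2" "r \<in> O2"
    and hT: "\<And>t. 0 \<le> t \<Longrightarrow> t \<le> 1 \<Longrightarrow> r(l := t) \<in> T" "\<And>s. s \<in> O2 \<Longrightarrow> s(l := 0) \<in> T \<and> s(l := 1) \<in> T"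
    and ph: "\<And>y t. y \<in> T \<Longrightarrow> y(l := t) \<in> T \<Longrightarrow> p0 (h (y(l := t))) = p0 (h y)"
  shows "mpull N1 l O2 (\<lambda>s. p1 (h (s(l := 0)))) \<beta> r vs = mpull N1 l O2 (\<lambda>s. p1 (h (s(l := 1)))) \<beta> r vs"
proof (cases "set vs \<subseteq> cart l")
  case True
  define H where "H y = p1 (h y)" for y
  have H: "smooth_into (Suc l) T N1 H" unfolding H_def by (rule smooth_map_compose[OF M p1 T])
  define \<gamma> where "\<gamma> = mpull N1 (Suc l) T H \<beta>"
  have \<gamma>: "\<gamma> \<in> lforms k (Suc l) T" unfolding \<gamma>_def by (rule mpull_lforms[OF N1 T(1) H \<beta>(1)])
  have vs: "set vs \<subseteq> cart (Suc l)" using True by (auto simp: cart_iff)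
  have "\<forall>y\<in>T. \<forall>t. y(l := t) \<in> T \<longrightarrow> leaf_of F1 (H (y(l := t))) = leaf_of F1 (H y)"
    unfolding H_def using leaf ph smooth_into_mpts[OF T(2)] by blast
  then have p0: "partial l (\<lambda>y. \<gamma> y vs) y = 0" if "y \<in> T" for y
    using \<beta>(2) T(1) H that vs unfolding leafwise_invariant_def \<gamma>_def by blast
  have "((\<lambda>t. \<gamma> (r(l := t)) vs) has_real_derivative 0) (at t)" if "0 \<le> t" "t \<le> 1" for t
    using smooth_fun_has_partial[OF T(1) lforms_smooth[OF \<gamma> T(1)] _ hT(1)[OF that], of l vs]
      p0[OF hT(1)[OF that]] by simp
  then obtain s :: real where "\<gamma> (r(l := 1)) vs - \<gamma> (r(l := 0)) vs = (1 - 0) * 0"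
    using mvt_unordered[of 0 1 "\<lambda>t. \<gamma> (r(l := t)) vs" "\<lambda>_. 0"] by auto
  then have eq: "\<gamma> (r(l := 0)) vs = \<gamma> (r(l := 1)) vs" by simp
  have "mpull N1 l O2 (\<lambda>s. p1 (h (s(l := t)))) \<beta> r vs = \<gamma> (r(l := t)) vs" if "t = 0 \<or> t = 1" for t
  proof -
    have sub: "(\<lambda>s. s(l := t)) ` O2 \<subseteq> T" using hT(2) that by auto
    have "mpull N1 l O2 (H \<circ> (\<lambda>s. s(l := t))) \<beta> = lpull l O2 (Suc l) (\<lambda>s. s(l := t)) \<gamma>"
      unfolding \<gamma>_def by (rule mpull_compose[OF N1 T(1) H \<beta>(1) O2(1) smooth_cart_append(1)[OF O2(1)] sub])
    moreover have "map (jac l (Suc l) (\<lambda>s. s(l := t)) r) vs = vs"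
      using True smooth_cart_append(2)[OF O2(1)] by (intro map_idI) auto
    ultimately show ?thesis using True O2(2) by (simp add: lpull_apply H_def comp_def)
  qed
  then show ?thesis using eq by simp
qed (simp add: mpull_outside)

text \<open>The values f r and g r may be far apart in the fiber, so a single homotopy in one normal
  form need not join the maps. Instead the pulled back value is followed through all points of the
  fiber: through each of them there is a local lift, nearby lifts are homotopic, and the fiber is
  connected.\<close>

lemma mpull_eq_of_same_fiber:
  assumes M: "smooth_manifold M" and N: "smooth_manifold N0" "smooth_manifold N1"
    and p0: "surj_submersion_conn M N0 p0" and p1: "smooth_map M N1 p1"
    and \<beta>: "\<beta> \<in> mforms N1 k" "leafwise_invariant N1 F1 \<beta>"
    and leaf: "\<And>x y. x \<in> mpts M \<Longrightarrow> y \<in> mpts M \<Longrightarrow> p0 x = p0 y \<Longrightarrow> leaf_of F1 (p1 x) = leaf_of F1 (p1 y)"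
    and O: "opn l O'" and f: "smooth_into l O' M f" and g: "smooth_into l O' M g"
    and fg: "\<And>s. s \<in> O' \<Longrightarrow> p0 (f s) = p0 (g s)" and r: "r \<in> O'"
  shows "mpull N1 l O' (\<lambda>s. p1 (f s)) \<beta> r vs = mpull N1 l O' (\<lambda>s. p1 (g s)) \<beta> r vs"
proof -
  have sub: "submersion M N0 p0" and conn: "\<And>y. y \<in> mpts N0 \<Longrightarrow> connectedin (mtop M) {x \<in> mpts M. p0 x = y}"
    using p0 by (auto simp: surj_submersion_conn_def)
  have p0s: "smooth_map M N0 p0" using sub by (simp add: submersion_def)
  have p0f: "smooth_into l O' N0 (\<lambda>s. p0 (f s))" by (rule smooth_map_compose[OF M p0s O f])
  define A where "A = {x \<in> mpts M. p0 x = p0 (f r)}"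
  have A: "connectedin (mtop M) A"
    unfolding A_def by (rule conn[OF smooth_into_mpts[OF p0f r]])
  \<comment> \<open>With r and vs fixed, \<open>val\<close> is a value obtained from some local
    lift, along \<open>p0\<close>, of the map s \<mapsto> p0 (f s) that passes through x at
    r.\<close>
  define R where "R x val \<longleftrightarrow> (\<exists>W q. opn l W \<and> r \<in> W \<and> W \<subseteq> O' \<and> smooth_into l W M q \<and>
    (\<forall>s\<in>W. p0 (q s) = p0 (f s)) \<and> q r = x \<and> mpull N1 l W (\<lambda>s. p1 (q s)) \<beta> r vs = val)" for x val
  have ex: "\<exists>val. R x val" if "x \<in> A" for x
    using submersion_lift[OF M N(1) sub O p0f r, of x] that unfolding R_def A_def by blast
  \<comment> \<open>Local constancy of the value. The case x' = x'' also shows that the value at a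
    point does not depend on the lift.\<close>
  have loc: "\<exists>V. openin (mtop M) V \<and> x \<in> V \<and> (\<forall>x'\<in>V. \<forall>x''\<in>V. \<forall>v' v''. R x' v' \<longrightarrow> R x'' v'' \<longrightarrow> v' = v'')"
    if xA: "x \<in> A" for x
  proof -
    have "x \<in> mpts M" using xA by (simp add: A_def)
    from submersion_homotopy[OF M N(1) sub this] obtain V where V: "openin (mtop M) V" "x \<in> V"
      and hom': "\<forall>l O' f g r. opn l O' \<longrightarrow> smooth_into l O' M f \<longrightarrow>
        smooth_into l O' M g \<longrightarrow> (\<forall>s\<in>O'. p0 (f s) = p0 (g s)) \<longrightarrow> r \<in> O' \<longrightarrow> f r \<in> V \<longrightarrow> g r \<in> V \<longrightarrow>
        fiber_homotopic M p0 l O' f g r"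
      by (elim exE conjE) (rule that; assumption)
    note hom = hom'[THEN spec, THEN spec, THEN spec, THEN spec, THEN spec, THEN mp, THEN mp, THEN mp, THEN mp, THEN mp, THEN mp, THEN mp]
    have "v' = v''" if x': "x' \<in> V" "R x' v'" and x'': "x'' \<in> V" "R x'' v''" for x' x'' v' v''
    proof -
      obtain W' q' where W': "opn l W'" "r \<in> W'" "W' \<subseteq> O'" "smooth_into l W' M q'"
        "\<And>s. s \<in> W' \<Longrightarrow> p0 (q' s) = p0 (f s)" "q' r = x'" "mpull N1 l W' (\<lambda>s. p1 (q' s)) \<beta> r vs = v'"
        using x'(2) unfolding R_def by blast
      obtain W'' q'' where W'': "opn l W''" "r \<in> W''" "W'' \<subseteq> O'" "smooth_into l W'' M q''"
        "\<And>s. s \<in> W'' \<Longrightarrow> p0 (q'' s) = p0 (f s)" "q'' r = x''" "mpull N1 l W'' (\<lambda>s. p1 (q'' s)) \<beta> r vs = v''"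
        using x''(2) unfolding R_def by blast
      define W where "W = W' \<inter> W''"
      have W: "opn l W" "W \<subseteq> W'" "W \<subseteq> W''" "r \<in> W" using W' W'' by (auto simp: W_def)
      have q': "smooth_into l W M q'" by (rule smooth_into_subset[OF W'(4,1) W(1,2)])
      have q'': "smooth_into l W M q''" by (rule smooth_into_subset[OF W''(4,1) W(1,3)])
      have "\<forall>s\<in>W. p0 (q' s) = p0 (q'' s)" using W'(5) W''(5) by (simp add: W_def)
      from hom[OF W(1) q' q'' this W(4)] x'(1) x''(1) W'(6) W''(6)
      have "fiber_homotopic M p0 l W q' q'' r" by simp
      then obtain O2 T h where O2: "opn l O2" "r \<in> O2" "O2 \<subseteq> W" and T: "opn (Suc l) T" "smooth_into (Suc l) T M h"
        and hT': "\<forall>s\<in>O2. \<forall>t. 0 \<le> t \<longrightarrow> t \<le> 1 \<longrightarrow> s(l := t) \<in> T"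
        and h': "\<forall>s\<in>O2. h (s(l := 0)) = q' s \<and> h (s(l := 1)) = q'' s"
        and ph': "\<forall>y\<in>T. y(l := 0) \<in> O2 \<and> p0 (h y) = p0 (q' (y(l := 0)))"
        unfolding fiber_homotopic_def by (elim exE conjE) (rule that; assumption)
      have hT: "s(l := t) \<in> T" if "s \<in> O2" "0 \<le> t" "t \<le> 1" for s t using hT' that by blast
      have h: "h (s(l := 0)) = q' s" "h (s(l := 1)) = q'' s" if "s \<in> O2" for s using h' that by auto
      have ph: "p0 (h y) = p0 (q' (y(l := 0)))" if "y \<in> T" for y using ph' that by blast
      have p1q: "smooth_into l V M q \<Longrightarrow> opn l V \<Longrightarrow> smooth_into l V N1 (\<lambda>s. p1 (q s))" for V q
        using smooth_map_compose[OF M p1] by blast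
      have O2W: "O2 \<subseteq> W'" "O2 \<subseteq> W''" using O2(3) W by auto
      have hs: "smooth_into l O2 N1 (\<lambda>s. p1 (h (s(l := 0))))"
        by (rule smooth_into_cong[OF p1q[OF smooth_into_subset[OF W'(4,1) O2(1) O2W(1)] O2(1)]]) (simp add: h)
      have hs': "smooth_into l O2 N1 (\<lambda>s. p1 (h (s(l := 1))))"
        by (rule smooth_into_cong[OF p1q[OF smooth_into_subset[OF W''(4,1) O2(1) O2W(2)] O2(1)]]) (simp add: h)
      have "v' = mpull N1 l O2 (\<lambda>s. p1 (h (s(l := 0)))) \<beta> r vs"
        unfolding W'(7)[symmetric]
        by (rule mpull_cong[OF N(2) W'(1) O2(1) p1q[OF W'(4,1)] hs \<beta>(1) O2(1) O2W(1) order_refl O2(2)])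
          (simp add: h)
      also have "\<dots> = mpull N1 l O2 (\<lambda>s. p1 (h (s(l := 1)))) \<beta> r vs"
        by (rule homotopy_invariance[where ?p0.0 = p0, OF M N(2) p1 \<beta> leaf T O2(1,2)]) (use hT[OF O2(2)] hT ph in \<open>simp_all\<close>)
      also have "\<dots> = v''"
        unfolding W''(7)[symmetric]
        by (rule mpull_cong[OF N(2) O2(1) W''(1) hs' p1q[OF W''(4,1)] \<beta>(1) O2(1) order_refl O2W(2) O2(2)])
          (simp add: h)
      finally show ?thesis .
    qed
    then show ?thesis using V by blast
  qed
  define val where "val = mpull N1 l O' (\<lambda>s. p1 (f s)) \<beta> r vs"
  have Rf: "R (f r) val" unfolding R_def val_def using O f r by blast
  have Rg: "R (g r) (mpull N1 l O' (\<lambda>s. p1 (g s)) \<beta> r vs)"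
    unfolding R_def using O g r fg by (metis order_refl)
  define Q where "Q V \<longleftrightarrow> (\<forall>x'\<in>V. \<forall>x''\<in>V. \<forall>v' v''. R x' v' \<longrightarrow> R x'' v'' \<longrightarrow> v' = v'')" for V
  have "\<forall>x\<in>A. \<exists>V. openin (mtop M) V \<and> x \<in> V \<and> Q V" unfolding Q_def using loc by blast
  from bchoice[OF this] obtain V where V': "\<forall>x\<in>A. openin (mtop M) (V x) \<and> x \<in> V x \<and> Q (V x)" by (elim exE)
  have V: "openin (mtop M) (V x)" "x \<in> V x" if "x \<in> A" for x using V' that by auto
  have VQ: "v' = v''" if "x \<in> A" "x' \<in> V x" "x'' \<in> V x" "R x' v'" "R x'' v''" for x x' x'' v' v''
  proof -
    have "Q (V x)" using V' that(1) by blast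
    then show ?thesis using that(2-) unfolding Q_def by blast
  qed
  \<comment> \<open>If the value changed along the fiber, these two open sets would separate
    it.\<close>
  define E1 where "E1 = \<Union> (V ` {x \<in> A. R x val})"
  define E2 where "E2 = \<Union> (V ` {x \<in> A. \<not> R x val})"
  have "openin (mtop M) E1" "openin (mtop M) E2" unfolding E1_def E2_def using V(1) by auto
  moreover have "A \<subseteq> E1 \<union> E2" unfolding E1_def E2_def using V(2) by blast
  moreover have "E1 \<inter> E2 \<inter> A = {}"
  proof -
    have False if z: "z \<in> A" and x: "x \<in> A" "R x val" "z \<in> V x" and y: "y \<in> A" "\<not> R y val" "z \<in> V y" for x y z
    proof -
      obtain vz where vz: "R z vz" using ex[OF z] by blast
      obtain vy where vy: "R y vy" using ex[OF y(1)] by blast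
      have "vz = val" by (rule VQ[OF x(1,3) V(2)[OF x(1)] vz x(2)])
      moreover have "vy = vz" by (rule VQ[OF y(1) V(2)[OF y(1)] y(3) vy vz])
      ultimately show False using vy y(2) by simp
    qed
    then show ?thesis unfolding E1_def E2_def by blast
  qed
  moreover have fA: "f r \<in> A" "g r \<in> A"
    using smooth_into_mpts[OF f r] smooth_into_mpts[OF g r] fg[OF r] by (auto simp: A_def)
  then have "E1 \<inter> A \<noteq> {}" unfolding E1_def using Rf V(2) by blast
  ultimately have "E2 \<inter> A = {}" using A unfolding connectedin by blast
  then have "R (g r) val" using fA(2) V(2) unfolding E2_def by blast
  from VQ[OF fA(2) V(2) V(2) this Rg] fA(2) show ?thesis unfolding val_def by blast
qed

section \<open>Tangent spaces of the leaves\<close>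

text \<open>Each step eliminates one equation together with one pivot unknown. This supplies the
  dimension count in \<open>jac_inj_imp_surj\<close>.\<close>

lemma homogeneous_system_nontrivial:
  fixes A :: "nat \<Rightarrow> 'j \<Rightarrow> real"
  assumes "finite J" "m < card J"
  shows "\<exists>x. (\<exists>j\<in>J. x j \<noteq> 0) \<and> (\<forall>i<m. (\<Sum>j\<in>J. A i j * x j) = 0)"
  using assms
proof (induction m arbitrary: A J)
  case 0
  then have "J \<noteq> {}" by auto
  then show ?case by (intro exI[of _ "\<lambda>_. 1"]) auto
next
  case (Suc m)
  show ?case
  proof (cases "\<forall>j\<in>J. A m j = 0")
    case True
    obtain x where "\<exists>j\<in>J. x j \<noteq> 0" "\<forall>i<m. (\<Sum>j\<in>J. A i j * x j) = 0"
      using Suc.IH[of J A] Suc.prems by auto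
    then show ?thesis using True by (intro exI[of _ x]) (auto simp: less_Suc_eq)
  next
    case False
    then obtain p where p: "p \<in> J" "A m p \<noteq> 0" by blast
    define J' where "J' = J - {p}"
    define A' where "A' i j = A i j - A i p * A m j / A m p" for i j
    have "finite J'" "m < card J'" using Suc.prems p by (auto simp: J'_def card_Diff_singleton_if)
    from Suc.IH[OF this, of A'] obtain y where y: "\<exists>j\<in>J'. y j \<noteq> 0" "\<forall>i<m. (\<Sum>j\<in>J'. A' i j * y j) = 0" by blast
    define x where "x = y(p := - (\<Sum>j\<in>J'. A m j * y j) / A m p)"
    have xy: "(\<Sum>j\<in>J'. A i j * x j) = (\<Sum>j\<in>J'. A i j * y j)" for i
      by (intro sum.cong) (auto simp: x_def J'_def)
    have split: "(\<Sum>j\<in>J. A i j * x j) = A i p * x p + (\<Sum>j\<in>J'. A i j * y j)" for i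
      unfolding J'_def xy[symmetric, unfolded J'_def] using Suc.prems(1) p(1) by (rule sum.remove)
    have "(\<Sum>j\<in>J. A i j * x j) = 0" if i: "i < Suc m" for i
    proof (cases "i = m")
      case True
      then show ?thesis using split[of m] p(2) by (simp add: x_def)
    next
      case False
      then have "0 = (\<Sum>j\<in>J'. A' i j * y j)" using y(2) i by simp
      also have "\<dots> = (\<Sum>j\<in>J'. A i j * y j - A i p / A m p * (A m j * y j))"
        by (intro sum.cong) (auto simp: A'_def algebra_simps)
      also have "\<dots> = (\<Sum>j\<in>J'. A i j * y j) - A i p / A m p * (\<Sum>j\<in>J'. A m j * y j)"
        by (simp add: sum_subtractf sum_distrib_left)
      finally show ?thesis using split[of i] by (simp add: x_def)
    qed
    moreover have "\<exists>j\<in>J. x j \<noteq> 0" using y(1) by (auto simp: x_def J'_def)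
    ultimately show ?thesis by blast
  qed
qed

text \<open>Append -u as an additional column. The k equations in k + 1 unknowns have a nontrivial
  solution, injectivity makes its last entry nonzero, and division by that entry gives a preimage of
  u.\<close>

lemma jac_inj_imp_surj:
  assumes inj: "\<And>a. a \<in> cart k \<Longrightarrow> jac k k h x a = (\<lambda>_. 0) \<Longrightarrow> a = (\<lambda>_. 0)" and u: "u \<in> cart k"
  shows "\<exists>a\<in>cart k. jac k k h x a = u"
proof -
  define A where "A i j = (if j < k then partial j (\<lambda>y. h y i) x else - u i)" for i j
  obtain y where y: "\<exists>j\<in>{..<Suc k}. y j \<noteq> 0" "\<forall>i<k. (\<Sum>j<Suc k. A i j * y j) = 0"
    using homogeneous_system_nontrivial[of "{..<Suc k}" k A] by auto
  define a where "a j = (if j < k then y j else 0)" for j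
  have ac: "a \<in> cart k" by (simp add: a_def cart_iff)
  have eq: "jac k k h x a i = u i * y k" for i
  proof (cases "i < k")
    case True
    have "(\<Sum>j<k. A i j * y j) = (\<Sum>j<k. a j * partial j (\<lambda>y. h y i) x)"
      by (intro sum.cong) (auto simp: A_def a_def)
    then show ?thesis using y(2) True by (simp add: jac_def dir_deriv_def A_def)
  qed (use u in \<open>simp add: jac_def cart_iff\<close>)
  have yk: "y k \<noteq> 0"
  proof
    assume "y k = 0"
    then have "jac k k h x a = (\<lambda>_. 0)" using eq by auto
    then have "a = (\<lambda>_. 0)" by (rule inj[OF ac])
    then have "y j = 0" if "j < Suc k" for j
      using \<open>y k = 0\<close> that by (cases "j = k") (auto simp: a_def dest!: fun_cong[of _ _ j] split: if_splits)
    then show False using y(1) by auto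
  qed
  have "jac k k h x (\<lambda>j. inverse (y k) * a j + 0 * a j) = u"
    unfolding jac_linear using eq yk by (auto simp: fun_eq_iff)
  then show ?thesis using lincomb_cart[OF ac ac, of "inverse (y k)" 0] by blast
qed

section \<open>Leaves as manifolds and foliation charts\<close>

lemma leaf_structure:
  assumes "singular_foliation N F" "L \<in> F"
  shows "smooth_manifold (submfd N L)" "mpts (submfd N L) = L"
    "manifold_plots (submfd N L) = subspace_plots (manifold_plots N) L"
proof -
  have "\<exists>K. submanifold_structure N L K"
    using assms by (auto simp: singular_foliation_def weakly_embedded_def diffeological_submanifold_def)
  then have "submanifold_structure N L (submfd N L)" unfolding submfd_def by (rule someI_ex)
  then show "smooth_manifold (submfd N L)" "mpts (submfd N L) = L"
    "manifold_plots (submfd N L) = subspace_plots (manifold_plots N) L"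
    by (auto simp: submanifold_structure_def)
qed

lemma singular_foliation_partition: "singular_foliation N F \<Longrightarrow> partition_on (mpts N) F"
  by (simp add: singular_foliation_def)

text \<open>The defining property of a diffeological submanifold, freed from the convention that
  plots are undefined off their domain.\<close>

lemma smooth_into_leaf_iff:
  assumes F: "singular_foliation N F" "L \<in> F" and O: "opn n O'"
  shows "smooth_into n O' (submfd N L) f \<longleftrightarrow> smooth_into n O' N f \<and> f ` O' \<subseteq> L"
proof -
  have r: "smooth_into n O' K f \<longleftrightarrow> (n, O', restrict f O') \<in> manifold_plots K" for K :: "'a manifold"
    using O smooth_into_cong[of n O' K f "restrict f O'"] smooth_into_cong[of n O' K "restrict f O'" f]
    by (auto simp: manifold_plots_def)
  show ?thesis unfolding r leaf_structure(3)[OF F] by (auto simp: subspace_plots_def)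
qed

text \<open>A smooth map with values in one leaf is smooth into that leaf, so its differential
  factors through the differential of the inclusion. This is how velocities become tangent vectors
  of leaves.\<close>

lemma jac_through_leaf:
  assumes N: "smooth_manifold N" and F: "singular_foliation N F" "L \<in> F"
    and O: "opn m O'" and f: "smooth_into m O' N f" "f ` O' \<subseteq> L" and x: "x \<in> O'"
    and b: "b \<in> atlas (submfd N L)" "f x \<in> cdom b" and c: "c \<in> atlas N" "f x \<in> cdom c"
  shows "jac m (mdim N) (cmap c \<circ> f) x v =
    diff_in_charts (submfd N L) N (\<lambda>y. y) b c (f x) (jac m (mdim (submfd N L)) (cmap b \<circ> f) x v)"
proof -
  define K where "K = submfd N L"
  note K = leaf_structure[OF F, folded K_def]
  have fK: "smooth_into m O' K f" using smooth_into_leaf_iff[OF F O] f by (simp add: K_def)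
  have bN: "smooth_into (mdim K) (cimg b) N (cinv b)"
    using smooth_into_leaf_iff[OF F manifold_chart(3)[OF K(1)]] smooth_into_cinv[OF K(1)] b by (simp add: K_def)
  define E where "E = {z \<in> cimg b. cinv b z \<in> cdom c}"
  have bK: "b \<in> atlas K" using b by (simp add: K_def)
  note E = smooth_into_chart[OF N manifold_chart(3)[OF K(1) bK] bN c(1), folded E_def]
  define D where "D = {r \<in> O'. f r \<in> cdom b}"
  note D = smooth_into_chart[OF K(1) O fK bK, folded D_def]
  define T where "T = {r \<in> D. (cmap b \<circ> f) r \<in> E}"
  have T: "opn m T" unfolding T_def by (rule smooth_cart_preimage[OF D E(1)])
  have xT: "x \<in> T" using x b c cinv_cmap[OF K(1) bK] by (simp add: T_def D_def E_def)
  have "jac m (mdim N) (cmap c \<circ> f) x v = jac m (mdim N) ((cmap c \<circ> cinv b) \<circ> (cmap b \<circ> f)) x v"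
    by (rule jac_cong[OF T xT]) (simp add: T_def D_def cinv_cmap[OF K(1) bK])
  also have "\<dots> = jac (mdim K) (mdim N) (cmap c \<circ> cinv b) ((cmap b \<circ> f) x) (jac m (mdim K) (cmap b \<circ> f) x v)"
    by (rule jac_compose[OF T E(1) _ smooth_cart_subset[OF D(2,1) T] E(2) xT]) (auto simp: T_def)
  finally show ?thesis by (simp add: diff_in_charts_def K_def comp_def)
qed

text \<open>The product condition is restated without the transverse factor: the first k coordinates
  can be moved freely in \<open>U\<close> without leaving the chart image or the leaf.\<close>

lemma foliation_chart_facts:
  assumes N: "smooth_manifold N" and F: "singular_foliation N F" and c: "foliation_chart N F x c"
    and k: "k = mdim (submfd N (leaf_of F x))"
  obtains U where "opn k U" "(\<lambda>_. 0) \<in> U" "k \<le> mdim N" "c \<in> atlas N" "x \<in> cdom c" "cmap c x = (\<lambda>_. 0)"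
    "\<forall>z\<in>cimg c. (\<lambda>i. if i < k then z i else 0) \<in> U"
    "\<forall>z\<in>cimg c. \<forall>u\<in>U. (\<lambda>i. if i < k then u i else z i) \<in> cimg c \<and>
      leaf_of F (cinv c (\<lambda>i. if i < k then u i else z i)) = leaf_of F (cinv c z)"
proof -
  define n where "n = mdim N"
  obtain U W where U: "opn k U" "(\<lambda>_. 0) \<in> U" and W: "opn (n - k) W" "(\<lambda>_. 0) \<in> W"
    and c1: "c \<in> atlas N" "x \<in> cdom c" "cimg c = cart_prod k U W" "cmap c x = (\<lambda>_. 0)"
    and lf: "\<forall>L\<in>F. \<exists>l\<subseteq>W. cmap c ` (L \<inter> cdom c) = cart_prod k U l"
    using c unfolding foliation_chart_def Let_def k n_def by blast
  note P = singular_foliation_partition[OF F]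
  have Uc: "U \<subseteq> cart k" by (rule opn_subset[OF U(1)])
  have cn: "cimg c \<subseteq> cart n" using opn_subset[OF manifold_chart(3)[OF N c1(1)]] by (simp add: n_def)
  \<comment> \<open>The truncated subtraction in the definition does not by itself exclude k > n. In
    that case, however, \<open>U\<close> would contain a point whose entry with index n is nonzero,
    and the chart image would leave \<open>cart n\<close>.\<close>
  have "k \<le> n"
  proof (rule ccontr)
    assume "\<not> k \<le> n"
    then have nk: "n < k" by simp
    obtain e where e: "e > 0" "nbox k (\<lambda>_. 0) e \<subseteq> U" using opn_contains_nbox[OF U] by blast
    define u where "u = (\<lambda>i. if i = n then e / 2 else 0)"
    have "u \<in> nbox k (\<lambda>_. 0) e" using e nk by (auto simp: nbox_def cart_iff u_def)
    then have "(\<lambda>i. if i < k then u i else 0) \<in> cimg c"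
      using e(2) W(2) unfolding c1(3) cart_prod_def
      by (intro CollectI exI[of _ u] exI[of _ "\<lambda>_. 0"]) auto
    then have "(\<lambda>i. if i < k then u i else 0) \<in> cart n" using cn by blast
    then show False using nk e(1) by (auto simp: cart_iff u_def dest!: spec[of _ n])
  qed
  moreover have "(\<lambda>i. if i < k then z i else 0) \<in> U" if zc: "z \<in> cimg c" for z
  proof -
    obtain u w where z: "z = (\<lambda>i. if i < k then u i else w (i - k))" "u \<in> U"
      using zc unfolding c1(3) cart_prod_def by blast
    have "(\<lambda>i. if i < k then z i else 0) = u"
      using z Uc by (auto simp: fun_eq_iff cart_iff subset_iff)
    then show ?thesis using z by simp
  qed
  moreover have "(\<lambda>i. if i < k then u i else z i) \<in> cimg c \<and>
      leaf_of F (cinv c (\<lambda>i. if i < k then u i else z i)) = leaf_of F (cinv c z)"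
    if z: "z \<in> cimg c" and u: "u \<in> U" for z u
  proof -
    define L where "L = leaf_of F (cinv c z)"
    define z' where "z' = (\<lambda>i. if i < k then u i else z i)"
    have y: "cinv c z \<in> cdom c" "cmap c (cinv c z) = z"
      using cinv_cdom[OF z] cmap_cinv[OF z] by auto
    then have "cinv c z \<in> mpts N" using manifold_chart(1)[OF N c1(1)] by blast
    then have L: "L \<in> F" "cinv c z \<in> L" using leaf_of_in[OF P] by (auto simp: L_def)
    obtain l where l: "l \<subseteq> W" "cmap c ` (L \<inter> cdom c) = cart_prod k U l" using lf L(1) by blast
    have "z \<in> cart_prod k U l" unfolding l(2)[symmetric] using L(2) y by (metis IntI image_eqI)
    then obtain u2 w2 where "z = (\<lambda>i. if i < k then u2 i else w2 (i - k))" "w2 \<in> l"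
      unfolding cart_prod_def by blast
    then have "z' = (\<lambda>i. if i < k then u i else w2 (i - k))" "w2 \<in> l" by (auto simp: z'_def fun_eq_iff)
    then have "z' \<in> cart_prod k U l" using u unfolding cart_prod_def by blast
    then obtain y' where y': "y' \<in> L" "y' \<in> cdom c" "z' = cmap c y'" unfolding l(2)[symmetric] by blast
    then have "cinv c z' = y'" using cinv_cmap[OF N c1(1)] by simp
    then show ?thesis using y' leaf_of_eq[OF P L(1) y'(1)] by (auto simp: z'_def L_def)
  qed
  ultimately show thesis using that[of U] U c1 by (simp add: n_def)
qed

lemma smooth_cart_replace_head:
  assumes "opn k U" "k \<le> n" "z \<in> cart n"
  shows "smooth_cart k U n (\<lambda>u i. if i < k then u i else z i)"
    and "a \<in> cart k \<Longrightarrow> jac k n (\<lambda>u i. if i < k then u i else z i) u a = a"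
proof -
  show "smooth_cart k U n (\<lambda>u i. if i < k then u i else z i)"
    unfolding smooth_cart_def
  proof (intro conjI allI impI)
    show "(\<lambda>u i. if i < k then u i else z i) ` U \<subseteq> cart n"
      using assms(2,3) by (auto simp: cart_iff)
    show "smooth_fun k U (\<lambda>u. if i < k then u i else z i)" for i
      by (cases "i < k") (simp_all add: smooth_fun_coord smooth_fun_const assms(1))
  qed
  assume a: "a \<in> cart k"
  show "jac k n (\<lambda>u i. if i < k then u i else z i) u a = a"
  proof (rule cart_eqI[of _ n])
    show "a \<in> cart n" using a cart_mono[OF assms(2)] by blast
    fix i assume "i < n"
    then show "jac k n (\<lambda>u i. if i < k then u i else z i) u a i = a i"
      using a by (cases "i < k") (simp_all add: jac_def dir_deriv_coord cart_iff)
  qed simp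
qed

text \<open>Through any y in the chart, moving the first k coordinates is a smooth map into the leaf
  of y; \<open>h\<close> is this map read in the leaf chart b. The conclusion thus gives a right
  inverse, on \<open>cart k\<close>, of the differential of the inclusion. It is stated as a
  Jacobian so that at the centre the dimension count can be applied to it.\<close>

lemma leaf_slice:
  assumes N: "smooth_manifold N" and F: "singular_foliation N F" and c: "c \<in> atlas N"
    and U: "opn k U" "k \<le> mdim N"
    and slice: "\<forall>z\<in>cimg c. \<forall>u\<in>U. (\<lambda>i. if i < k then u i else z i) \<in> cimg c \<and>
      leaf_of F (cinv c (\<lambda>i. if i < k then u i else z i)) = leaf_of F (cinv c z)"
    and y: "y \<in> cdom c" "(\<lambda>i. if i < k then cmap c y i else 0) \<in> U"
    and b: "b \<in> atlas (submfd N (leaf_of F y))" "y \<in> cdom b"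
  shows "\<exists>h. \<forall>a\<in>cart k. diff_in_charts (submfd N (leaf_of F y)) N (\<lambda>y. y) b c y
    (jac k (mdim (submfd N (leaf_of F y))) h (\<lambda>i. if i < k then cmap c y i else 0) a) = a"
proof -
  note P = singular_foliation_partition[OF F]
  define z u0 where "z = cmap c y" and "u0 = (\<lambda>i. if i < k then cmap c y i else 0)"
  have z: "z \<in> cimg c" using y by (auto simp: z_def)
  have cz: "cinv c z = y" using cinv_cmap[OF N c y(1)] by (simp add: z_def)
  have zc: "z \<in> cart (mdim N)" using z opn_subset[OF manifold_chart(3)[OF N c]] by blast
  have yN: "y \<in> mpts N" using y manifold_chart(1)[OF N c] by blast
  have L: "leaf_of F y \<in> F" using leaf_of_in[OF P yN] by blast
  define \<tau> where "\<tau> = (\<lambda>u i. if i < k then u i else z i)"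
  note \<tau> = smooth_cart_replace_head[OF U zc, folded \<tau>_def]
  have \<tau>c: "\<tau> ` U \<subseteq> cimg c" using bspec[OF slice z] unfolding \<tau>_def by blast
  define q where "q u = cinv c (\<tau> u)" for u
  have q: "smooth_into k U N q" unfolding q_def by (rule smooth_into_cinv_comp[OF N c U(1) \<tau>(1) \<tau>c])
  have "q u \<in> leaf_of F y" if "u \<in> U" for u
  proof -
    have "leaf_of F (q u) = leaf_of F y"
      using bspec[OF bspec[OF slice z] that] cz by (simp add: q_def \<tau>_def)
    then show ?thesis using leaf_of_in[OF P smooth_into_mpts[OF q that]] by simp
  qed
  then have qL: "q ` U \<subseteq> leaf_of F y" by blast
  have "\<tau> u0 = z" by (auto simp: \<tau>_def u0_def z_def)
  then have qu: "q u0 = y" using cz by (simp add: q_def)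
  have u0U: "u0 \<in> U" using y by (simp add: u0_def)
  have "diff_in_charts (submfd N (leaf_of F y)) N (\<lambda>y. y) b c y
      (jac k (mdim (submfd N (leaf_of F y))) (cmap b \<circ> q) u0 a) = a" if a: "a \<in> cart k" for a
  proof -
    have "a = jac k (mdim N) \<tau> u0 a" using \<tau>(2)[OF a] by simp
    also have "\<dots> = jac k (mdim N) (cmap c \<circ> q) u0 a"
    proof (rule jac_cong[OF U(1) u0U])
      fix u assume "u \<in> U"
      then have "\<tau> u \<in> cimg c" using \<tau>c by blast
      then show "\<tau> u = (cmap c \<circ> q) u" by (simp add: q_def cmap_cinv)
    qed
    also have "\<dots> = diff_in_charts (submfd N (leaf_of F y)) N (\<lambda>y. y) b c y
        (jac k (mdim (submfd N (leaf_of F y))) (cmap b \<circ> q) u0 a)"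
      using jac_through_leaf[OF N F L U(1) q qL u0U, of b c a] b c y qu by simp
    finally show ?thesis by simp
  qed
  then show ?thesis unfolding u0_def by blast
qed

text \<open>In a foliation chart at \<open>x\<close> the tangent space of the leaf at \<open>x\<close> is spanned by the first
  coordinates: it contains them, and the dimensions agree.\<close>

lemma leaf_velocity_in_head:
  assumes N: "smooth_manifold N" and F: "singular_foliation N F" and c: "foliation_chart N F x c"
    and k: "k = mdim (submfd N (leaf_of F x))"
    and b: "b \<in> atlas (submfd N (leaf_of F x))" "x \<in> cdom b" and v: "v \<in> cart k"
  shows "diff_in_charts (submfd N (leaf_of F x)) N (\<lambda>y. y) b c x v \<in> cart k"
proof -
  obtain U where U: "opn k U" "(\<lambda>_. 0) \<in> U" "k \<le> mdim N" and c1: "c \<in> atlas N" "x \<in> cdom c" "cmap c x = (\<lambda>_. 0)"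
    and slice: "\<forall>z\<in>cimg c. \<forall>u\<in>U. (\<lambda>i. if i < k then u i else z i) \<in> cimg c \<and>
      leaf_of F (cinv c (\<lambda>i. if i < k then u i else z i)) = leaf_of F (cinv c z)"
    by (rule foliation_chart_facts[OF N F c k]) (rule that; assumption)
  have x0: "(\<lambda>i. if i < k then cmap c x i else 0) = (\<lambda>_. 0)" using c1(3) by auto
  define d where "d = diff_in_charts (submfd N (leaf_of F x)) N (\<lambda>y. y) b c x"
  have d_lin: "d (\<lambda>_. 0) = (\<lambda>_. 0)"
    using jac_linear[of _ _ _ _ 0 "\<lambda>_. 0" 0 "\<lambda>_. 0"] unfolding d_def diff_in_charts_def by simp
  have "\<exists>h. \<forall>a\<in>cart k. d (jac k k h (\<lambda>_. 0) a) = a"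
    using leaf_slice[OF N F c1(1) U(1,3) slice c1(2) _ b] U(2) unfolding x0 d_def k[symmetric] by blast
  then obtain h where h: "\<And>a. a \<in> cart k \<Longrightarrow> d (jac k k h (\<lambda>_. 0) a) = a" by blast
  \<comment> \<open>\<open>d\<close> is a left inverse of the Jacobian of \<open>h\<close>, which is
    therefore injective. The leaf of x has dimension k, so the Jacobian is also surjective, and
    \<open>d\<close> maps v back to some a in \<open>cart k\<close>.\<close>
  have "\<exists>a\<in>cart k. jac k k h (\<lambda>_. 0) a = v"
  proof (rule jac_inj_imp_surj[OF _ v])
    fix a assume "a \<in> cart k" "jac k k h (\<lambda>_. 0) a = (\<lambda>_. 0)"
    then show "a = (\<lambda>_. 0)" using h[of a] d_lin by simp
  qed
  then obtain a where "a \<in> cart k" "jac k k h (\<lambda>_. 0) a = v" by blast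
  then show ?thesis using h[of a] by (simp add: d_def)
qed

lemma tangent_in_chart_head:
  assumes N: "smooth_manifold N" and F: "singular_foliation N F" and c: "foliation_chart N F x c"
    and v: "v \<in> tangent_in_chart (submfd N (leaf_of F x)) N c x"
  shows "v \<in> cart (mdim (submfd N (leaf_of F x)))"
proof -
  obtain b u where "b \<in> atlas (submfd N (leaf_of F x))" "x \<in> cdom b" "u \<in> cart (mdim (submfd N (leaf_of F x)))"
    "v = diff_in_charts (submfd N (leaf_of F x)) N (\<lambda>y. y) b c x u"
    using v unfolding tangent_in_chart_def by blast
  then show ?thesis using leaf_velocity_in_head[OF N F c refl] by blast
qed

text \<open>Only the line through x in direction j is known to be mapped into the leaf of f x. Hence
  f is first restricted to that line, which gives a one-dimensional plot of the leaf.\<close>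

lemma leaf_curve_velocity:
  assumes N: "smooth_manifold N" and F: "singular_foliation N F"
    and O: "opn m O'" and f: "smooth_into m O' N f" and x: "x \<in> O'" and j: "j < m"
    and leaf: "\<And>t. x(j := t) \<in> O' \<Longrightarrow> leaf_of F (f (x(j := t))) = leaf_of F (f x)"
    and c: "foliation_chart N F (f x) c"
  shows "jac m (mdim N) (cmap c \<circ> f) x (ebas j) \<in> cart (mdim (submfd N (leaf_of F (f x))))"
proof -
  define L where "L = leaf_of F (f x)"
  note P = singular_foliation_partition[OF F]
  have fx: "f x \<in> mpts N" by (rule smooth_into_mpts[OF f x])
  have L: "L \<in> F" "f x \<in> L" using leaf_of_in[OF P fx] by (auto simp: L_def)
  have xc: "x \<in> cart m" using x opn_subset[OF O] by blast
  define \<sigma> where "\<sigma> s = x(j := s 0)" for s :: vec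
  have \<sigma>1: "smooth_cart 1 (cart 1) m \<sigma>"
    unfolding smooth_cart_def
  proof (intro conjI allI impI)
    show "\<sigma> ` cart 1 \<subseteq> cart m" using cart_upd[OF xc j] by (auto simp: \<sigma>_def)
    show "smooth_fun 1 (cart 1) (\<lambda>s. \<sigma> s i)" for i
      by (cases "i = j") (simp_all add: \<sigma>_def smooth_fun_coord smooth_fun_const)
  qed
  define I where "I = {s \<in> cart 1. \<sigma> s \<in> O'}"
  have I: "opn 1 I" unfolding I_def by (rule smooth_cart_preimage[OF opn_cart \<sigma>1 O])
  have \<sigma>: "smooth_cart 1 I m \<sigma>" "\<sigma> ` I \<subseteq> O'"
    using smooth_cart_subset[OF \<sigma>1 opn_cart I] by (auto simp: I_def)
  define s0 :: vec where "s0 = (\<lambda>i. if i = 0 then x j else 0)"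
  have s0: "s0 \<in> I" "\<sigma> s0 = x" using x by (auto simp: s0_def I_def \<sigma>_def cart_iff)
  have fs: "smooth_into 1 I N (f \<circ> \<sigma>)" by (rule smooth_into_compose[OF f O I \<sigma>])
  have fL: "(f \<circ> \<sigma>) ` I \<subseteq> L"
  proof (intro image_subsetI)
    fix s assume s: "s \<in> I"
    then have "leaf_of F (f (\<sigma> s)) = L" using leaf[of "s 0"] by (simp add: I_def \<sigma>_def L_def)
    then show "(f \<circ> \<sigma>) s \<in> L" using leaf_of_in[OF P smooth_into_mpts[OF fs s]] by simp
  qed
  have c1: "c \<in> atlas N" "f x \<in> cdom c" using c by (auto simp: foliation_chart_def)
  obtain b where b: "b \<in> atlas (submfd N L)" "f x \<in> cdom b"
    using manifold_cover[OF leaf_structure(1)[OF F L(1)]] leaf_structure(2)[OF F L(1)] L(2) by blast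
  have js: "jac 1 m \<sigma> s0 (ebas 0) = ebas j"
  proof (rule cart_eqI[of _ m])
    fix i assume "i < m"
    then show "jac 1 m \<sigma> s0 (ebas 0) i = ebas j i"
      using dir_deriv_coord[of 0 1 s0 "ebas 0"]
      by (cases "i = j") (simp_all add: jac_def \<sigma>_def ebas_def)
  qed (use ebas_cart[OF j] in simp_all)
  define D where "D = {r \<in> O'. f r \<in> cdom c}"
  note D = smooth_into_chart[OF N O f c1(1), folded D_def]
  define J where "J = {s \<in> I. \<sigma> s \<in> D}"
  have J: "opn 1 J" unfolding J_def by (rule smooth_cart_preimage[OF I \<sigma>(1) D(1)])
  have "jac 1 (mdim N) (cmap c \<circ> f \<circ> \<sigma>) s0 (ebas 0) = jac m (mdim N) (cmap c \<circ> f) (\<sigma> s0) (jac 1 m \<sigma> s0 (ebas 0))"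
    by (rule jac_compose[OF J D(1) _ smooth_cart_subset[OF \<sigma>(1) I J] D(2)])
      (use s0 x c1(2) in \<open>auto simp: J_def D_def\<close>)
  then have "jac m (mdim N) (cmap c \<circ> f) x (ebas j) = jac 1 (mdim N) (cmap c \<circ> (f \<circ> \<sigma>)) s0 (ebas 0)"
    by (simp only: js s0(2) comp_assoc)
  also have "\<dots> = diff_in_charts (submfd N L) N (\<lambda>y. y) b c (f x)
      (jac 1 (mdim (submfd N L)) (cmap b \<circ> (f \<circ> \<sigma>)) s0 (ebas 0))"
    using jac_through_leaf[OF N F L(1) I fs fL s0(1), of b c "ebas 0"] b c1 s0(2) by simp
  also have "\<dots> \<in> cart (mdim (submfd N L))"
    unfolding L_def by (rule leaf_velocity_in_head[OF N F c refl]) (use b in \<open>simp_all add: L_def\<close>)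
  finally show ?thesis unfolding L_def .
qed

lemma tangent_in_chart_change:
  assumes N: "smooth_manifold N" and F: "singular_foliation N F" "L \<in> F"
    and c: "c \<in> atlas N" "c' \<in> atlas N" and y: "y \<in> cdom c" "y \<in> cdom c'"
    and v: "v \<in> tangent_in_chart (submfd N L) N c y"
  shows "jac (mdim N) (mdim N) (transition c c') (cmap c y) v \<in> tangent_in_chart (submfd N L) N c' y"
proof -
  define K where "K = submfd N L"
  note K = leaf_structure[OF F, folded K_def]
  obtain b u where b: "b \<in> atlas K" "y \<in> cdom b" "u \<in> cart (mdim K)"
    and v: "v = diff_in_charts K N (\<lambda>y. y) b c y u"
    using v unfolding tangent_in_chart_def K_def by blast
  have bo: "opn (mdim K) (cimg b)" by (rule manifold_chart(3)[OF K(1) b(1)])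
  have bN: "smooth_into (mdim K) (cimg b) N (cinv b)"
    using smooth_into_leaf_iff[OF F bo] smooth_into_cinv[OF K(1) b(1)] bo by (simp add: K_def)
  have by': "cinv b (cmap b y) = y" by (rule cinv_cmap[OF K(1) b(1,2)])
  have eq: "diff_in_charts K N (\<lambda>y. y) b c y u = jac (mdim K) (mdim N) (cmap c \<circ> cinv b) (cmap b y) u" for c
    by (simp add: diff_in_charts_def comp_def)
  have "jac (mdim N) (mdim N) (transition c c') (cmap c y) v = diff_in_charts K N (\<lambda>y. y) b c' y u"
    using jac_change_chart[OF N bo bN c, of "cmap b y" u] b(2) y by (simp add: by' v eq)
  then show ?thesis using b unfolding tangent_in_chart_def K_def by blast
qed

lemma tangent_in_chart_scale:
  assumes "v \<in> tangent_in_chart K N c y"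
  shows "(\<lambda>i. r * v i) \<in> tangent_in_chart K N c y"
proof -
  obtain b u where b: "b \<in> atlas K" "y \<in> cdom b" "u \<in> cart (mdim K)" "v = diff_in_charts K N (\<lambda>y. y) b c y u"
    using assms unfolding tangent_in_chart_def by blast
  have "(\<lambda>i. r * v i) = diff_in_charts K N (\<lambda>y. y) b c y (\<lambda>i. r * u i + 0 * u i)"
    unfolding b(4) diff_in_charts_def jac_linear by simp
  then show ?thesis using b(1,2) lincomb_cart[OF b(3,3), of r 0] unfolding tangent_in_chart_def by blast
qed

text \<open>Holds at every y of the chart, not only at its centre; away from the centre the leaf may
  have a larger dimension, so there only this inclusion is available. It makes constant fields in
  the first coordinates tangent to the foliation on the whole chart.\<close>

lemma tangent_in_foliation_chart:
  assumes N: "smooth_manifold N" and F: "singular_foliation N F" and c: "foliation_chart N F x c"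
    and y: "y \<in> cdom c" and a: "a \<in> cart (mdim (submfd N (leaf_of F x)))"
  shows "a \<in> tangent_in_chart (submfd N (leaf_of F y)) N c y"
proof -
  define k where "k = mdim (submfd N (leaf_of F x))"
  obtain U where U: "opn k U" "k \<le> mdim N" and c1: "c \<in> atlas N"
    and head: "\<forall>z\<in>cimg c. (\<lambda>i. if i < k then z i else 0) \<in> U"
    and slice: "\<forall>z\<in>cimg c. \<forall>u\<in>U. (\<lambda>i. if i < k then u i else z i) \<in> cimg c \<and>
      leaf_of F (cinv c (\<lambda>i. if i < k then u i else z i)) = leaf_of F (cinv c z)"
    by (rule foliation_chart_facts[OF N F c k_def]) (rule that; assumption)
  note P = singular_foliation_partition[OF F]
  have yN: "y \<in> mpts N" using y manifold_chart(1)[OF N c1] by blast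
  have L: "leaf_of F y \<in> F" "y \<in> leaf_of F y" using leaf_of_in[OF P yN] by auto
  obtain b where b: "b \<in> atlas (submfd N (leaf_of F y))" "y \<in> cdom b"
    using manifold_cover[OF leaf_structure(1)[OF F L(1)]] leaf_structure(2)[OF F L(1)] L(2) by blast
  have "(\<lambda>i. if i < k then cmap c y i else 0) \<in> U" using bspec[OF head, of "cmap c y"] y by blast
  from leaf_slice[OF N F c1 U slice y this b] a
  obtain h where "diff_in_charts (submfd N (leaf_of F y)) N (\<lambda>y. y) b c y
      (jac k (mdim (submfd N (leaf_of F y))) h (\<lambda>i. if i < k then cmap c y i else 0) a) = a"
    unfolding k_def by blast
  then show ?thesis using b unfolding tangent_in_chart_def by (metis (no_types, lifting) UN_I image_eqI jac_cart mem_Collect_eq)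
qed

section \<open>Basic forms\<close>

definition bump :: "real \<Rightarrow> real" where
  "bump t = (if t > 0 then exp (- inverse t) else 0)"

lemma poly_exp_tendsto_0: "((\<lambda>s. poly p s * exp (- s)) \<longlongrightarrow> (0 :: real)) at_top"
proof -
  have "((\<lambda>s. \<Sum>i\<le>degree p. coeff p i * (s ^ i / exp s)) \<longlongrightarrow> (\<Sum>i\<le>degree p. coeff p i * 0)) at_top"
    by (intro tendsto_sum tendsto_mult tendsto_const tendsto_power_div_exp_0)
  then show ?thesis
    by (simp add: poly_altdef sum_distrib_right exp_minus divide_inverse mult.assoc)
qed

lemma bump_smooth:
  assumes "opn n O'" "smooth_fun n O' f"
  shows "smooth_fun n O' (\<lambda>x. bump (f x))"
proof -
  define G where "G p = (\<lambda>t :: real. if t > 0 then poly p (inverse t) * exp (- inverse t) else 0)" for p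
  \<comment> \<open>With s = 1/t, differentiation in t sends p(s) exp(-s) to (p - p')(s) s^2
    exp(-s), and \<open>[:0, 0, 1:]\<close> is the polynomial s^2.\<close>
  have DG: "(G p has_real_derivative G ((p - pderiv p) * [:0, 0, 1:]) t) (at t)" for p t
  proof -
    consider "t > 0" | "t < 0" | "t = 0" by linarith
    then show ?thesis
    proof cases
      case 1
      have "((\<lambda>t. poly p (inverse t) * exp (- inverse t)) has_real_derivative
          poly (pderiv p) (inverse t) * (- (inverse t ^ Suc (Suc 0))) * exp (- inverse t) +
          poly p (inverse t) * (exp (- inverse t) * (inverse t ^ Suc (Suc 0)))) (at t)"
        using 1 by (auto intro!: derivative_eq_intros DERIV_chain2[OF poly_DERIV] DERIV_inverse)
      then have "((\<lambda>t. poly p (inverse t) * exp (- inverse t)) has_real_derivative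
          G ((p - pderiv p) * [:0, 0, 1:]) t) (at t)"
        using 1 by (simp add: G_def algebra_simps)
      moreover have ev: "\<forall>\<^sub>F s in nhds t. G p s = poly p (inverse s) * exp (- inverse s)"
        using eventually_nhds_in_open[of "{0<..}" t] 1 by (auto simp: G_def elim: eventually_mono)
      ultimately show ?thesis by (simp only: DERIV_cong_ev[OF refl ev refl])
    next
      case 2
      have ev: "\<forall>\<^sub>F s in nhds t. G p s = 0"
        using eventually_nhds_in_open[of "{..<0}" t] 2 by (auto simp: G_def elim: eventually_mono)
      moreover have "((\<lambda>_. 0) has_real_derivative G ((p - pderiv p) * [:0, 0, 1:]) t) (at t)"
        using 2 by (simp add: G_def)
      ultimately show ?thesis by (simp only: DERIV_cong_ev[OF refl ev refl])
    next
      case 3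
      \<comment> \<open>At 0 the difference quotient of \<open>G p\<close> is p(1/t) exp(-1/t) / t;
        the factor \<open>[:0, 1:]\<close> absorbs the division by t.\<close>
      have "((\<lambda>s. poly (p * [:0, 1:]) (inverse s) * exp (- inverse s)) \<longlongrightarrow> 0) (at_right 0)"
        by (rule filterlim_compose[OF poly_exp_tendsto_0 filterlim_inverse_at_top_right])
      then have "((\<lambda>s. G p s / s) \<longlongrightarrow> 0) (at_right 0)"
      proof (rule Lim_transform_eventually)
        show "\<forall>\<^sub>F s in at_right 0. poly (p * [:0, 1:]) (inverse s) * exp (- inverse s) = G p s / s"
          by (rule eventually_mono[OF eventually_at_right_less[of 0]]) (simp add: G_def divide_inverse)
      qed
      moreover have "((\<lambda>s. G p s / s) \<longlongrightarrow> 0) (at_left 0)"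
      proof (rule Lim_transform_eventually[OF tendsto_const])
        show "\<forall>\<^sub>F s in at_left 0. 0 = G p s / s"
          by (rule eventually_mono[OF eventually_at_left_real[of "-1" 0]]) (auto simp: G_def)
      qed
      ultimately have "((\<lambda>s. G p s / s) \<longlongrightarrow> 0) (at 0)" by (simp add: filterlim_at_split)
      then show ?thesis using 3 by (simp add: has_field_derivative_iff G_def)
    qed
  qed
  have "bump \<in> range G"
    by (rule range_eqI[of _ _ 1]) (simp add: bump_def G_def fun_eq_iff)
  moreover have "\<exists>g'\<in>range G. \<forall>t\<in>UNIV. (g has_real_derivative g' t) (at t)" if "g \<in> range G" for g
    using that DG by blast
  ultimately show ?thesis
    by (intro smooth_fun_closure[OF assms, where T = UNIV and S = "range G" and g = bump]) auto
qed

lemma compact_box: "compactin (Euclidean_space n) {z \<in> cart n. \<forall>i<n. \<bar>z i - a i\<bar> \<le> d}"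
proof -
  have "compactin (powertop_real UNIV) (\<Pi>\<^sub>E i\<in>UNIV. if i < n then {a i - d..a i + d} else {0})"
    unfolding compactin_PiE by auto
  moreover have "(\<Pi>\<^sub>E i\<in>UNIV. if i < n then {a i - d..a i + d} else {0}) = {z \<in> cart n. \<forall>i<n. \<bar>z i - a i\<bar> \<le> d}"
    by (auto simp: PiE_iff cart_iff abs_le_iff split: if_splits) (smt (verit, best))+
  ultimately have "compactin (powertop_real UNIV) {z \<in> cart n. \<forall>i<n. \<bar>z i - a i\<bar> \<le> d}" by simp
  then show ?thesis by (auto simp: Euclidean_space_def compactin_subtopology)
qed

text \<open>A compact set of the chart image is compact in N, and closed since N is Hausdorff. A
  field supported in it can then be extended by zero, because the complement is an open set on which
  it vanishes.\<close>

lemma closed_chart_preimage: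
  assumes N: "smooth_manifold N" and c: "c \<in> atlas N"
    and C: "compactin (Euclidean_space (mdim N)) C" "C \<subseteq> cimg c"
  shows "openin (mtop N) (mpts N - cinv c ` C)"
proof -
  have top: "topspace (mtop N) = mpts N"
  proof -
    have "opn (mdim N) (cmap c ` (mpts N \<inter> cdom c))" if "c \<in> atlas N" for c
      using manifold_chart(1,3)[OF N that] by (simp add: inf_absorb2)
    then have "openin (mtop N) (mpts N)" by (simp add: openin_mtop[OF N])
    moreover have "topspace (mtop N) \<subseteq> mpts N" using openin_mtop[OF N, of "topspace (mtop N)"] by simp
    ultimately show ?thesis using openin_subset by blast
  qed
  have "continuous_map (subtopology (Euclidean_space (mdim N)) (cimg c)) (mtop N) (cinv c)"
    unfolding continuous_map
  proof (intro conjI allI impI)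
    show "cinv c ` topspace (subtopology (Euclidean_space (mdim N)) (cimg c)) \<subseteq> topspace (mtop N)"
      unfolding top using cinv_cdom[of _ c] manifold_chart(1)[OF N c] by auto
    fix G assume G: "openin (mtop N) G"
    have "{z \<in> topspace (subtopology (Euclidean_space (mdim N)) (cimg c)). cinv c z \<in> G} = cmap c ` (G \<inter> cdom c)"
      using opn_subset[OF manifold_chart(3)[OF N c]] cmap_cinv[of _ c] cinv_cdom[of _ c] cinv_cmap[OF N c] by force
    moreover have "opn (mdim N) (cmap c ` (G \<inter> cdom c))" using G c by (simp add: openin_mtop[OF N])
    ultimately show "openin (subtopology (Euclidean_space (mdim N)) (cimg c))
        {z \<in> topspace (subtopology (Euclidean_space (mdim N)) (cimg c)). cinv c z \<in> G}"
      by (auto simp: openin_open_subtopology[OF manifold_chart(3)[OF N c]])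
  qed
  then have "compactin (mtop N) (cinv c ` C)"
    by (rule image_compactin[rotated]) (use C in \<open>simp add: compactin_subtopology\<close>)
  moreover have "Hausdorff_space (mtop N)" using N by (simp add: smooth_manifold_def)
  ultimately have "closedin (mtop N) (cinv c ` C)" by (intro compactin_imp_closedin)
  then show ?thesis using top by (auto simp: closedin_def)
qed

text \<open>The field is the constant vector a in the foliation chart, times a cutoff, and zero
  elsewhere. It is tangent to the foliation throughout the chart because a lies in the span of the
  first coordinates, which are tangent to all leaves there.\<close>

lemma extend_tangent_vector:
  assumes N: "smooth_manifold N" and F: "singular_foliation N F" and c: "foliation_chart N F x c"
    and a: "a \<in> cart (mdim (submfd N (leaf_of F x)))" "a \<in> cart (mdim N)"
  obtains X where "tangent_field N F X" "X c (cmap c x) = a"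
proof -
  define n where "n = mdim N"
  have c1: "c \<in> atlas N" "x \<in> cdom c" using c by (auto simp: foliation_chart_def)
  define z0 where "z0 = cmap c x"
  have z0: "z0 \<in> cimg c" using c1 by (auto simp: z0_def)
  note cop = manifold_chart(3)[OF N c1(1), folded n_def]
  obtain e where e: "e > 0" "nbox n z0 e \<subseteq> cimg c" using opn_contains_nbox[OF cop z0] by blast
  \<comment> \<open>Half the radius, so that the closed cube \<open>C\<close> lies in the chart
    image.\<close>
  define d where "d = e / 2"
  have d: "d > 0" "d < e" using e by (auto simp: d_def)
  define C where "C = {z \<in> cart n. \<forall>i<n. \<bar>z i - z0 i\<bar> \<le> d}"
  have C: "C \<subseteq> cimg c" using e(2) d(2) by (force simp: C_def nbox_def)
  \<comment> \<open>The first factor is nonzero only inside the round ball of radius d, hence inside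
    the cube \<open>C\<close>; the second one normalises the value at the centre to 1.\<close>
  define B where "B z = bump (d\<^sup>2 - (\<Sum>i<n. (z i - z0 i) * (z i - z0 i))) * inverse (bump (d\<^sup>2))" for z
  have B: "smooth_fun n O' B" if "opn n O'" for O'
    unfolding B_def by (intro smooth_fun_mult bump_smooth smooth_fun_diff smooth_fun_sum smooth_fun_const smooth_fun_coord that)
  have B0: "B z0 = 1" using d(1) by (simp add: B_def bump_def)
  have BC: "z \<in> C" if "z \<in> cart n" "B z \<noteq> 0" for z
  proof -
    have s: "(\<Sum>i<n. (z i - z0 i) * (z i - z0 i)) < d\<^sup>2" using that(2) by (auto simp: B_def bump_def split: if_splits)
    have "\<bar>z i - z0 i\<bar> \<le> d" if "i < n" for i
    proof -
      have "(z i - z0 i) * (z i - z0 i) \<le> (\<Sum>i<n. (z i - z0 i) * (z i - z0 i))"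
        by (rule member_le_sum) (use that in auto)
      then have "\<bar>z i - z0 i\<bar>\<^sup>2 \<le> d\<^sup>2" using s by (simp add: power2_eq_square)
      then show ?thesis using d(1) by (simp add: abs_le_square_iff[symmetric])
    qed
    then show ?thesis using that(1) by (simp add: C_def)
  qed
  define G where "G = mpts N - cinv c ` C"
  have G: "openin (mtop N) G"
    unfolding G_def by (rule closed_chart_preimage[OF N c1(1) _ C]) (simp add: C_def n_def[symmetric] compact_box)
  \<comment> \<open>The components in chart c', as a function of the coordinates in c. Substituting
    the transition map into \<open>Y\<close> gives the field in chart c' near points of the domain
    of c.\<close>
  define Y where "Y c' z = (\<lambda>i. B z * jac n n (transition c c') z a i)" for c' :: "'a chart" and z
  define X where "X c' z = (if z \<in> cimg c' \<and> cinv c' z \<in> cdom c then Y c' (cmap c (cinv c' z)) else (\<lambda>_. 0))"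
    for c' :: "'a chart" and z
  have X_in: "X c' (cmap c' y) = Y c' (cmap c y)" if "c' \<in> atlas N" "y \<in> cdom c'" "y \<in> cdom c" for c' y
    using that cinv_cmap[OF N that(1,2)] by (auto simp: X_def)
  have X_out: "X c' (cmap c' y) = (\<lambda>_. 0)" if "c' \<in> atlas N" "y \<in> cdom c'" "y \<notin> cdom c \<or> B (cmap c y) = 0" for c' y
    using that cinv_cmap[OF N that(1,2)] by (auto simp: X_def Y_def)
  have sm: "smooth_cart n (cimg c') n (X c')" if c': "c' \<in> atlas N" for c'
  proof (rule smooth_cart_local[OF manifold_chart(3)[OF N c', folded n_def]])
    fix z assume z: "z \<in> cimg c'"
    then obtain y where y: "y \<in> cdom c'" "z = cmap c' y" by blast
    show "\<exists>W. opn n W \<and> z \<in> W \<and> W \<subseteq> cimg c' \<and> smooth_cart n W n (X c')"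
    proof (cases "y \<in> cdom c")
      case True
      define T T' where "T = cmap c ` (cdom c \<inter> cdom c')" and "T' = cmap c' ` (cdom c' \<inter> cdom c)"
      note T = transition_smooth[OF N c1(1) c', folded T_def n_def]
      note T' = transition_smooth[OF N c' c1(1), folded T'_def n_def]
      have Y: "smooth_cart n T n (Y c')"
        unfolding smooth_cart_def
      proof (intro conjI allI impI)
        show "Y c' ` T \<subseteq> cart n"
          unfolding Y_def by (auto simp: cart_iff jac_def)
        show "smooth_fun n T (\<lambda>x. Y c' x i)" if "i < n" for i
          unfolding Y_def using smooth_cartD(1)[OF smooth_cart_jac[OF T] that]
          by (intro smooth_fun_mult T(1) B)
      qed
      have tT: "transition c' c ` T' \<subseteq> T"
        using cinv_cmap[OF N c'] by (auto simp: T_def T'_def)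
      have "smooth_cart n T' n (Y c' \<circ> transition c' c)"
        by (rule smooth_cart_compose[OF T'(1) T(1) tT T'(2) Y])
      moreover have "(Y c' \<circ> transition c' c) z = X c' z" if "z \<in> T'" for z
        using that cinv_cmap[OF N c'] by (auto simp: T'_def X_def)
      ultimately have "smooth_cart n T' n (X c')"
        using smooth_cart_cong[OF T'(1), of "Y c' \<circ> transition c' c" "X c'"] by blast
      then show ?thesis using T'(1) y True by (intro exI[of _ T']) (auto simp: T'_def)
    next
      case False
      \<comment> \<open>A point outside the domain of c has the neighbourhood \<open>G\<close>, on
        which the cutoff vanishes. This covers points on the boundary of the domain, where no
        coordinates of c are available.\<close>
      define W where "W = cmap c' ` (G \<inter> cdom c')"
      have W: "opn n W" using G c' unfolding W_def n_def openin_mtop[OF N] by blast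
      have "cinv c w \<in> cdom c" if "w \<in> C" for w using subsetD[OF C that] by (rule cinv_cdom)
      then have "y \<in> G" using False y(1) manifold_chart(1)[OF N c'] by (auto simp: G_def)
      then have zW: "z \<in> W" using y by (auto simp: W_def)
      have "X c' w = (\<lambda>_. 0)" if w: "w \<in> W" for w
      proof -
        obtain y' where y': "y' \<in> G" "y' \<in> cdom c'" "w = cmap c' y'" using w by (auto simp: W_def)
        have "B (cmap c y') = 0" if yc: "y' \<in> cdom c"
        proof (rule ccontr)
          assume "B (cmap c y') \<noteq> 0"
          then have "cmap c y' \<in> C" using yc opn_subset[OF cop] by (intro BC) auto
          then have "cinv c (cmap c y') \<in> cinv c ` C" by blast
          then show False using y'(1) cinv_cmap[OF N c1(1) yc] by (simp add: G_def)
        qed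
        then show ?thesis using X_out[OF c' y'(2)] y'(3) by blast
      qed
      then have "smooth_cart n W n (X c')"
        using smooth_cart_const[OF W zero_cart] smooth_cart_cong[OF W, of "X c'" "\<lambda>_ _. 0"] by blast
      moreover have "W \<subseteq> cimg c'" by (auto simp: W_def)
      ultimately show ?thesis using W zW by blast
    qed
  qed
  have compat: "X c'' (cmap c'' y) = jac n n (transition c' c'') (cmap c' y) (X c' (cmap c' y))"
    if c': "c' \<in> atlas N" "c'' \<in> atlas N" and y: "y \<in> cdom c'" "y \<in> cdom c''" for c' c'' y
  proof (cases "y \<in> cdom c")
    case True
    have j: "jac n n (transition c c'') (cmap c y) a =
        jac n n (transition c' c'') (cmap c' y) (jac n n (transition c c') (cmap c y) a)"
      using jac_change_chart[OF N manifold_chart(3)[OF N c1(1)] smooth_into_cinv[OF N c1(1)] c', of "cmap c y" a]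
        True y cinv_cmap[OF N c1(1) True] by (simp add: n_def)
    have "jac n n (transition c' c'') (cmap c' y)
        (\<lambda>i. B (cmap c y) * jac n n (transition c c') (cmap c y) a i + 0 * jac n n (transition c c') (cmap c y) a i) =
        (\<lambda>i. B (cmap c y) * jac n n (transition c c'') (cmap c y) a i)"
      unfolding jac_linear j by simp
    then show ?thesis using X_in[OF c'(1) y(1) True] X_in[OF c'(2) y(2) True] by (simp add: Y_def)
  next
    case False
    have "jac n n (transition c' c'') (cmap c' y) (\<lambda>_. 0) = (\<lambda>_. 0)"
      using jac_linear[of n n "transition c' c''" "cmap c' y" 0 "\<lambda>_. 0" 0 "\<lambda>_. 0"] by simp
    then show ?thesis using X_out[OF c'(1) y(1)] X_out[OF c'(2) y(2)] False by simp
  qed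
  have "vector_field N X"
    unfolding vector_field_def n_def[symmetric] using sm compat by blast
  moreover have "X c' (cmap c' y) \<in> tangent_in_chart (submfd N (leaf_of F y)) N c' y"
    if c': "c' \<in> atlas N" and y: "y \<in> cdom c'" for c' y
  proof -
    note P = singular_foliation_partition[OF F]
    have "y \<in> mpts N" using y manifold_chart(1)[OF N c'] by blast
    then have L: "leaf_of F y \<in> F" "y \<in> leaf_of F y" using leaf_of_in[OF P] by auto
    show ?thesis
    proof (cases "y \<in> cdom c")
      case True
      have "a \<in> tangent_in_chart (submfd N (leaf_of F y)) N c y"
        by (rule tangent_in_foliation_chart[OF N F c True a(1)])
      from tangent_in_chart_change[OF N F L(1) c1(1) c' True y this]
      have "Y c' (cmap c y) \<in> tangent_in_chart (submfd N (leaf_of F y)) N c' y"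
        unfolding Y_def n_def by (rule tangent_in_chart_scale)
      then show ?thesis using X_in[OF c' y True] by simp
    next
      case False
      obtain b where b: "b \<in> atlas (submfd N (leaf_of F y))" "y \<in> cdom b"
        using manifold_cover[OF leaf_structure(1)[OF F L(1)]] leaf_structure(2)[OF F L(1)] L(2) by blast
      then have "diff_in_charts (submfd N (leaf_of F y)) N (\<lambda>y. y) b c' y (\<lambda>_. 0)
          \<in> tangent_in_chart (submfd N (leaf_of F y)) N c' y"
        unfolding tangent_in_chart_def using zero_cart by blast
      from tangent_in_chart_scale[OF this, of 0] show ?thesis using X_out[OF c' y] False by simp
    qed
  qed
  ultimately have "tangent_field N F X" unfolding tangent_field_def by blast
  moreover have "X c (cmap c x) = a"
  proof -
    have "jac n n (transition c c) z0 a = jac n n (\<lambda>z. z) z0 a"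
      by (rule jac_cong[OF cop z0]) (simp add: cmap_cinv)
    then have "jac n n (transition c c) z0 a = a" using jac_id a(2) by (simp add: n_def)
    then show ?thesis using X_in[OF c1(1) c1(2) c1(2)] B0 by (simp add: Y_def z0_def[symmetric])
  qed
  ultimately show thesis by (rule that)
qed

text \<open>At each point the velocity of f along coordinate j is tangent to the leaf and is
  therefore the value of some global tangent field. The contraction clause follows at once. For the
  derivative clause the field agrees with the velocity at x0 only, which is what
  \<open>llie_eq_deriv_pullback\<close> asks for; its other premises are the vanishing contractions
  with the velocity and with the field.\<close>

lemma basic_imp_leafwise_invariant:
  assumes N: "smooth_manifold N" and F: "singular_foliation N F" and \<beta>: "\<beta> \<in> basic_forms N F k"
  shows "leafwise_invariant N F \<beta>"
  unfolding leafwise_invariant_def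
proof (intro allI impI ballI)
  fix m O' f j x0 and vs :: "vec list"
  assume O: "opn m O'" and f: "smooth_into m O' N f" and j: "j < m"
    and leaf: "\<forall>x\<in>O'. \<forall>t. x(j := t) \<in> O' \<longrightarrow> leaf_of F (f (x(j := t))) = leaf_of F (f x)"
    and x0: "x0 \<in> O'" and vs: "set vs \<subseteq> cart m"
  define n where "n = mdim N"
  have bm: "\<beta> \<in> mforms N k" using \<beta> by (simp add: basic_forms_def)
  have field: "\<exists>c X. c \<in> atlas N \<and> f x \<in> cdom c \<and> tangent_field N F X \<and>
      X c (cmap c (f x)) = jac m n (cmap c \<circ> f) x (ebas j)" if x: "x \<in> O'" for x
  proof -
    obtain c where c: "foliation_chart N F (f x) c"
      using F smooth_into_mpts[OF f x] by (auto simp: singular_foliation_def)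
    have "jac m n (cmap c \<circ> f) x (ebas j) \<in> cart (mdim (submfd N (leaf_of F (f x))))"
      unfolding n_def by (rule leaf_curve_velocity[OF N F O f x j _ c]) (use leaf x in blast)
    from extend_tangent_vector[OF N F c this] obtain X where "tangent_field N F X"
      "X c (cmap c (f x)) = jac m n (cmap c \<circ> f) x (ebas j)" by (auto simp: n_def)
    moreover have "c \<in> atlas N" "f x \<in> cdom c" using c by (simp_all add: foliation_chart_def)
    ultimately show ?thesis by blast
  qed
  have int0: "\<beta> c z (X c z # us) = 0" if "tangent_field N F X" "c \<in> atlas N" for X c z us
  proof -
    have "mint N X \<beta> c z us = 0" using \<beta> that by (simp add: basic_forms_def)
    then show ?thesis using that by (simp add: mint_def lint_def)
  qed
  have lie0: "llie n (cimg c) (X c) (\<beta> c) z us = 0" if "tangent_field N F X" "c \<in> atlas N" for X c z us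
  proof -
    have "mlie N X \<beta> c z us = 0" using \<beta> that by (simp add: basic_forms_def)
    then show ?thesis using that by (simp add: mlie_def n_def)
  qed
  have 1: "mpull N m O' f \<beta> x (ebas j # us) = 0" if x: "x \<in> O'" and us: "set us \<subseteq> cart m" for x us
  proof -
    obtain c X where c: "c \<in> atlas N" "f x \<in> cdom c" and X: "tangent_field N F X"
      "X c (cmap c (f x)) = jac m n (cmap c \<circ> f) x (ebas j)" using field[OF x] by blast
    have "set (ebas j # us) \<subseteq> cart m" using us ebas_cart[OF j] by simp
    from mpull_eq[OF N O f bm c(1) x c(2) this] show ?thesis
      using int0[OF X(1) c(1), of "cmap c (f x)"] X(2) by (simp add: n_def)
  qed
  have "partial j (\<lambda>y. mpull N m O' f \<beta> y vs) x0 = 0"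
  proof -
    obtain c X where c: "c \<in> atlas N" "f x0 \<in> cdom c" and X: "tangent_field N F X"
      "X c (cmap c (f x0)) = jac m n (cmap c \<circ> f) x0 (ebas j)" using field[OF x0] by blast
    define D where "D = {r \<in> O'. f r \<in> cdom c}"
    note D = smooth_into_chart[OF N O f c(1), folded D_def n_def]
    have xD: "x0 \<in> D" using x0 c by (simp add: D_def)
    have pe: "mpull N m O' f \<beta> y us = \<beta> c ((cmap c \<circ> f) y) (map (jac m n (cmap c \<circ> f) y) us)"
      if "y \<in> D" "set us \<subseteq> cart m" for y us
      using mpull_eq[OF N O f bm c(1) _ _ that(2), of y] that(1) by (simp add: D_def n_def)
    have Xs: "smooth_cart n (cimg c) n (X c)"
      using X(1) c(1) by (simp add: tangent_field_def vector_field_def n_def)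
    have "dir_deriv m (\<lambda>y. \<beta> c ((cmap c \<circ> f) y) (map (jac m n (cmap c \<circ> f) y) vs)) x0 (ebas j) =
        llie n (cimg c) (X c) (\<beta> c) ((cmap c \<circ> f) x0) (map (jac m n (cmap c \<circ> f) x0) vs)"
    proof (rule llie_eq_deriv_pullback[OF manifold_chart(3)[OF N c(1), folded n_def]
          mforms_lforms[OF bm c(1), folded n_def] D _ Xs xD _ _ _ vs])
      show "(cmap c \<circ> f) ` D \<subseteq> cimg c" by (auto simp: D_def)
      show "jac m n (cmap c \<circ> f) x0 (ebas j) = X c ((cmap c \<circ> f) x0)" using X(2) by simp
      show "\<beta> c y (X c y # us) = 0" for y us by (rule int0[OF X(1) c(1)])
      fix y and us :: "vec list" assume y: "y \<in> D" and us: "set us \<subseteq> cart m"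
      have "set (ebas j # us) \<subseteq> cart m" using us ebas_cart[OF j] by simp
      from pe[OF y this] 1[of y us] y us
      show "\<beta> c ((cmap c \<circ> f) y) (jac m n (cmap c \<circ> f) y (ebas j) # map (jac m n (cmap c \<circ> f) y) us) = 0"
        by (simp add: D_def)
    qed
    then have "dir_deriv m (\<lambda>y. \<beta> c ((cmap c \<circ> f) y) (map (jac m n (cmap c \<circ> f) y) vs)) x0 (ebas j) = 0"
      using lie0[OF X(1) c(1)] by simp
    moreover have "dir_deriv m (\<lambda>y. mpull N m O' f \<beta> y vs) x0 (ebas j) =
        dir_deriv m (\<lambda>y. \<beta> c ((cmap c \<circ> f) y) (map (jac m n (cmap c \<circ> f) y) vs)) x0 (ebas j)"
      by (rule dir_deriv_cong[OF D(1) xD]) (rule pe[OF _ vs])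
    ultimately show ?thesis by (simp add: dir_deriv_ebas[OF j])
  qed
  then show "mpull N m O' f \<beta> x0 (ebas j # vs) = 0 \<and> partial j (\<lambda>y. mpull N m O' f \<beta> y vs) x0 = 0"
    using 1[OF x0 vs] by blast
qed

text \<open>Leafwise invariance, applied to the inverse of a foliation chart at x, says that
  \<open>\<beta>\<close> is killed by the first coordinate vectors and that its coefficients are
  constant along them. At x the tangent field is a combination of these vectors, and this one point
  decides both the contraction and, given the vanishing contraction on the chart, the Lie
  derivative.\<close>

lemma leafwise_invariant_imp_basic:
  assumes N: "smooth_manifold N" and F: "singular_foliation N F"
    and \<beta>: "\<beta> \<in> mforms N k" and inv: "leafwise_invariant N F \<beta>"
  shows "\<beta> \<in> basic_forms N F k"
proof -
  define n where "n = mdim N"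
  \<comment> \<open>Each instance fixes one point z, while the Lie derivative at z needs the
    vanishing contraction around z. The second part therefore takes it as a premise on the whole
    chart image, to be supplied by the first part.\<close>
  have main: "\<beta> c z (X c z # us) = 0"
    "(\<forall>z\<in>cimg c. \<forall>us. set us \<subseteq> cart n \<longrightarrow> \<beta> c z (X c z # us) = 0) \<Longrightarrow> llie n (cimg c) (X c) (\<beta> c) z us = 0"
    if X: "tangent_field N F X" and c: "c \<in> atlas N" and z: "z \<in> cimg c" and us: "set us \<subseteq> cart n" for X c z us
  proof -
    obtain x where x: "x \<in> cdom c" "z = cmap c x" using z by blast
    have xN: "x \<in> mpts N" using x manifold_chart(1)[OF N c] by blast
    note P = singular_foliation_partition[OF F]
    have L: "leaf_of F x \<in> F" using leaf_of_in[OF P xN] by blast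
    obtain c' where c': "foliation_chart N F x c'" using F xN by (auto simp: singular_foliation_def)
    define h where "h = mdim (submfd N (leaf_of F x))"
    obtain U where U: "opn h U" "h \<le> n" and c1: "c' \<in> atlas N" "x \<in> cdom c'"
      and head: "\<forall>z\<in>cimg c'. (\<lambda>i. if i < h then z i else 0) \<in> U"
      and slice: "\<forall>z\<in>cimg c'. \<forall>u\<in>U. (\<lambda>i. if i < h then u i else z i) \<in> cimg c' \<and>
        leaf_of F (cinv c' (\<lambda>i. if i < h then u i else z i)) = leaf_of F (cinv c' z)"
      by (rule foliation_chart_facts[OF N F c' h_def, folded n_def]) (rule that; assumption)
    note cop = manifold_chart(3)[OF N c1(1), folded n_def]
    have leafw: "leaf_of F (cinv c' (y(j := t))) = leaf_of F (cinv c' y)"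
      if "y \<in> cimg c'" "y(j := t) \<in> cimg c'" "j < h" for y j t
    proof -
      have "(\<lambda>i. if i < h then (y(j := t)) i else 0) \<in> U" by (rule bspec[OF head that(2)])
      from bspec[OF bspec[OF slice that(1)] this]
      have "leaf_of F (cinv c' (\<lambda>i. if i < h then (if i < h then (y(j := t)) i else 0) else y i)) = leaf_of F (cinv c' y)"
        by blast
      moreover have "(\<lambda>i. if i < h then (if i < h then (y(j := t)) i else 0) else y i) = y(j := t)"
        using that(3) by auto
      ultimately show ?thesis by simp
    qed
    have flat: "\<beta> c' y (ebas j # vs) = 0 \<and> partial j (\<lambda>y. \<beta> c' y vs) y = 0"
      if y: "y \<in> cimg c'" and j: "j < h" and vs: "set vs \<subseteq> cart n" for y j vs
    proof -
      have "mpull N n (cimg c') (cinv c') \<beta> = \<beta> c'" unfolding n_def by (rule mpull_cinv[OF N \<beta> c1(1)])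
      moreover have "\<forall>x\<in>cimg c'. \<forall>t. x(j := t) \<in> cimg c' \<longrightarrow> leaf_of F (cinv c' (x(j := t))) = leaf_of F (cinv c' x)"
        using leafw j by blast
      ultimately show ?thesis
        using inv[unfolded leafwise_invariant_def, rule_format, OF cop smooth_into_cinv[OF N c1(1), folded n_def], of j y vs]
          j U(2) y vs by auto
    qed
    \<comment> \<open>The value of X at x in the foliation chart, kept as a constant vector; away
      from x it may differ from X.\<close>
    define e where "e = jac n n (transition c c') z (X c z)"
    have e: "e \<in> cart h"
    proof -
      have "X c z \<in> tangent_in_chart (submfd N (leaf_of F x)) N c x"
        using X c x by (auto simp: tangent_field_def)
      from tangent_in_chart_change[OF N F L c c1(1) x(1) c1(2) this]
      show ?thesis unfolding e_def x(2) h_def n_def by (rule tangent_in_chart_head[OF N F c'])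
    qed
    have eh: "e l = 0" if "h \<le> l" for l using e that by (simp add: cart_iff)
    have ec: "e \<in> cart n" by (simp add: e_def)
    have e0: "\<beta> c' y (e # vs) = 0" if y: "y \<in> cimg c'" and vs: "set vs \<subseteq> cart n" for y vs
    proof (cases "length (e # vs) = k")
      case True
      have "\<beta> c' y ([] @ e # vs) = (\<Sum>l<n. e l * \<beta> c' y ([] @ ebas l # vs))"
        by (rule lforms_expand[OF mforms_lforms[OF \<beta> c1(1), folded n_def]]) (use True ec vs in auto)
      also have "\<dots> = 0"
        by (intro sum.neutral ballI) (use flat[OF y _ vs] eh not_le in auto)
      finally show ?thesis by simp
    qed (use lforms_zero[OF mforms_lforms[OF \<beta> c1(1)]] in blast)
    have De: "dir_deriv n (\<lambda>y. \<beta> c' y vs) y e = 0" if y: "y \<in> cimg c'" and vs: "set vs \<subseteq> cart n" for y vs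
      unfolding dir_deriv_def by (intro sum.neutral ballI) (use flat[OF y _ vs] eh not_le in auto)
    have Xs: "smooth_cart n (cimg c) n (X c)"
      using X c by (simp add: tangent_field_def vector_field_def n_def)
    have Xc: "X c z \<in> cart n" by (rule smooth_cartD(2)[OF Xs z])
    have xc': "cmap c' x \<in> cimg c'" using c1 by blast
    have "\<beta> c z (X c z # us) = \<beta> c' (cmap c' x) (map (jac n n (transition c c') z) (X c z # us))"
      unfolding x(2) n_def by (rule mforms_transition[OF \<beta> c c1(1) x(1) c1(2)]) (use Xc us x in \<open>simp add: n_def\<close>)
    also have "\<dots> = 0" using e0[OF xc' set_map_jac] by (simp add: e_def)
    finally show "\<beta> c z (X c z # us) = 0" .
    assume H2: "\<forall>z\<in>cimg c. \<forall>us. set us \<subseteq> cart n \<longrightarrow> \<beta> c z (X c z # us) = 0"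
    define D where "D = cmap c' ` (cdom c' \<inter> cdom c)"
    define f where "f = transition c' c"
    note D = transition_smooth[OF N c1(1) c, folded D_def f_def n_def]
    have x0: "cmap c' x \<in> D" "f (cmap c' x) = z"
      using c1 x cinv_cmap[OF N c1] by (auto simp: D_def f_def)
    have fD: "f ` D \<subseteq> cimg c" using cinv_cmap[OF N c1(1)] by (auto simp: D_def f_def)
    have pull: "\<beta> c (f y) (map (jac n n f y) vs) = \<beta> c' y vs" if y: "y \<in> D" and vs: "set vs \<subseteq> cart n" for y vs
    proof -
      obtain w where w: "w \<in> cdom c'" "w \<in> cdom c" "y = cmap c' w" using y by (auto simp: D_def)
      then have "f y = cmap c w" using cinv_cmap[OF N c1(1)] by (simp add: f_def)
      then show ?thesis
        using mforms_transition[OF \<beta> c1(1) c w(1,2), of vs] vs w(3) by (simp add: n_def f_def)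
    qed
    have jac_back: "jac n n f (cmap c' x) (jac n n (transition c c') z v) = v" if v: "v \<in> cart n" for v
    proof -
      have "jac n n (cmap c \<circ> cinv c) z v =
          jac n n (transition c' c) (cmap c' (cinv c z)) (jac n n (cmap c' \<circ> cinv c) z v)"
        unfolding n_def
        by (rule jac_change_chart[OF N manifold_chart(3)[OF N c] smooth_into_cinv[OF N c] c1(1) c z])
          (use x c1 cinv_cmap[OF N c] in auto)
      moreover have "jac n n (cmap c \<circ> cinv c) z v = jac n n (\<lambda>y. y) z v"
        by (rule jac_cong[OF manifold_chart(3)[OF N c, folded n_def] z]) (simp add: cmap_cinv)
      ultimately show ?thesis using jac_id[OF v] x cinv_cmap[OF N c] by (simp add: f_def)
    qed
    define vs where "vs = map (jac n n (transition c c') z) us"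
    have vs: "set vs \<subseteq> cart n" unfolding vs_def by (rule set_map_jac)
    have "map (jac n n f (cmap c' x)) vs = us"
      unfolding vs_def map_map by (rule map_idI) (use jac_back us in auto)
    \<comment> \<open>The transition map from the foliation chart plays the part of the map in
      \<open>llie_eq_deriv_pullback\<close>, with the constant direction e. The form pulled back
      along it is \<open>\<beta> c'\<close>, whose derivative along e vanishes.\<close>
    moreover have "dir_deriv n (\<lambda>y. \<beta> c (f y) (map (jac n n f y) vs)) (cmap c' x) e =
        llie n (cimg c) (X c) (\<beta> c) (f (cmap c' x)) (map (jac n n f (cmap c' x)) vs)"
    proof (rule llie_eq_deriv_pullback[OF manifold_chart(3)[OF N c, folded n_def]
          mforms_lforms[OF \<beta> c, folded n_def] D fD Xs x0(1) _ _ _ vs])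
      show "jac n n f (cmap c' x) e = X c (f (cmap c' x))" using jac_back[OF Xc] x0(2) by (simp add: e_def)
      show "\<beta> c y (X c y # us) = 0" if "y \<in> cimg c" "set us \<subseteq> cart n" for y us using H2 that by blast
      fix y and vs :: "vec list" assume y: "y \<in> D" and vs: "set vs \<subseteq> cart n"
      have "set (e # vs) \<subseteq> cart n" using vs ec by simp
      from pull[OF y this] e0[OF _ vs, of y] y
      show "\<beta> c (f y) (jac n n f y e # map (jac n n f y) vs) = 0" by (auto simp: D_def)
    qed
    moreover have "dir_deriv n (\<lambda>y. \<beta> c (f y) (map (jac n n f y) vs)) (cmap c' x) e =
        dir_deriv n (\<lambda>y. \<beta> c' y vs) (cmap c' x) e"
      by (rule dir_deriv_cong[OF D(1) x0(1)]) (rule pull[OF _ vs])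
    ultimately show "llie n (cimg c) (X c) (\<beta> c) z us = 0" using De[OF xc' vs] x0(2) by simp
  qed
  have "mint N X \<beta> = (\<lambda>_ _ _. 0) \<and> mlie N X \<beta> = (\<lambda>_ _ _. 0)" if X: "tangent_field N F X" for X
  proof -
    have i: "\<beta> c z (X c z # us) = 0" if c: "c \<in> atlas N" for c z us
    proof (cases "z \<in> cimg c \<and> set us \<subseteq> cart n")
      case True
      then show ?thesis using main(1)[OF X c] by blast
    next
      case False
      then show ?thesis by (intro lforms_zero[OF mforms_lforms[OF \<beta> c]]) (auto simp: n_def)
    qed
    moreover have "llie n (cimg c) (X c) (\<beta> c) z us = 0" if c: "c \<in> atlas N" for c z us
    proof (cases "z \<in> cimg c \<and> set us \<subseteq> cart n")
      case True
      then show ?thesis using main(2)[OF X c] i[OF c] by blast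
    next
      case False
      then show ?thesis by (simp only: llie_def if_False)
    qed
    ultimately show ?thesis by (intro conjI ext) (simp_all add: mint_def mlie_def lint_def n_def)
  qed
  then show ?thesis using \<beta> by (simp add: basic_forms_def)
qed

section \<open>Transport along Molino transverse equivalences\<close>

text \<open>The right side depends on the pullback foliation only. Hence \<open>p0\<close> and
  \<open>p1\<close> induce the same relation on M, which is the form in which equality of the two
  pullbacks is used.\<close>

lemma pullback_foliation_same_leaf_iff:
  assumes F: "partition_on (mpts N) F" and p: "p ` mpts M \<subseteq> mpts N" and x: "x \<in> mpts M" "y \<in> mpts M"
  shows "leaf_of F (p x) = leaf_of F (p y) \<longleftrightarrow> (\<exists>L\<in>pullback_foliation M p F. x \<in> L \<and> y \<in> L)"
proof
  have px: "p x \<in> mpts N" "p y \<in> mpts N" using p x by auto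
  note l = leaf_of_in[OF F px(1)] leaf_of_in[OF F px(2)]
  assume "leaf_of F (p x) = leaf_of F (p y)"
  then have "p y \<in> leaf_of F (p x)" using l by simp
  then show "\<exists>L\<in>pullback_foliation M p F. x \<in> L \<and> y \<in> L"
    using l(1) x by (intro bexI[of _ "{z \<in> mpts M. p z \<in> leaf_of F (p x)}"]) (auto simp: pullback_foliation_def)
next
  assume "\<exists>L\<in>pullback_foliation M p F. x \<in> L \<and> y \<in> L"
  then obtain L where "L \<in> F" "p x \<in> L" "p y \<in> L" unfolding pullback_foliation_def by blast
  then show "leaf_of F (p x) = leaf_of F (p y)" using leaf_of_eq[OF F] by metis
qed

text \<open>The conclusion says that \<alpha> and \<beta> have the same pullback to M. It is
  expressed through smooth maps into M, so that no form on M has to be constructed.\<close>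

lemma descend_along_submersion:
  assumes M: "smooth_manifold M" and N: "smooth_manifold N0" "smooth_manifold N1"
    and p0: "surj_submersion_conn M N0 p0" and p1: "smooth_map M N1 p1"
    and \<beta>: "\<beta> \<in> mforms N1 k" "leafwise_invariant N1 F1 \<beta>"
    and leaf: "\<And>x y. x \<in> mpts M \<Longrightarrow> y \<in> mpts M \<Longrightarrow> p0 x = p0 y \<Longrightarrow> leaf_of F1 (p1 x) = leaf_of F1 (p1 y)"
  shows "\<exists>\<alpha>\<in>mforms N0 k. \<forall>l O' f. opn l O' \<longrightarrow> smooth_into l O' M f \<longrightarrow>
    (\<forall>r\<in>O'. \<forall>vs. mpull N0 l O' (\<lambda>s. p0 (f s)) \<alpha> r vs = mpull N1 l O' (\<lambda>s. p1 (f s)) \<beta> r vs)"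
proof -
  define n where "n = mdim N0"
  have sub: "submersion M N0 p0" and onto: "p0 ` mpts M = mpts N0"
    using p0 by (auto simp: surj_submersion_conn_def)
  have p0s: "smooth_map M N0 p0" using sub by (simp add: submersion_def)
  define lift where "lift c z W s \<longleftrightarrow> opn n W \<and> z \<in> W \<and> W \<subseteq> cimg c \<and> smooth_into n W M s \<and>
    (\<forall>r\<in>W. p0 (s r) = cinv c r)" for c :: "'b chart" and z W s
  have liftD: "opn n W" "z \<in> W" "W \<subseteq> cimg c" "smooth_into n W M s" "\<And>r. r \<in> W \<Longrightarrow> p0 (s r) = cinv c r"
    if "lift c z W s" for c z W s using that by (auto simp: lift_def)
  define \<alpha> where "\<alpha> c z vs = (if c \<in> atlas N0 \<and> z \<in> cimg c \<and> set vs \<subseteq> cart n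
    then SOME v. \<exists>W s. lift c z W s \<and> v = mpull N1 n W (\<lambda>r. p1 (s r)) \<beta> z vs else 0)" for c z vs
  have ex_lift: "\<exists>W s. lift c z W s" if c: "c \<in> atlas N0" and z: "z \<in> cimg c" for c z
  proof -
    have "cinv c z \<in> mpts N0" using cinv_cdom[OF z] manifold_chart(1)[OF N(1) c] by blast
    then obtain x where x: "x \<in> mpts M" "p0 x = cinv c z" using onto by (metis imageE)
    from submersion_lift[OF M N(1) sub manifold_chart(3)[OF N(1) c] smooth_into_cinv[OF N(1) c] z x]
    show ?thesis unfolding lift_def n_def by blast
  qed
  have restr: "lift c z V s" if "lift c z' W s" "opn n V" "V \<subseteq> W" "z \<in> V" for c z z' W s V
    using liftD[OF that(1)] that(2-) smooth_into_subset[of n W M s V] unfolding lift_def by blast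
  have unique: "mpull N1 n W (\<lambda>r. p1 (s r)) \<beta> z vs = mpull N1 n W' (\<lambda>r. p1 (s' r)) \<beta> z vs"
    if s: "lift c z W s" and s': "lift c z W' s'" for c z W s W' s' vs
  proof -
    define V where "V = W \<inter> W'"
    have V: "opn n V" "V \<subseteq> W" "V \<subseteq> W'" "z \<in> V" using liftD[OF s] liftD[OF s'] by (auto simp: V_def)
    note t = liftD[OF restr[OF s V(1,2,4)]] and t' = liftD[OF restr[OF s' V(1,3,4)]]
    have "mpull N1 n V (\<lambda>r. p1 (s r)) \<beta> z vs = mpull N1 n V (\<lambda>r. p1 (s' r)) \<beta> z vs"
      by (rule mpull_eq_of_same_fiber[OF M N p0 p1 \<beta> leaf V(1) t(4) t'(4) _ V(4)]) (use t(5) t'(5) in simp_all)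
    then show ?thesis
      using mpull_subset[OF V(2,4), of N1 n "\<lambda>r. p1 (s r)" \<beta> vs] mpull_subset[OF V(3,4), of N1 n "\<lambda>r. p1 (s' r)" \<beta> vs]
      by simp
  qed
  have \<alpha>_eq: "\<alpha> c z vs = mpull N1 n W (\<lambda>r. p1 (s r)) \<beta> z vs"
    if c: "c \<in> atlas N0" and l: "lift c z W s" for c z W s vs
  proof (cases "set vs \<subseteq> cart n")
    case True
    have "z \<in> cimg c" using liftD[OF l] by blast
    then have "\<alpha> c z vs = (SOME v. \<exists>W s. lift c z W s \<and> v = mpull N1 n W (\<lambda>r. p1 (s r)) \<beta> z vs)"
      using c True by (simp add: \<alpha>_def)
    also have "\<dots> = mpull N1 n W (\<lambda>r. p1 (s r)) \<beta> z vs"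
      by (rule some_equality) (use l unique[OF _ l] in blast)+
    finally show ?thesis .
  next
    case False
    then show ?thesis by (simp add: \<alpha>_def mpull_outside)
  qed
  have p1s: "smooth_into l V N1 (\<lambda>r. p1 (s r))" if "opn l V" "smooth_into l V M s" for l V s
    by (rule smooth_map_compose[OF M p1 that])
  have \<alpha>: "\<alpha> \<in> mforms N0 k"
    unfolding mforms_def mem_Collect_eq
  proof (intro conjI allI ballI impI)
    fix c :: "'b chart" assume "c \<notin> atlas N0"
    then show "\<alpha> c = (\<lambda>_ _. 0)" by (simp add: \<alpha>_def fun_eq_iff)
  next
    fix c assume c: "c \<in> atlas N0"
    show "\<alpha> c \<in> lforms k (mdim N0) (cimg c)"
      unfolding n_def[symmetric]
    proof (rule lforms_local[OF manifold_chart(3)[OF N(1) c, folded n_def]])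
      show "\<alpha> c z vs = 0" if "\<not> (z \<in> cimg c \<and> set vs \<subseteq> cart n)" for z vs
        using that unfolding \<alpha>_def by (simp only: if_False simp_thms)
      fix z assume "z \<in> cimg c"
      then obtain W s where l: "lift c z W s" using ex_lift[OF c] by blast
      note W = liftD[OF l]
      have "\<alpha> c y vs = mpull N1 n W (\<lambda>r. p1 (s r)) \<beta> y vs" if "y \<in> W" for y vs
        by (rule \<alpha>_eq[OF c restr[OF l W(1) order_refl that]])
      then show "\<exists>W w'. opn n W \<and> z \<in> W \<and> W \<subseteq> cimg c \<and> w' \<in> lforms k n W \<and>
          (\<forall>y\<in>W. \<forall>vs. set vs \<subseteq> cart n \<longrightarrow> \<alpha> c y vs = w' y vs)"
        using W(1-3) mpull_lforms[OF N(2) W(1) p1s[OF W(1,4)] \<beta>(1)] by blast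
    qed
  next
    fix c c' x and vs :: "vec list"
    assume c: "c \<in> atlas N0" "c' \<in> atlas N0" and x: "x \<in> cdom c \<inter> cdom c'" and vs: "set vs \<subseteq> cart (mdim N0)"
    define T where "T = cmap c ` (cdom c \<inter> cdom c')"
    note T = transition_smooth[OF N(1) c, folded T_def n_def]
    have xT: "cmap c x \<in> T" using x by (simp add: T_def)
    have tx: "transition c c' (cmap c x) = cmap c' x" using x cinv_cmap[OF N(1) c(1)] by simp
    have "cmap c' x \<in> cimg c'" using x by blast
    then obtain W s where l: "lift c' (cmap c' x) W s" using ex_lift[OF c(2)] by blast
    note W = liftD[OF l]
    define V where "V = {z \<in> T. transition c c' z \<in> W}"
    have V: "opn n V" unfolding V_def by (rule smooth_cart_preimage[OF T W(1)])
    have VT: "V \<subseteq> T" "transition c c' ` V \<subseteq> W" "cmap c x \<in> V" using xT tx W(2) by (auto simp: V_def)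
    have tV: "smooth_cart n V n (transition c c')" by (rule smooth_cart_subset[OF T(2,1) V VT(1)])
    \<comment> \<open>A section over chart c', composed with the transition map, is a section over
      chart c. Both sides are thus computed from the same section.\<close>
    have "lift c (cmap c x) V (s \<circ> transition c c')"
      unfolding lift_def
    proof (intro conjI ballI)
      show "smooth_into n V M (s \<circ> transition c c')" by (rule smooth_into_compose[OF W(4,1) V tV VT(2)])
      fix z assume z: "z \<in> V"
      then obtain y where y: "y \<in> cdom c" "y \<in> cdom c'" "z = cmap c y" using VT(1) by (auto simp: T_def)
      have "transition c c' z \<in> W" using VT(2) z by blast
      from W(5)[OF this] show "p0 ((s \<circ> transition c c') z) = cinv c z"
        using y cinv_cmap[OF N(1)] c by simp
    qed (use V VT in \<open>auto simp: T_def\<close>)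
    then have "\<alpha> c (cmap c x) vs = mpull N1 n V ((\<lambda>r. p1 (s r)) \<circ> transition c c') \<beta> (cmap c x) vs"
      using \<alpha>_eq[OF c(1)] by (simp add: comp_def)
    also have "\<dots> = mpull N1 n W (\<lambda>r. p1 (s r)) \<beta> (cmap c' x) (map (jac n n (transition c c') (cmap c x)) vs)"
      using VT(3) vs[folded n_def] tx
      by (simp add: mpull_compose[OF N(2) W(1) p1s[OF W(1,4)] \<beta>(1) V tV VT(2)] lpull_apply)
    also have "\<dots> = \<alpha> c' (cmap c' x) (map (jac n n (transition c c') (cmap c x)) vs)"
      by (rule \<alpha>_eq[OF c(2) l, symmetric])
    finally show "\<alpha> c (cmap c x) vs =
        \<alpha> c' (cmap c' x) (map (jac (mdim N0) (mdim N0) (transition c c') (cmap c x)) vs)"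
      by (simp add: n_def)
  qed
  moreover have "mpull N0 l O' (\<lambda>s. p0 (f s)) \<alpha> r vs = mpull N1 l O' (\<lambda>s. p1 (f s)) \<beta> r vs"
    if O: "opn l O'" and f: "smooth_into l O' M f" and r: "r \<in> O'" for l O' f r vs
  proof (cases "set vs \<subseteq> cart l")
    case True
    have q: "smooth_into l O' N0 (\<lambda>s. p0 (f s))" by (rule smooth_map_compose[OF M p0s O f])
    obtain c where c: "c \<in> atlas N0" "p0 (f r) \<in> cdom c"
      using manifold_cover[OF N(1) smooth_into_mpts[OF q r]] by blast
    define D where "D = {s \<in> O'. p0 (f s) \<in> cdom c}"
    define g where "g = cmap c \<circ> (\<lambda>s. p0 (f s))"
    note D = smooth_into_chart[OF N(1) O q c(1), folded D_def g_def n_def]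
    have "g r \<in> cimg c" using c(2) by (auto simp: g_def)
    then obtain W s where l: "lift c (g r) W s" using ex_lift[OF c(1)] by blast
    note W = liftD[OF l]
    define V where "V = {s \<in> D. g s \<in> W}"
    have V: "opn l V" unfolding V_def by (rule smooth_cart_preimage[OF D W(1)])
    have VD: "V \<subseteq> D" "g ` V \<subseteq> W" "V \<subseteq> O'" "r \<in> V" using r c(2) W(2) by (auto simp: V_def D_def)
    have gV: "smooth_cart l V n g" by (rule smooth_cart_subset[OF D(2,1) V VD(1)])
    have sg: "smooth_into l V M (s \<circ> g)" by (rule smooth_into_compose[OF W(4,1) V gV VD(2)])
    have "mpull N0 l O' (\<lambda>s. p0 (f s)) \<alpha> r vs = \<alpha> c (g r) (map (jac l n g r) vs)"
      using mpull_eq[OF N(1) O q \<alpha> c(1) r c(2) True] by (simp add: g_def n_def)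
    also have "\<dots> = mpull N1 n W (\<lambda>z. p1 (s z)) \<beta> (g r) (map (jac l n g r) vs)"
      by (rule \<alpha>_eq[OF c(1) l])
    also have "\<dots> = mpull N1 l V ((\<lambda>z. p1 (s z)) \<circ> g) \<beta> r vs"
      using VD(4) True
      by (simp add: mpull_compose[OF N(2) W(1) p1s[OF W(1,4)] \<beta>(1) V gV VD(2)] lpull_apply)
    also have "\<dots> = mpull N1 l V (\<lambda>z. p1 ((s \<circ> g) z)) \<beta> r vs" by (simp add: comp_def)
    \<comment> \<open>The section composed with \<open>g\<close>, and f itself, are two lifts of one
      map along \<open>p0\<close>.\<close>
    also have "\<dots> = mpull N1 l V (\<lambda>s. p1 (f s)) \<beta> r vs"
    proof (rule mpull_eq_of_same_fiber[OF M N p0 p1 \<beta> leaf V sg smooth_into_subset[OF f O V VD(3)] _ VD(4)])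
      fix y assume y: "y \<in> V"
      then have "g y \<in> W" "p0 (f y) \<in> cdom c" using VD by (auto simp: D_def)
      then show "p0 ((s \<circ> g) y) = p0 (f y)" using W(5) cinv_cmap[OF N(1) c(1)] by (simp add: g_def)
    qed
    also have "\<dots> = mpull N1 l O' (\<lambda>s. p1 (f s)) \<beta> r vs" by (rule mpull_subset[OF VD(3,4)])
    finally show ?thesis .
  qed (simp add: mpull_outside)
  ultimately show ?thesis by blast
qed

text \<open>Both clauses concern the germ of f at a point, so a local lift to M suffices. Followed
  by \<open>p1\<close> the lift again stays in leaves along coordinate j, by the hypothesis
  \<open>leaf\<close>.\<close>

lemma transfer_leafwise_invariant:
  assumes M: "smooth_manifold M" and N: "smooth_manifold N0" "smooth_manifold N1"
    and p0: "submersion M N0 p0" "p0 ` mpts M = mpts N0" and p1: "smooth_map M N1 p1"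
    and \<alpha>: "\<alpha> \<in> mforms N0 k" and \<beta>: "leafwise_invariant N1 F1 \<beta>"
    and leaf: "\<And>x y. x \<in> mpts M \<Longrightarrow> y \<in> mpts M \<Longrightarrow>
      leaf_of F0 (p0 x) = leaf_of F0 (p0 y) \<Longrightarrow> leaf_of F1 (p1 x) = leaf_of F1 (p1 y)"
    and pull: "\<And>l O' f r vs. opn l O' \<Longrightarrow> smooth_into l O' M f \<Longrightarrow> r \<in> O' \<Longrightarrow>
      mpull N0 l O' (\<lambda>s. p0 (f s)) \<alpha> r vs = mpull N1 l O' (\<lambda>s. p1 (f s)) \<beta> r vs"
  shows "leafwise_invariant N0 F0 \<alpha>"
  unfolding leafwise_invariant_def
proof (intro allI impI ballI)
  fix n O' f j x and vs :: "vec list"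
  assume O: "opn n O'" and f: "smooth_into n O' N0 f" and j: "j < n"
    and lw: "\<forall>x\<in>O'. \<forall>t. x(j := t) \<in> O' \<longrightarrow> leaf_of F0 (f (x(j := t))) = leaf_of F0 (f x)"
    and x: "x \<in> O'" and vs: "set vs \<subseteq> cart n"
  obtain y where y: "y \<in> mpts M" "p0 y = f x" using smooth_into_mpts[OF f x] p0(2) by (metis imageE)
  obtain W g where W: "opn n W" "x \<in> W" "W \<subseteq> O'" "smooth_into n W M g" and pg: "\<forall>s\<in>W. p0 (g s) = f s"
    using submersion_lift[OF M N(1) p0(1) O f x y] by blast
  have p0s: "smooth_map M N0 p0" using p0(1) by (simp add: submersion_def)
  have eq: "mpull N0 n O' f \<alpha> s us = mpull N1 n W (\<lambda>s. p1 (g s)) \<beta> s us" if s: "s \<in> W" for s us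
  proof -
    have "mpull N0 n O' f \<alpha> s us = mpull N0 n W (\<lambda>s. p0 (g s)) \<alpha> s us"
      by (rule mpull_cong[OF N(1) O W(1) f smooth_map_compose[OF M p0s W(1,4)] \<alpha> W(1,3) order_refl s])
        (use pg in simp)
    then show ?thesis using pull[OF W(1,4) s] by simp
  qed
  have "\<forall>s\<in>W. \<forall>t. s(j := t) \<in> W \<longrightarrow> leaf_of F1 (p1 (g (s(j := t)))) = leaf_of F1 (p1 (g s))"
  proof (intro ballI allI impI)
    fix s t assume s: "s \<in> W" "s(j := t) \<in> W"
    then have "leaf_of F0 (f (s(j := t))) = leaf_of F0 (f s)" using lw W(3) by blast
    then show "leaf_of F1 (p1 (g (s(j := t)))) = leaf_of F1 (p1 (g s))"
      using s pg smooth_into_mpts[OF W(4)] by (intro leaf) auto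
  qed
  then have "mpull N1 n W (\<lambda>s. p1 (g s)) \<beta> x (ebas j # vs) = 0 \<and>
      partial j (\<lambda>y. mpull N1 n W (\<lambda>s. p1 (g s)) \<beta> y vs) x = 0"
    using \<beta>[unfolded leafwise_invariant_def, rule_format, OF W(1) smooth_map_compose[OF M p1 W(1,4)] j] W(2) vs
    by blast
  moreover have "partial j (\<lambda>y. mpull N0 n O' f \<alpha> y vs) x = partial j (\<lambda>y. mpull N1 n W (\<lambda>s. p1 (g s)) \<beta> y vs) x"
    by (rule partial_cong[OF W(1,2) j]) (rule eq)
  ultimately show "mpull N0 n O' f \<alpha> x (ebas j # vs) = 0 \<and> partial j (\<lambda>y. mpull N0 n O' f \<alpha> y vs) x = 0"
    using eq[OF W(2)] by simp
qed

text \<open>The two plots are lifted independently of each other. Their lifts need not lie in common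
  fibers; \<open>leaf\<close> makes their images in N0 lie in common leaves, where the invariance of
  \<alpha> applies.\<close>

lemma transfer_plot_invariant:
  assumes M: "smooth_manifold M" and N: "smooth_manifold N0" "smooth_manifold N1"
    and p0: "smooth_map M N0 p0" and p1: "submersion M N1 p1" "p1 ` mpts M = mpts N1"
    and \<alpha>: "plot_invariant N0 F0 \<alpha>" and \<beta>: "\<beta> \<in> mforms N1 k"
    and leaf: "\<And>x y. x \<in> mpts M \<Longrightarrow> y \<in> mpts M \<Longrightarrow>
      leaf_of F1 (p1 x) = leaf_of F1 (p1 y) \<Longrightarrow> leaf_of F0 (p0 x) = leaf_of F0 (p0 y)"
    and pull: "\<And>l O' f r vs. opn l O' \<Longrightarrow> smooth_into l O' M f \<Longrightarrow> r \<in> O' \<Longrightarrow>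
      mpull N0 l O' (\<lambda>s. p0 (f s)) \<alpha> r vs = mpull N1 l O' (\<lambda>s. p1 (f s)) \<beta> r vs"
  shows "plot_invariant N1 F1 \<beta>"
  unfolding plot_invariant_def
proof (intro allI impI ballI)
  fix n O' q q' r and vs :: "vec list"
  assume O: "opn n O'" and q: "smooth_into n O' N1 q" "smooth_into n O' N1 q'"
    and eq: "\<forall>x\<in>O'. leaf_of F1 (q x) = leaf_of F1 (q' x)" and r: "r \<in> O'"
  have p1s: "smooth_map M N1 p1" using p1(1) by (simp add: submersion_def)
  have lift: "\<exists>W g. opn n W \<and> r \<in> W \<and> W \<subseteq> O' \<and> smooth_into n W M g \<and> (\<forall>s\<in>W. p1 (g s) = f s)"
    if f: "smooth_into n O' N1 f" for f
  proof -
    obtain y where "y \<in> mpts M" "p1 y = f r" using smooth_into_mpts[OF f r] p1(2) by (metis imageE)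
    from submersion_lift[OF M N(2) p1(1) O f r this] show ?thesis by blast
  qed
  obtain W1 g where W1: "opn n W1" "r \<in> W1" "W1 \<subseteq> O'" "smooth_into n W1 M g" "\<forall>s\<in>W1. p1 (g s) = q s"
    using lift[OF q(1)] by blast
  obtain W2 g' where W2: "opn n W2" "r \<in> W2" "W2 \<subseteq> O'" "smooth_into n W2 M g'" "\<forall>s\<in>W2. p1 (g' s) = q' s"
    using lift[OF q(2)] by blast
  define W where "W = W1 \<inter> W2"
  have W: "opn n W" "W \<subseteq> W1" "W \<subseteq> W2" "r \<in> W" "W \<subseteq> O'" using W1 W2 by (auto simp: W_def)
  have g: "smooth_into n W M g" by (rule smooth_into_subset[OF W1(4,1) W(1,2)])
  have g': "smooth_into n W M g'" by (rule smooth_into_subset[OF W2(4,1) W(1,3)])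
  have "leaf_of F0 (p0 (g s)) = leaf_of F0 (p0 (g' s))" if s: "s \<in> W" for s
  proof (rule leaf[OF smooth_into_mpts[OF g s] smooth_into_mpts[OF g' s]])
    have "s \<in> W1" "s \<in> W2" "s \<in> O'" using s W by auto
    then show "leaf_of F1 (p1 (g s)) = leaf_of F1 (p1 (g' s))" using eq W1(5) W2(5) by simp
  qed
  then have "mpull N0 n W (\<lambda>s. p0 (g s)) \<alpha> r vs = mpull N0 n W (\<lambda>s. p0 (g' s)) \<alpha> r vs"
    using \<alpha>[unfolded plot_invariant_def, rule_format, OF W(1) smooth_map_compose[OF M p0 W(1) g]
        smooth_map_compose[OF M p0 W(1) g']] W(4) by blast
  then have "mpull N1 n W (\<lambda>s. p1 (g s)) \<beta> r vs = mpull N1 n W (\<lambda>s. p1 (g' s)) \<beta> r vs"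
    by (simp add: pull[OF W(1) g W(4)] pull[OF W(1) g' W(4)])
  moreover have "mpull N1 n O' q \<beta> r vs = mpull N1 n W (\<lambda>s. p1 (g s)) \<beta> r vs"
    by (rule mpull_cong[OF N(2) O W(1) q(1) smooth_map_compose[OF M p1s W(1) g] \<beta> W(1,5) order_refl W(4)])
      (use W1(5) W(2) in auto)
  moreover have "mpull N1 n O' q' \<beta> r vs = mpull N1 n W (\<lambda>s. p1 (g' s)) \<beta> r vs"
    by (rule mpull_cong[OF N(2) O W(1) q(2) smooth_map_compose[OF M p1s W(1) g'] \<beta> W(1,5) order_refl W(4)])
      (use W2(5) W(3) in auto)
  ultimately show "mpull N1 n O' q \<beta> r vs = mpull N1 n O' q' \<beta> r vs" by simp
qed

section \<open>The quotient pullback as a cochain map\<close>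

lemma quot_pull_linear:
  "quot_pull N F (\<lambda>p x vs. a * v p x vs + b * w p x vs) =
    (\<lambda>c x vs. a * quot_pull N F v c x vs + b * quot_pull N F w c x vs)"
  by (auto simp: quot_pull_def mform_of_def dpull_def fun_eq_iff)

text \<open>Both differentials are \<open>ldiff\<close> of the value on the same plot, the one given
  by the inverse of the chart.\<close>

lemma quot_pull_ddiff:
  assumes N: "smooth_manifold N"
  shows "quot_pull N F (ddiff w) = mdiff N (quot_pull N F w)"
proof
  fix c show "quot_pull N F (ddiff w) c = mdiff N (quot_pull N F w) c"
    by (cases "c \<in> atlas N") (simp_all add: quot_pull_chart[OF N] quot_pull_off mdiff_def ddiff_def)
qed

text \<open>Pullbacks from the leaf space are plot invariant, hence leafwise invariant, hence
  basic.\<close>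

lemma quot_pull_basic:
  assumes N: "smooth_manifold N" and F: "singular_foliation N F"
    and \<alpha>: "\<alpha> \<in> dforms (leaf_space_plots N F) k"
  shows "quot_pull N F \<alpha> \<in> basic_forms N F k"
proof -
  note P = singular_foliation_partition[OF F]
  note m = quot_pull_mforms[OF N P \<alpha>]
  show ?thesis
    by (rule leafwise_invariant_imp_basic[OF N F m
          plot_invariant_imp_leafwise[OF N m quot_pull_plot_invariant[OF N P \<alpha>]]])
qed

theorem proposition4p6:
  fixes N0 :: "'a manifold" and F0 :: "'a set set"
    and N1 :: "'b manifold" and F1 :: "'b set set"
  assumes "smooth_manifold N0" and "singular_foliation N0 F0"
    and "smooth_manifold N1" and "singular_foliation N1 F1"
    and "molino_equivalent TYPE('m) N0 F0 N1 F1"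
    and "quot_pull_iso N0 F0"
  shows "quot_pull_iso N1 F1"
proof -
  note N = assms(1,3) and F = assms(2,4)
  note P = F[THEN singular_foliation_partition]
  obtain M :: "'m manifold" and p0 p1 where M: "smooth_manifold M"
    and p0: "surj_submersion_conn M N0 p0" and p1: "surj_submersion_conn M N1 p1"
    and pb: "pullback_foliation M p0 F0 = pullback_foliation M p1 F1"
    using assms(5) unfolding molino_equivalent_def by blast
  have s0: "submersion M N0 p0" "p0 ` mpts M = mpts N0" "smooth_map M N0 p0"
    and s1: "submersion M N1 p1" "p1 ` mpts M = mpts N1" "smooth_map M N1 p1"
    using p0 p1 by (auto simp: surj_submersion_conn_def submersion_def)
  have leaf: "leaf_of F0 (p0 x) = leaf_of F0 (p0 y) \<longleftrightarrow> leaf_of F1 (p1 x) = leaf_of F1 (p1 y)"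
    if "x \<in> mpts M" "y \<in> mpts M" for x y
    using pullback_foliation_same_leaf_iff[OF P(1) equalityD1[OF s0(2)] that]
      pullback_foliation_same_leaf_iff[OF P(2) equalityD1[OF s1(2)] that] pb by simp
  \<comment> \<open>Injectivity, linearity, compatibility with the differentials and basic values
    hold for every singular foliation. Surjectivity is what has to be carried over from N0.\<close>
  have surj: "\<exists>\<alpha>\<in>dforms (leaf_space_plots N1 F1) k. quot_pull N1 F1 \<alpha> = \<beta>"
    if \<beta>: "\<beta> \<in> basic_forms N1 F1 k" for k \<beta>
  proof -
    have \<beta>m: "\<beta> \<in> mforms N1 k" using \<beta> by (simp add: basic_forms_def)
    have \<beta>i: "leafwise_invariant N1 F1 \<beta>" by (rule basic_imp_leafwise_invariant[OF N(2) F(2) \<beta>])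
    have "\<exists>\<gamma>\<in>mforms N0 k. \<forall>l O' f. opn l O' \<longrightarrow> smooth_into l O' M f \<longrightarrow>
        (\<forall>r\<in>O'. \<forall>vs. mpull N0 l O' (\<lambda>s. p0 (f s)) \<gamma> r vs = mpull N1 l O' (\<lambda>s. p1 (f s)) \<beta> r vs)"
      by (rule descend_along_submersion[OF M N p0 s1(3) \<beta>m \<beta>i]) (simp add: leaf[symmetric])
    then obtain \<gamma> where \<gamma>: "\<gamma> \<in> mforms N0 k" and pull': "\<forall>l O' f. opn l O' \<longrightarrow> smooth_into l O' M f \<longrightarrow>
        (\<forall>r\<in>O'. \<forall>vs. mpull N0 l O' (\<lambda>s. p0 (f s)) \<gamma> r vs = mpull N1 l O' (\<lambda>s. p1 (f s)) \<beta> r vs)"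
      by (elim bexE)
    note pull = pull'[rule_format]
    have "leafwise_invariant N0 F0 \<gamma>"
      by (rule transfer_leafwise_invariant[OF M N s0(1,2) s1(3) \<gamma> \<beta>i _ pull]) (simp_all add: leaf)
    then have "\<gamma> \<in> basic_forms N0 F0 k" by (rule leafwise_invariant_imp_basic[OF N(1) F(1) \<gamma>])
    \<comment> \<open>Here the assumption on N0 enters: the transported basic form comes from the
      leaf space, which upgrades leafwise invariance to plot invariance.\<close>
    moreover have "bij_betw (quot_pull N0 F0) (dforms (leaf_space_plots N0 F0) k) (basic_forms N0 F0 k)"
      using assms(6) unfolding quot_pull_iso_def cochain_iso_def by blast
    ultimately obtain \<alpha> where \<alpha>: "\<alpha> \<in> dforms (leaf_space_plots N0 F0) k" "quot_pull N0 F0 \<alpha> = \<gamma>"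
      using bij_betw_imp_surj_on imageE by metis
    have \<gamma>i: "plot_invariant N0 F0 \<gamma>" using quot_pull_plot_invariant[OF N(1) P(1) \<alpha>(1)] \<alpha>(2) by simp
    have "plot_invariant N1 F1 \<beta>"
      by (rule transfer_plot_invariant[OF M N s0(3) s1(1,2) \<gamma>i \<beta>m _ pull]) (simp_all add: leaf)
    then show ?thesis by (rule plot_invariant_imp_quot_pull[OF N(2) P(2) \<beta>m])
  qed
  have "bij_betw (quot_pull N1 F1) (dforms (leaf_space_plots N1 F1) k) (basic_forms N1 F1 k)" for k
    unfolding bij_betw_def
    using quot_pull_inj[OF N(2) P(2)] quot_pull_basic[OF N(2) F(2)] surj[of _ k] by blast
  then show ?thesis
    unfolding quot_pull_iso_def cochain_iso_def
    by (simp add: quot_pull_linear quot_pull_ddiff[OF N(2)])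
qed

end
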